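(* If $X$ is a smooth manifold and the characteristic class of the gerbe $\mathcal L$ over $X$ is the torsion element $[H]\in H^3(X,\mathbf Z)$, then $${}^{\mathcal L}K_{\mathrm{gpd}}(X)\cong K_{[H]}(X).$$
   Context: Groupoid of a manifold. For an open cover $\{U_\alpha\}$ of $X$, the groupoid $\mathcal R\rightrightarrows\mathcal U$ has $\mathcal U=\bigsqcup_\alpha U_\alpha$, $\mathcal R=\bigsqcup_{(\alpha,\beta)}U_\alpha\cap U_\beta$ (ordered pairs), with $s,t$ the inclusions of $U_\alpha\cap U_\beta$ in $U_\alpha$, $U_\beta$, and composition $m:U_{\alpha\beta\gamma}\to U_{\alpha\gamma}$. By the standing convention the cover is of Leray type (all finite intersections contractible). Gerbes. A gerbe over $\mathcal R\rightrightarrows\mathcal U$ is a complex line bundle $\mathcal L\to\mathcal R$ with $i^*\mathcal L\cong\mathcal L^{-1}$ ($i$ the inverse) and a trivialization $\theta_{\mathcal L}:\mathcal R\,{}_t\!\times_s\mathcal R\to\mathrm U(1)$ of $\pi_1^*\mathcal L\otimes\pi_2^*\mathcal L\otimes m^*i^*\mathcal L$ which is a 2-cocycle. Its characteristic class is the class of $\theta_{\mathcal L}$ in $H^2(X,\underline{\mathbf C^*})\cong H^3(X,\mathbf Z)$. Twisted groupoid $K$-theory. An $n$-dimensional $\mathcal L$-twisted bundle is $\mathcal R\times\mathbf C^n\rightrightarrows\mathcal U\times\mathbf C^n$ together with $\rho:\mathcal R\to\mathrm{GL}_n(\mathbf C)$ such that $\rho(i(r))=\rho(r)^{-1}$ and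 $\rho(r')\rho(r)=\theta_{\mathcal L}(r,r')\rho(m(r,r'))$ for composable $(r,r')$. ${}^{\mathcal L}K_{\mathrm{gpd}}(X)$ is the Grothendieck group of isomorphism classes of $\mathcal L$-twisted bundles under Whitney sum. $K_{[H]}(X)$. Since $[H]$ is torsion, of order $n$ say, it lifts along the connecting map $H^2(X;\mathrm U(1))\to H^3(X;\mathbf Z)$ (constant coefficients) to a class represented, for a sufficiently fine cover $\{U_i\}$, by a Čech cocycle $h_{ijk}$ with values in $n$-th roots of unity. An $[H]$-twisted vector bundle is a collection of functions $g_{ij}:U_{ij}\to\mathrm{GL}_m(\mathbf C)$ with $g_{ij}g_{jk}g_{ki}=h_{ijk}\cdot\mathrm{id}$. $K_{[H]}(X)$ is the Grothendieck group of such twisted bundles.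
   Formalization: The 2-cocycle of the gerbe and the cocycle h are assumed alternating (odd permutations of indices invert them), and the transition functions of [H]-twisted bundles are assumed to satisfy g_ji = g_ij^{-1}; without these conventions the claim already fails over a point. *)

theory Defs
  imports
    "HOL-Analysis.Analysis"
    "HOL-Algebra.Multiplicative_Group"
    "Jordan_Normal_Form.Matrix"
begin

section \<open>Smooth manifolds\<close>

text \<open>The sets \<open>S\<close> below are always open. On a finite-dimensional space the recursion
  gives the usual classes: all directional derivatives being continuous means being
  continuously differentiable.\<close>

primrec Ck_on :: "nat \<Rightarrow> 'e::real_normed_vector set \<Rightarrow> ('e \<Rightarrow> 'f::real_normed_vector) \<Rightarrow> bool" where
  "Ck_on 0 S f \<longleftrightarrow> continuous_on S f"
| "Ck_on (Suc k) S f \<longleftrightarrow>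
     (\<forall>x\<in>S. f differentiable (at x)) \<and> (\<forall>v. Ck_on k S (\<lambda>x. frechet_derivative f (at x) v))"

definition smooth_on :: "'e::real_normed_vector set \<Rightarrow> ('e \<Rightarrow> 'f::real_normed_vector) \<Rightarrow> bool" where
  "smooth_on S f \<longleftrightarrow> (\<forall>k. Ck_on k S f)"

text \<open>The model space is an arbitrary finite-dimensional inner product space rather than a type
  of class \<open>euclidean_space\<close>, because the latter excludes dimension zero.\<close>

definition smooth_atlas :: "'a topology \<Rightarrow> ('a set \<times> ('a \<Rightarrow> 'e::real_inner)) set \<Rightarrow> bool" where
  "smooth_atlas X \<A> \<longleftrightarrow>
     (\<Union>(D, \<phi>)\<in>\<A>. D) = topspace X \<and>
     (\<forall>(D, \<phi>)\<in>\<A>. openin X D \<and> open (\<phi> ` D) \<and>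
        homeomorphic_map (subtopology X D) (top_of_set (\<phi> ` D)) \<phi>) \<and>
     (\<forall>(D, \<phi>)\<in>\<A>. \<forall>(E, \<psi>)\<in>\<A>. smooth_on (\<phi> ` (D \<inter> E)) (\<psi> \<circ> inv_into D \<phi>))"

definition smooth_manifold :: "'a topology \<Rightarrow> ('a set \<times> ('a \<Rightarrow> 'e::real_inner)) set \<Rightarrow> bool" where
  "smooth_manifold X \<A> \<longleftrightarrow>
     Hausdorff_space X \<and> second_countable X \<and>
     (\<exists>B::'e set. finite B \<and> span B = UNIV) \<and> smooth_atlas X \<A>"

definition smooth_fun ::
    "('a set \<times> ('a \<Rightarrow> 'e::real_inner)) set \<Rightarrow> 'a set \<Rightarrow> ('a \<Rightarrow> complex) \<Rightarrow> bool" where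
  "smooth_fun \<A> S f \<longleftrightarrow> (\<forall>(D, \<phi>)\<in>\<A>. smooth_on (\<phi> ` (D \<inter> S)) (f \<circ> inv_into D \<phi>))"

definition GL :: "nat \<Rightarrow> complex mat set" where
  "GL n = {M \<in> carrier_mat n n. invertible_mat M}"

definition smooth_GL ::
    "('a set \<times> ('a \<Rightarrow> 'e::real_inner)) set \<Rightarrow> 'a set \<Rightarrow> nat \<Rightarrow> ('a \<Rightarrow> complex mat) \<Rightarrow> bool" where
  "smooth_GL \<A> S n g \<longleftrightarrow>
     (\<forall>x\<in>S. g x \<in> GL n) \<and> (\<forall>i<n. \<forall>j<n. smooth_fun \<A> S (\<lambda>x. g x $$ (i, j)))"


section \<open>Quotient monoids and Grothendieck groups\<close>

definition quot_monoid :: "'b set \<Rightarrow> ('b \<times> 'b) set \<Rightarrow> ('b \<Rightarrow> 'b \<Rightarrow> 'b) \<Rightarrow> 'b \<Rightarrow> 'b set monoid" where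
  "quot_monoid B E f z =
     \<lparr>carrier = B // E, monoid.mult = (\<lambda>P Q. \<Union>a\<in>P. \<Union>b\<in>Q. E `` {f a b}), one = E `` {z}\<rparr>"

definition grothendieck_rel :: "('b, 'c) monoid_scheme \<Rightarrow> (('b \<times> 'b) \<times> ('b \<times> 'b)) set" where
  "grothendieck_rel M =
     {((a, b), (c, d)). a \<in> carrier M \<and> b \<in> carrier M \<and> c \<in> carrier M \<and> d \<in> carrier M \<and>
        (\<exists>e\<in>carrier M. a \<otimes>\<^bsub>M\<^esub> d \<otimes>\<^bsub>M\<^esub> e = c \<otimes>\<^bsub>M\<^esub> b \<otimes>\<^bsub>M\<^esub> e)}"

definition grothendieck_group :: "('b, 'c) monoid_scheme \<Rightarrow> ('b \<times> 'b) set monoid" where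
  "grothendieck_group M =
     quot_monoid (carrier M \<times> carrier M) (grothendieck_rel M)
       (\<lambda>(a, b) (c, d). (a \<otimes>\<^bsub>M\<^esub> c, b \<otimes>\<^bsub>M\<^esub> d)) (\<one>\<^bsub>M\<^esub>, \<one>\<^bsub>M\<^esub>)"


section \<open>Cech cochains\<close>

text \<open>A \<open>p\<close>-cochain of a cover \<open>U\<close> indexed by \<open>I\<close> assigns to each list \<open>s = [i\<^sub>0, \<dots>, i\<^sub>p]\<close> of
  indices a function on \<open>overlap U s\<close>; its values off the overlap are irrelevant. The predicate
  \<open>P\<close> selects the sheaf of coefficients.\<close>

definition overlap :: "('i \<Rightarrow> 'a set) \<Rightarrow> 'i list \<Rightarrow> 'a set" where
  "overlap U s = (\<Inter>i\<in>set s. U i)"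

definition cech_cochain ::
    "'i set \<Rightarrow> ('i \<Rightarrow> 'a set) \<Rightarrow> ('a set \<Rightarrow> ('a \<Rightarrow> 'b) \<Rightarrow> bool) \<Rightarrow> nat \<Rightarrow> ('i list \<Rightarrow> 'a \<Rightarrow> 'b) \<Rightarrow> bool" where
  "cech_cochain I U P p c \<longleftrightarrow> (\<forall>s\<in>lists I. length s = Suc p \<longrightarrow> P (overlap U s) (c s))"

definition coboundary :: "('i list \<Rightarrow> 'a \<Rightarrow> 'b::comm_ring_1) \<Rightarrow> 'i list \<Rightarrow> 'a \<Rightarrow> 'b" where
  "coboundary c s x = (\<Sum>k<length s. (-1) ^ k * c (take k s @ drop (Suc k) s) x)"

definition locally_constant :: "'a topology \<Rightarrow> 'a set \<Rightarrow> ('a \<Rightarrow> 'b) \<Rightarrow> bool" where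
  "locally_constant X S f \<longleftrightarrow> continuous_map (subtopology X S) (discrete_topology UNIV) f"


section \<open>Degree-three integral Cech cohomology\<close>

text \<open>\<open>H\<^sup>3(X;\<int>)\<close> is the colimit of the third cohomology groups of open covers, formed (after
  Godement) over the covers indexed by the points of \<open>X\<close> with \<open>x \<in> W x\<close>. These are cofinal among
  all covers, and a refinement \<open>W' x \<subseteq> W x\<close> acts on cochains by restriction.\<close>

definition pointed_cover :: "'a topology \<Rightarrow> ('a \<Rightarrow> 'a set) \<Rightarrow> bool" where
  "pointed_cover X W \<longleftrightarrow> (\<forall>x\<in>topspace X. openin X (W x) \<and> x \<in> W x)"

definition int_cocycles3 :: "'a topology \<Rightarrow> (('a \<Rightarrow> 'a set) \<times> ('a list \<Rightarrow> 'a \<Rightarrow> int)) set" where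
  "int_cocycles3 X =
     {(W, c). pointed_cover X W \<and> cech_cochain (topspace X) W (locally_constant X) 3 c \<and>
        (\<forall>s\<in>lists (topspace X). length s = 5 \<longrightarrow> (\<forall>x\<in>overlap W s. coboundary c s x = 0))}"

definition int_cohomologous3 :: "'a topology \<Rightarrow>
    ((('a \<Rightarrow> 'a set) \<times> ('a list \<Rightarrow> 'a \<Rightarrow> int)) \<times> (('a \<Rightarrow> 'a set) \<times> ('a list \<Rightarrow> 'a \<Rightarrow> int))) set" where
  "int_cohomologous3 X =
     {((W, c), (W', c')). (W, c) \<in> int_cocycles3 X \<and> (W', c') \<in> int_cocycles3 X \<and>
        (\<exists>V b. pointed_cover X V \<and> (\<forall>x\<in>topspace X. V x \<subseteq> W x \<inter> W' x) \<and>
           cech_cochain (topspace X) V (locally_constant X) 2 b \<and>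
           (\<forall>s\<in>lists (topspace X). length s = 4 \<longrightarrow>
              (\<forall>x\<in>overlap V s. c s x - c' s x = coboundary b s x)))}"

definition cech_H3 :: "'a topology \<Rightarrow> (('a \<Rightarrow> 'a set) \<times> ('a list \<Rightarrow> 'a \<Rightarrow> int)) set monoid" where
  "cech_H3 X = quot_monoid (int_cocycles3 X) (int_cohomologous3 X)
     (\<lambda>(W, c) (W', c'). (\<lambda>x. W x \<inter> W' x, \<lambda>s x. c s x + c' s x)) (\<lambda>x. topspace X, \<lambda>s x. 0)"

text \<open>The class of an integral cocycle of an arbitrary open cover. The refinement map \<open>\<tau>\<close> is
  chosen, but the class does not depend on it.\<close>

definition cech_class3 ::
    "'a topology \<Rightarrow> 'i set \<Rightarrow> ('i \<Rightarrow> 'a set) \<Rightarrow> ('i list \<Rightarrow> 'a \<Rightarrow> int) \<Rightarrow>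
     (('a \<Rightarrow> 'a set) \<times> ('a list \<Rightarrow> 'a \<Rightarrow> int)) set" where
  "cech_class3 X I U c =
     (let \<tau> = (SOME \<tau>. \<forall>x\<in>topspace X. \<tau> x \<in> I \<and> x \<in> U (\<tau> x))
      in int_cohomologous3 X `` {(\<lambda>x. U (\<tau> x), \<lambda>s. c (map \<tau> s))})"

text \<open>\<open>H\<close> is the image of the class of the multiplicative 2-cocycle \<open>\<theta>\<close> under the connecting map
  of an exponential sequence \<open>0 \<rightarrow> \<int> \<rightarrow> P \<rightarrow> exp (2 \<pi> i P) \<rightarrow> 1\<close>: lift \<open>\<theta>\<close> to a cochain \<open>f\<close> with
  values in \<open>P\<close> and take the class of its coboundary. With \<open>P\<close> the smooth complex functions this
  is the isomorphism from degree two with coefficients in the sheaf of nowhere vanishing functions.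
  With \<open>P\<close> the locally constant functions and \<open>\<theta>\<close> of modulus one, \<open>f\<close> is automatically
  real and this is the connecting map for constant coefficients \<open>U(1)\<close>. On a cover with
  contractible overlaps, lifts exist without refining the cover.\<close>

definition connecting_image ::
    "'a topology \<Rightarrow> ('a set \<Rightarrow> ('a \<Rightarrow> complex) \<Rightarrow> bool) \<Rightarrow> 'i set \<Rightarrow> ('i \<Rightarrow> 'a set) \<Rightarrow>
     ('i \<Rightarrow> 'i \<Rightarrow> 'i \<Rightarrow> 'a \<Rightarrow> complex) \<Rightarrow> (('a \<Rightarrow> 'a set) \<times> ('a list \<Rightarrow> 'a \<Rightarrow> int)) set \<Rightarrow> bool" where
  "connecting_image X P I U \<theta> H \<longleftrightarrow>
     (\<exists>f c. cech_cochain I U P 2 f \<and>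
        (\<forall>i\<in>I. \<forall>j\<in>I. \<forall>k\<in>I. \<forall>x\<in>U i \<inter> U j \<inter> U k. exp (2 * pi * \<i> * f [i, j, k] x) = \<theta> i j k x) \<and>
        cech_cochain I U (locally_constant X) 3 c \<and>
        (\<forall>s\<in>lists I. length s = 4 \<longrightarrow>
           (\<forall>x\<in>overlap U s. complex_of_int (c s x) = coboundary f s x)) \<and>
        H = cech_class3 X I U c)"


section \<open>The groupoid of a cover\<close>

definition leray_cover :: "'a topology \<Rightarrow> 'i set \<Rightarrow> ('i \<Rightarrow> 'a set) \<Rightarrow> bool" where
  "leray_cover X I U \<longleftrightarrow>
     (\<forall>i\<in>I. openin X (U i)) \<and> (\<Union>i\<in>I. U i) = topspace X \<and>
     (\<forall>F. F \<subseteq> I \<and> finite F \<and> F \<noteq> {} \<longrightarrow> contractible_space (subtopology X (\<Inter>i\<in>F. U i)))"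

text \<open>The arrow \<open>(\<alpha>, \<beta>, x)\<close> is the point \<open>x\<close> in the \<open>(\<alpha>, \<beta>)\<close> summand, with source the object
  \<open>(\<alpha>, x)\<close> and target the object \<open>(\<beta>, x)\<close>.\<close>

definition gpd_arrows :: "'i set \<Rightarrow> ('i \<Rightarrow> 'a set) \<Rightarrow> ('i \<times> 'i \<times> 'a) set" where
  "gpd_arrows I U = {(\<alpha>, \<beta>, x). \<alpha> \<in> I \<and> \<beta> \<in> I \<and> x \<in> U \<alpha> \<inter> U \<beta>}"

fun gpd_src :: "'i \<times> 'i \<times> 'a \<Rightarrow> 'i \<times> 'a" where
  "gpd_src (\<alpha>, \<beta>, x) = (\<alpha>, x)"

fun gpd_tgt :: "'i \<times> 'i \<times> 'a \<Rightarrow> 'i \<times> 'a" where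
  "gpd_tgt (\<alpha>, \<beta>, x) = (\<beta>, x)"

fun gpd_inv :: "'i \<times> 'i \<times> 'a \<Rightarrow> 'i \<times> 'i \<times> 'a" where
  "gpd_inv (\<alpha>, \<beta>, x) = (\<beta>, \<alpha>, x)"

fun gpd_mult :: "'i \<times> 'i \<times> 'a \<Rightarrow> 'i \<times> 'i \<times> 'a \<Rightarrow> 'i \<times> 'i \<times> 'a" where
  "gpd_mult (\<alpha>, \<beta>, x) (\<beta>', \<gamma>, y) = (\<alpha>, \<gamma>, x)"

definition gpd_composable :: "'i set \<Rightarrow> ('i \<Rightarrow> 'a set) \<Rightarrow> (('i \<times> 'i \<times> 'a) \<times> ('i \<times> 'i \<times> 'a)) set" where
  "gpd_composable I U =
     {(r, r'). r \<in> gpd_arrows I U \<and> r' \<in> gpd_arrows I U \<and> gpd_tgt r = gpd_src r'}"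


section \<open>Gerbes and groupoid K-theory\<close>

text \<open>The arrow space is a disjoint union of contractible pieces, so the line bundle of a gerbe is
  the trivial one, trivialized compatibly with the duality between the lines over \<open>r\<close> and over
  \<open>gpd_inv r\<close>; what remains of the gerbe is the function \<open>\<theta>\<close>. The last two conditions express
  this duality. The lines whose tensor product \<open>\<theta>\<close> trivializes are those over \<open>r\<close>, \<open>r'\<close> and
  \<open>gpd_inv (gpd_mult r r')\<close>. Permuting the three lines cyclically changes nothing, and reversing
  the three arrows dualizes the product. Thus \<open>\<theta>\<close> is an alternating cocycle in the sense that an
  odd permutation of its three indices inverts it; repeated indices may give the value \<open>-1\<close>.\<close>

definition gerbe :: "('a set \<times> ('a \<Rightarrow> 'e::real_inner)) set \<Rightarrow> 'i set \<Rightarrow> ('i \<Rightarrow> 'a set) \<Rightarrow>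
    ('i \<times> 'i \<times> 'a \<Rightarrow> 'i \<times> 'i \<times> 'a \<Rightarrow> complex) \<Rightarrow> bool" where
  "gerbe \<A> I U \<theta> \<longleftrightarrow>
     (\<forall>\<alpha>\<in>I. \<forall>\<beta>\<in>I. \<forall>\<gamma>\<in>I. smooth_fun \<A> (U \<alpha> \<inter> U \<beta> \<inter> U \<gamma>) (\<lambda>x. \<theta> (\<alpha>, \<beta>, x) (\<beta>, \<gamma>, x))) \<and>
     (\<forall>(r, r')\<in>gpd_composable I U. cmod (\<theta> r r') = 1) \<and>
     (\<forall>(r, r')\<in>gpd_composable I U. \<forall>r''. (r', r'') \<in> gpd_composable I U \<longrightarrow>
        \<theta> r' r'' * \<theta> r (gpd_mult r' r'') = \<theta> r r' * \<theta> (gpd_mult r r') r'') \<and>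
     (\<forall>(r, r')\<in>gpd_composable I U. \<theta> r' (gpd_inv (gpd_mult r r')) = \<theta> r r') \<and>
     (\<forall>(r, r')\<in>gpd_composable I U. \<theta> (gpd_inv r') (gpd_inv r) = inverse (\<theta> r r'))"

definition characteristic_class :: "'a topology \<Rightarrow> ('a set \<times> ('a \<Rightarrow> 'e::real_inner)) set \<Rightarrow>
    'i set \<Rightarrow> ('i \<Rightarrow> 'a set) \<Rightarrow> ('i \<times> 'i \<times> 'a \<Rightarrow> 'i \<times> 'i \<times> 'a \<Rightarrow> complex) \<Rightarrow>
    (('a \<Rightarrow> 'a set) \<times> ('a list \<Rightarrow> 'a \<Rightarrow> int)) set \<Rightarrow> bool" where
  "characteristic_class X \<A> I U \<theta> H \<longleftrightarrow>
     connecting_image X (smooth_fun \<A>) I U (\<lambda>\<alpha> \<beta> \<gamma> x. \<theta> (\<alpha>, \<beta>, x) (\<beta>, \<gamma>, x)) H"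

definition gpd_twisted_bundles :: "('a set \<times> ('a \<Rightarrow> 'e::real_inner)) set \<Rightarrow> 'i set \<Rightarrow> ('i \<Rightarrow> 'a set) \<Rightarrow>
    ('i \<times> 'i \<times> 'a \<Rightarrow> 'i \<times> 'i \<times> 'a \<Rightarrow> complex) \<Rightarrow> (nat \<times> ('i \<times> 'i \<times> 'a \<Rightarrow> complex mat)) set" where
  "gpd_twisted_bundles \<A> I U \<theta> =
     {(n, \<rho>).
        (\<forall>\<alpha>\<in>I. \<forall>\<beta>\<in>I. smooth_GL \<A> (U \<alpha> \<inter> U \<beta>) n (\<lambda>x. \<rho> (\<alpha>, \<beta>, x))) \<and>
        (\<forall>r\<in>gpd_arrows I U. \<rho> r * \<rho> (gpd_inv r) = 1\<^sub>m n) \<and>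
        (\<forall>(r, r')\<in>gpd_composable I U. \<rho> r' * \<rho> r = \<theta> r r' \<cdot>\<^sub>m \<rho> (gpd_mult r r'))}"

definition gpd_twisted_iso :: "('a set \<times> ('a \<Rightarrow> 'e::real_inner)) set \<Rightarrow> 'i set \<Rightarrow> ('i \<Rightarrow> 'a set) \<Rightarrow>
    ('i \<times> 'i \<times> 'a \<Rightarrow> 'i \<times> 'i \<times> 'a \<Rightarrow> complex) \<Rightarrow>
    ((nat \<times> ('i \<times> 'i \<times> 'a \<Rightarrow> complex mat)) \<times> (nat \<times> ('i \<times> 'i \<times> 'a \<Rightarrow> complex mat))) set" where
  "gpd_twisted_iso \<A> I U \<theta> =
     {((n, \<rho>), (n', \<rho>')).
        (n, \<rho>) \<in> gpd_twisted_bundles \<A> I U \<theta> \<and> (n', \<rho>') \<in> gpd_twisted_bundles \<A> I U \<theta> \<and> n = n' \<and>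
        (\<exists>f. (\<forall>\<alpha>\<in>I. smooth_GL \<A> (U \<alpha>) n (\<lambda>x. f (\<alpha>, x))) \<and>
           (\<forall>r\<in>gpd_arrows I U. f (gpd_tgt r) * \<rho> r = \<rho>' r * f (gpd_src r)))}"

definition block_sum :: "nat \<Rightarrow> nat \<Rightarrow> complex mat \<Rightarrow> complex mat \<Rightarrow> complex mat" where
  "block_sum n m M N = four_block_mat M (0\<^sub>m n m) (0\<^sub>m m n) N"

definition gpd_K :: "('a set \<times> ('a \<Rightarrow> 'e::real_inner)) set \<Rightarrow> 'i set \<Rightarrow> ('i \<Rightarrow> 'a set) \<Rightarrow>
    ('i \<times> 'i \<times> 'a \<Rightarrow> 'i \<times> 'i \<times> 'a \<Rightarrow> complex) \<Rightarrow>
    ((nat \<times> ('i \<times> 'i \<times> 'a \<Rightarrow> complex mat)) set \<times> (nat \<times> ('i \<times> 'i \<times> 'a \<Rightarrow> complex mat)) set) set monoid" where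
  "gpd_K \<A> I U \<theta> = grothendieck_group
     (quot_monoid (gpd_twisted_bundles \<A> I U \<theta>) (gpd_twisted_iso \<A> I U \<theta>)
        (\<lambda>(n, \<rho>) (m, \<sigma>). (n + m, \<lambda>r. block_sum n m (\<rho> r) (\<sigma> r))) (0, \<lambda>r. 1\<^sub>m 0))"


section \<open>K-theory twisted by a torsion class\<close>

text \<open>A twisting cocycle with values in the \<open>n\<close>-th roots of unity. Transition functions satisfy the
  usual convention \<open>g\<^sub>j\<^sub>i = g\<^sub>i\<^sub>j\<^sup>-\<^sup>1\<close>, which forces \<open>h\<close> to be alternating.\<close>

definition root_cocycle ::
    "'a topology \<Rightarrow> nat \<Rightarrow> 'j set \<Rightarrow> ('j \<Rightarrow> 'a set) \<Rightarrow> ('j \<Rightarrow> 'j \<Rightarrow> 'j \<Rightarrow> 'a \<Rightarrow> complex) \<Rightarrow> bool" where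
  "root_cocycle X n J V h \<longleftrightarrow>
     (\<forall>i\<in>J. \<forall>j\<in>J. \<forall>k\<in>J. locally_constant X (V i \<inter> V j \<inter> V k) (h i j k)) \<and>
     (\<forall>i\<in>J. \<forall>j\<in>J. \<forall>k\<in>J. \<forall>x\<in>V i \<inter> V j \<inter> V k.
        h i j k x ^ n = 1 \<and> h j k i x = h i j k x \<and> h k j i x = inverse (h i j k x)) \<and>
     (\<forall>i\<in>J. \<forall>j\<in>J. \<forall>k\<in>J. \<forall>l\<in>J. \<forall>x\<in>V i \<inter> V j \<inter> V k \<inter> V l.
        h j k l x * h i j l x = h i k l x * h i j k x)"

definition twisted_bundles :: "('a set \<times> ('a \<Rightarrow> 'e::real_inner)) set \<Rightarrow> 'j set \<Rightarrow> ('j \<Rightarrow> 'a set) \<Rightarrow>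
    ('j \<Rightarrow> 'j \<Rightarrow> 'j \<Rightarrow> 'a \<Rightarrow> complex) \<Rightarrow> (nat \<times> ('j \<Rightarrow> 'j \<Rightarrow> 'a \<Rightarrow> complex mat)) set" where
  "twisted_bundles \<A> J V h =
     {(m, g).
        (\<forall>i\<in>J. \<forall>j\<in>J. smooth_GL \<A> (V i \<inter> V j) m (g i j)) \<and>
        (\<forall>i\<in>J. \<forall>j\<in>J. \<forall>x\<in>V i \<inter> V j. g i j x * g j i x = 1\<^sub>m m) \<and>
        (\<forall>i\<in>J. \<forall>j\<in>J. \<forall>k\<in>J. \<forall>x\<in>V i \<inter> V j \<inter> V k.
           g i j x * g j k x * g k i x = h i j k x \<cdot>\<^sub>m 1\<^sub>m m)}"

definition twisted_iso :: "('a set \<times> ('a \<Rightarrow> 'e::real_inner)) set \<Rightarrow> 'j set \<Rightarrow> ('j \<Rightarrow> 'a set) \<Rightarrow>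
    ('j \<Rightarrow> 'j \<Rightarrow> 'j \<Rightarrow> 'a \<Rightarrow> complex) \<Rightarrow>
    ((nat \<times> ('j \<Rightarrow> 'j \<Rightarrow> 'a \<Rightarrow> complex mat)) \<times> (nat \<times> ('j \<Rightarrow> 'j \<Rightarrow> 'a \<Rightarrow> complex mat))) set" where
  "twisted_iso \<A> J V h =
     {((m, g), (m', g')).
        (m, g) \<in> twisted_bundles \<A> J V h \<and> (m', g') \<in> twisted_bundles \<A> J V h \<and> m = m' \<and>
        (\<exists>f. (\<forall>i\<in>J. smooth_GL \<A> (V i) m (f i)) \<and>
           (\<forall>i\<in>J. \<forall>j\<in>J. \<forall>x\<in>V i \<inter> V j. f i x * g i j x = g' i j x * f j x))}"

definition twisted_K :: "('a set \<times> ('a \<Rightarrow> 'e::real_inner)) set \<Rightarrow> 'j set \<Rightarrow> ('j \<Rightarrow> 'a set) \<Rightarrow>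
    ('j \<Rightarrow> 'j \<Rightarrow> 'j \<Rightarrow> 'a \<Rightarrow> complex) \<Rightarrow>
    ((nat \<times> ('j \<Rightarrow> 'j \<Rightarrow> 'a \<Rightarrow> complex mat)) set \<times> (nat \<times> ('j \<Rightarrow> 'j \<Rightarrow> 'a \<Rightarrow> complex mat)) set) set monoid" where
  "twisted_K \<A> J V h = grothendieck_group
     (quot_monoid (twisted_bundles \<A> J V h) (twisted_iso \<A> J V h)
        (\<lambda>(m, g) (m', g'). (m + m', \<lambda>i j x. block_sum m m' (g i j x) (g' i j x))) (0, \<lambda>i j x. 1\<^sub>m 0))"

text \<open>Data presenting the group twisted by a class \<open>H\<close> of order \<open>n\<close>: a Leray cover \<open>V\<close>, and
  on it a cocycle of \<open>n\<close>-th roots of unity whose class in \<open>H\<^sup>2(X;U(1))\<close> lifts \<open>H\<close>.\<close>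

definition torsion_twist :: "'a topology \<Rightarrow> (('a \<Rightarrow> 'a set) \<times> ('a list \<Rightarrow> 'a \<Rightarrow> int)) set \<Rightarrow>
    'j set \<Rightarrow> ('j \<Rightarrow> 'a set) \<Rightarrow> ('j \<Rightarrow> 'j \<Rightarrow> 'j \<Rightarrow> 'a \<Rightarrow> complex) \<Rightarrow> bool" where
  "torsion_twist X H J V h \<longleftrightarrow>
     leray_cover X J V \<and> root_cocycle X (group.ord (cech_H3 X) H) J V h \<and>
     connecting_image X (locally_constant X) J V h H"

end

theory Submission
  imports Defs "Jordan_Normal_Form.Determinant"
begin

text \<open>Both K-groups are built from matrices of smooth functions that satisfy a cocycle condition up to a scalar
  twisting. On the groupoid of a cover the transition matrices compose in the opposite order; transposing them
  identifies the bundles over the groupoid with the bundles twisted by \<open>\<theta>\<close> over the same cover, for the convention that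
  is used with roots of unity (\<open>gpd_mult_iso\<close>). What has to be compared then are bundles twisted by \<open>\<theta>\<close> on one Leray
  cover and bundles twisted by \<open>h\<close> on another one.

  Both twistings have the same image in the third integral cohomology. On a common refinement, indexed by the points of
  the manifold, logarithms of the two twistings therefore differ by an integral cochain and a smooth additive cocycle.
  Smooth partitions of unity bound that cocycle (\<open>smooth_cocycle_coboundary\<close>), so on the refinement the ratio of the
  twistings is the coboundary of a smooth function \<open>l\<close> without zeros. Since both twistings are alternating, \<open>l\<close> is
  automatically antisymmetric (\<open>scaling_of_coboundary\<close>), and multiplying transition matrices by \<open>l\<close> turns bundles of the
  one kind into bundles of the other kind (\<open>mult_iso_scale\<close>).

  It remains to see that passing from a Leray cover to a refinement changes nothing (\<open>mult_iso_refinement\<close>). Isomorphisms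
  of restrictions extend by conjugation with transition matrices (\<open>extend_iso\<close>). A bundle on the refinement extends to the
  original cover (\<open>extend_bundle\<close>) because on a single set of that cover the twisting can be removed, which leaves an
  ordinary vector bundle on a contractible open set; such a bundle is trivial (\<open>smooth_trivialisation\<close>).

  The triviality is the geometric heart of the matter. A partition of unity averages the transition matrices to an
  operator that transports vectors between nearby points and is the identity on the diagonal. Following the path along
  which a point is contracted, in steps whose length depends continuously on the point, the composed transports give a
  continuous trivialisation (\<open>topological_trivialisation\<close>). A second average, over a cover on which that trivialisation is
  nearly constant, makes it smooth.

  Finally, an equivalence of categories compatible with direct sums induces an isomorphism of Grothendieck groups
  (\<open>mult_iso_quot\<close>, \<open>mult_iso_grothendieck\<close>).\<close>

no_notation scalar_prod (infix "\<bullet>" 70)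
hide_const (open) Determinants.det

section \<open>Calculus of smooth functions on inner product spaces\<close>

lemma Ck_on_cong:
  assumes "open S" "\<And>x. x \<in> S \<Longrightarrow> f x = g x" "Ck_on k S f"
  shows "Ck_on k S g"
  using assms(2,3)
proof (induction k arbitrary: f g)
  case 0
  then show ?case using continuous_on_eq[of S f g] by simp
next
  case (Suc k)
  have d: "g differentiable (at x)" if "x \<in> S" for x
  proof -
    have "(f has_derivative frechet_derivative f (at x)) (at x)"
      using Suc.prems that by (simp add: frechet_derivative_works)
    then have "(g has_derivative frechet_derivative f (at x)) (at x)"
      by (rule has_derivative_transform_within_open[OF _ assms(1) that]) (rule Suc.prems(1))
    then show ?thesis by (auto simp: differentiable_def)
  qed
  have D: "frechet_derivative f (at x) = frechet_derivative g (at x)" if "x \<in> S" for x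
    using frechet_derivative_transform_within_open[OF _ assms(1) that Suc.prems(1)] Suc.prems(2) that
    by simp
  have "Ck_on k S (\<lambda>x. frechet_derivative g (at x) v)" for v
    by (rule Suc.IH[of "\<lambda>x. frechet_derivative f (at x) v"]) (use D Suc.prems(2) in auto)
  then show ?case using d by simp
qed

lemma Ck_on_subset: "Ck_on k S f \<Longrightarrow> T \<subseteq> S \<Longrightarrow> Ck_on k T f"
  by (induction k arbitrary: f) (auto intro: continuous_on_subset)

lemma Ck_on_Suc_imp: "Ck_on (Suc k) S f \<Longrightarrow> Ck_on k S f"
proof (induction k arbitrary: f)
  case 0
  then show ?case
    by (auto intro!: continuous_at_imp_continuous_on differentiable_imp_continuous_within)
next
  case (Suc k)
  from Suc.prems have "\<And>v. Ck_on (Suc k) S (\<lambda>x. frechet_derivative f (at x) v)"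
    by (subst (asm) Ck_on.simps(2)) blast
  then have "\<And>v. Ck_on k S (\<lambda>x. frechet_derivative f (at x) v)"
    by (rule Suc.IH)
  then show ?case using Suc.prems by simp
qed

lemma Ck_on_SucI:
  assumes "open S" "\<And>x. x \<in> S \<Longrightarrow> (f has_derivative D x) (at x)" "\<And>v. Ck_on k S (\<lambda>x. D x v)"
  shows "Ck_on (Suc k) S f"
proof -
  have D: "D x = frechet_derivative f (at x)" if "x \<in> S" for x
    using assms(2)[OF that] by (rule frechet_derivative_at)
  have "Ck_on k S (\<lambda>x. frechet_derivative f (at x) v)" for v
    by (rule Ck_on_cong[OF assms(1) _ assms(3)[of v]]) (simp only: D)
  then show ?thesis using assms(2) by (auto intro: differentiableI)
qed

lemma Ck_on_SucD:
  assumes "Ck_on (Suc k) S f"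
  shows "x \<in> S \<Longrightarrow> (f has_derivative frechet_derivative f (at x)) (at x)"
    and "Ck_on k S (\<lambda>x. frechet_derivative f (at x) v)"
  using assms by (simp_all add: frechet_derivative_works)

lemma Ck_on_const: "open S \<Longrightarrow> Ck_on k S (\<lambda>x. c)"
proof (induction k arbitrary: c)
  case (Suc k)
  show ?case
    by (rule Ck_on_SucI[where D = "\<lambda>x v. 0"]) (use Suc in auto)
qed auto

lemma Ck_on_linear:
  assumes "bounded_linear L" "open S" "Ck_on k S f"
  shows "Ck_on k S (\<lambda>x. L (f x))"
  using assms(3)
proof (induction k arbitrary: f)
  case 0
  then show ?case by (simp add: bounded_linear.continuous_on[OF assms(1)])
next
  case (Suc k)
  show ?case
    by (rule Ck_on_SucI[OF assms(2), where D = "\<lambda>x v. L (frechet_derivative f (at x) v)"])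
      (use Suc Ck_on_SucD[OF Suc.prems] in \<open>auto intro: bounded_linear.has_derivative[OF assms(1)]\<close>)
qed

lemma Ck_on_id: "open S \<Longrightarrow> Ck_on k S (\<lambda>x. x)"
proof (cases k)
  case (Suc k)
  assume "open S"
  then show ?thesis unfolding Suc
    by (intro Ck_on_SucI[where D = "\<lambda>x v. v"]) (auto intro: Ck_on_const)
qed auto

lemma Ck_on_add:
  assumes "open S" "Ck_on k S f" "Ck_on k S g"
  shows "Ck_on k S (\<lambda>x. f x + g x)"
  using assms(2,3)
proof (induction k arbitrary: f g)
  case 0
  then show ?case by (auto intro: continuous_on_add)
next
  case (Suc k)
  show ?case
    by (rule Ck_on_SucI[OF assms(1), where
          D = "\<lambda>x v. frechet_derivative f (at x) v + frechet_derivative g (at x) v"])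
      (use Suc.IH Ck_on_SucD[OF Suc.prems(1)] Ck_on_SucD[OF Suc.prems(2)]
        in \<open>auto intro: has_derivative_add\<close>)
qed

lemma Ck_on_sum:
  assumes "open S" "\<And>a. a \<in> A \<Longrightarrow> Ck_on k S (f a)"
  shows "Ck_on k S (\<lambda>x. \<Sum>a\<in>A. f a x)"
  using assms(2)
  by (induction A rule: infinite_finite_induct) (auto intro: Ck_on_const Ck_on_add assms(1))

lemma Ck_on_bilinear:
  assumes "bounded_bilinear b" "open S" "Ck_on k S f" "Ck_on k S g"
  shows "Ck_on k S (\<lambda>x. b (f x) (g x))"
  using assms(3,4)
proof (induction k arbitrary: f g)
  case 0
  then show ?case by (auto intro: bounded_bilinear.continuous_on[OF assms(1)])
next
  case (Suc k)
  show ?case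
    by (rule Ck_on_SucI[OF assms(2), where
          D = "\<lambda>x v. b (f x) (frechet_derivative g (at x) v) + b (frechet_derivative f (at x) v) (g x)"])
      (use Ck_on_SucD[OF Suc.prems(1)] Ck_on_SucD[OF Suc.prems(2)]
        Suc.prems[THEN Ck_on_Suc_imp]
        in \<open>auto intro!: bounded_bilinear.FDERIV[OF assms(1)] Ck_on_add[OF assms(2)] Suc.IH\<close>)
qed

text \<open>Expanding the inner derivative in a finite orthonormal basis turns the chain rule into a sum
  of products of functions already known to be one order less differentiable, which is what the
  induction needs.\<close>

lemma Ck_on_compose:
  fixes g :: "'e::real_normed_vector \<Rightarrow> 'd::real_inner" and B :: "'d set"
  assumes B: "finite B" "\<And>v. v = (\<Sum>b\<in>B. (v \<bullet> b) *\<^sub>R b)"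
    and "open S" "open T" "g ` S \<subseteq> T" "Ck_on k S g" "Ck_on k T f"
  shows "Ck_on k S (\<lambda>x. f (g x))"
  using assms(6,7)
proof (induction k arbitrary: f)
  case 0
  then show ?case using assms(5) by (auto intro: continuous_on_compose2)
next
  case (Suc k)
  note g = Ck_on_SucD[OF Suc.prems(1)] and f = Ck_on_SucD[OF Suc.prems(2)]
  let ?D = "\<lambda>x v. \<Sum>b\<in>B. (frechet_derivative g (at x) v \<bullet> b) *\<^sub>R frechet_derivative f (at (g x)) b"
  show ?case
  proof (rule Ck_on_SucI[OF assms(3), where D = ?D])
    fix x assume x: "x \<in> S"
    have lin: "linear (frechet_derivative f (at (g x)))"
      by (rule has_derivative_linear[OF f(1)]) (use x assms(5) in auto)
    have ex: "frechet_derivative f (at (g x)) v = (\<Sum>b\<in>B. (v \<bullet> b) *\<^sub>R frechet_derivative f (at (g x)) b)" for v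
      by (subst B(2)[of v]) (simp add: linear_sum[OF lin] linear_cmul[OF lin])
    have "?D x = frechet_derivative f (at (g x)) \<circ> frechet_derivative g (at x)"
      unfolding o_def by (rule ext, rule ex[symmetric])
    then show "((\<lambda>x. f (g x)) has_derivative ?D x) (at x)"
      using diff_chain_at[OF g(1)[OF x] f(1)[of "g x"]] x assms(5) by (auto simp: o_def)
  next
    fix v
    show "Ck_on k S (\<lambda>x. ?D x v)"
      by (intro Ck_on_sum Ck_on_bilinear[OF bounded_bilinear_scaleR] assms(3)
          Ck_on_linear[OF bounded_linear_inner_left] g(2) Suc.IH f(2) Ck_on_Suc_imp[OF Suc.prems(1)])
  qed
qed

lemma Ck_on_exp: "Ck_on k UNIV (exp :: complex \<Rightarrow> complex)"
proof (induction k)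
  case (Suc k)
  show ?case
    by (rule Ck_on_SucI[where D = "\<lambda>x v. exp x * v"])
      (use Suc in \<open>auto intro!: Ck_on_linear[OF bounded_linear_mult_left]
         DERIV_exp[unfolded has_field_derivative_def]\<close>)
qed (simp add: continuous_at_imp_continuous_on)

lemma Ck_on_inverse: "Ck_on k (-{0}) (inverse :: complex \<Rightarrow> complex)"
proof (induction k)
  case (Suc k)
  show ?case
    by (rule Ck_on_SucI[where D = "\<lambda>x v. - (inverse x * v * inverse x)"])
      (use Suc in \<open>auto intro!: Ck_on_linear[OF bounded_linear_minus] Ck_on_bilinear[OF bounded_bilinear_mult]
          Ck_on_linear[OF bounded_linear_mult_left] has_derivative_inverse'\<close>)
qed (use continuous_on_inverse[OF continuous_on_id, of "-{0::complex}"] in simp)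

text \<open>The functions \<open>t\<^sup>-\<^sup>m exp (- 1 / t)\<close>, extended by zero, are closed under differentiation up to linear
  combinations; hence all of them are smooth.\<close>

definition flat :: "nat \<Rightarrow> real \<Rightarrow> real" where
  "flat m t = (if t \<le> 0 then 0 else exp (- 1 / t) / t ^ m)"

lemma flat_tendsto_0: "(flat m \<longlongrightarrow> 0) (at 0)"
proof -
  have r: "((\<lambda>t::real. inverse t ^ m / exp (inverse t)) \<longlongrightarrow> 0) (at_right 0)"
    by (rule filterlim_compose[OF tendsto_power_div_exp_0 filterlim_inverse_at_top_right])
  have "(flat m \<longlongrightarrow> 0) (at_right 0)"
    by (rule Lim_transform_eventually[OF r])
      (auto simp: flat_def eventually_at_filter exp_minus field_simps intro!: always_eventually)
  moreover have "(flat m \<longlongrightarrow> 0) (at_left 0)"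
    by (rule tendsto_eventually)
      (auto simp: flat_def eventually_at_filter intro!: always_eventually)
  ultimately show ?thesis by (intro filterlim_split_at)
qed

lemma flat_has_derivative:
  "(flat m has_derivative (\<lambda>v. (flat (m + 2) t - m * flat (m + 1) t) * v)) (at t)"
proof -
  consider "t < 0" | "t = 0" | "t > 0" by linarith
  then show ?thesis
  proof cases
    case 1
    have "((\<lambda>x. 0) has_derivative (\<lambda>v. 0)) (at t)" by simp
    then have "(flat m has_derivative (\<lambda>v. 0)) (at t)"
      by (rule has_derivative_transform_within_open[where s = "{..<0}"]) (use 1 in \<open>auto simp: flat_def\<close>)
    then show ?thesis using 1 by (simp add: flat_def)
  next
    case 2
    have "((\<lambda>y. (flat m y - flat m 0) / (y - 0)) \<longlongrightarrow> 0) (at 0)"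
      by (rule Lim_transform_eventually[OF flat_tendsto_0[of "Suc m"]])
        (auto simp: flat_def eventually_at_topological intro!: exI[of _ UNIV])
    then have "(flat m has_field_derivative 0) (at 0)"
      by (simp add: has_field_derivative_iff)
    moreover have "(*) 0 = (\<lambda>v. (flat (m + 2) t - m * flat (m + 1) t) * v)"
      using 2 by (auto simp: flat_def)
    ultimately show ?thesis using 2 by (simp only: has_field_derivative_def)
  next
    case 3
    have "((\<lambda>t. exp (- 1 / t) / t ^ m) has_real_derivative
       ((exp (- 1 / t) * (1 / t\<^sup>2)) * t ^ m - exp (- 1 / t) * (m * t ^ (m - 1))) / (t ^ m * t ^ m)) (at t)"
      using 3 by (auto intro!: derivative_eq_intros simp: power2_eq_square)
    also have "((exp (- 1 / t) * (1 / t\<^sup>2)) * t ^ m - exp (- 1 / t) * (m * t ^ (m - 1))) / (t ^ m * t ^ m)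
       = flat (m + 2) t - m * flat (m + 1) t"
      using 3 by (cases m) (simp_all add: flat_def field_simps power2_eq_square)
    finally have "((\<lambda>t. exp (- 1 / t) / t ^ m) has_derivative (\<lambda>v. (flat (m + 2) t - m * flat (m + 1) t) * v)) (at t)"
      by (simp add: has_field_derivative_def)
    then show ?thesis
      by (rule has_derivative_transform_within_open[where s = "{0<..}"]) (use 3 in \<open>auto simp: flat_def\<close>)
  qed
qed

lemma Ck_on_flat: "Ck_on k UNIV (flat m)"
proof (induction k arbitrary: m)
  case 0
  have "isCont (flat m) t" for t
    by (rule has_derivative_continuous[OF flat_has_derivative])
  then show ?case by (simp add: continuous_at_imp_continuous_on)
next
  case (Suc k)
  show ?case
  proof (rule Ck_on_SucI[OF open_UNIV flat_has_derivative])
    fix v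
    have "Ck_on k UNIV (\<lambda>t. (flat (m + 2) t + (- real m) * flat (m + 1) t) * v)"
      by (intro Ck_on_linear[OF bounded_linear_mult_left] Ck_on_add Suc.IH open_UNIV
          Ck_on_linear[OF bounded_linear_mult_right])
    then show "Ck_on k UNIV (\<lambda>t. (flat (m + 2) t - m * flat (m + 1) t) * v)"
      by simp
  qed
qed

lemma flat_pos_iff: "0 < flat m t \<longleftrightarrow> 0 < t"
  by (auto simp: flat_def)

lemma flat_nonneg: "0 \<le> flat m t"
  by (auto simp: flat_def)

lemma real_expand: "v = (\<Sum>b\<in>{1}. (v \<bullet> b) *\<^sub>R b)" for v :: real
  by simp

lemma complex_expand: "v = (\<Sum>b\<in>Basis. (v \<bullet> b) *\<^sub>R b)" for v :: complex
  by (rule euclidean_representation[symmetric])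

lemma orthonormal_expansion:
  fixes B :: "'e::real_inner set"
  assumes "finite B" "span B = UNIV"
  obtains C :: "'e set" where "finite C" "\<And>v. v = (\<Sum>b\<in>C. (v \<bullet> b) *\<^sub>R b)"
proof -
  obtain C where C: "finite C" "span C = (UNIV :: 'e set)" "pairwise Linear_Algebra.orthogonal C"
    using basis_orthogonal[OF assms(1)] assms(2) by auto
  define D where "D = (\<lambda>x. x /\<^sub>R norm x) ` (C - {0})"
  have fD: "finite D" using C D_def by auto
  have C0: "span (C - {0}) = (UNIV :: 'e set)" using C(2) by (metis span_delete_0)
  have "v = (\<Sum>b\<in>D. (v \<bullet> b) *\<^sub>R b)" for v
  proof -
    have inj: "inj_on (\<lambda>x. x /\<^sub>R norm x) (C - {0})"
    proof (rule inj_onI, rule ccontr)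
      fix x y assume xy: "x \<in> C - {0}" "y \<in> C - {0}" "x /\<^sub>R norm x = y /\<^sub>R norm y" "x \<noteq> y"
      then have "Linear_Algebra.orthogonal x y" using C(3) by (auto simp: pairwise_def)
      then have "(x /\<^sub>R norm x) \<bullet> (y /\<^sub>R norm y) = 0" by (simp add: Linear_Algebra.orthogonal_def)
      then show False using xy by auto
    qed
    have eq: "(\<Sum>b\<in>D. (v \<bullet> b) *\<^sub>R b) = (\<Sum>x\<in>C - {0}. (v \<bullet> x / (x \<bullet> x)) *\<^sub>R x)" for v
      unfolding D_def sum.reindex[OF inj] o_def
      by (rule sum.cong) (auto simp: power2_norm_eq_inner[symmetric] power2_eq_square field_simps)
    have "v \<in> span (C - {0})" using C0 by simp
    then show ?thesis unfolding eq
    proof (induction rule: span_induct_alt)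
      case base
      then show ?case by simp
    next
      case (step c x y)
      have "(\<Sum>z\<in>C - {0}. (x \<bullet> z / (z \<bullet> z)) *\<^sub>R z) = (\<Sum>z\<in>C - {0}. if z = x then x else 0)"
        by (rule sum.cong) (use step(1) C(3) in \<open>auto simp: pairwise_def Linear_Algebra.orthogonal_def\<close>)
      also have "\<dots> = x" using step(1) C(1) by (simp add: sum.delta)
      finally have 1: "(\<Sum>z\<in>C - {0}. (x \<bullet> z / (z \<bullet> z)) *\<^sub>R z) = x" .
      have "(\<Sum>z\<in>C - {0}. ((c *\<^sub>R x + y) \<bullet> z / (z \<bullet> z)) *\<^sub>R z) =
         c *\<^sub>R (\<Sum>z\<in>C - {0}. (x \<bullet> z / (z \<bullet> z)) *\<^sub>R z) + (\<Sum>z\<in>C - {0}. (y \<bullet> z / (z \<bullet> z)) *\<^sub>R z)"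
        by (simp add: scaleR_sum_right sum.distrib[symmetric] inner_add_left add_divide_distrib scaleR_add_left)
      then show ?case using 1 step(2)[symmetric] by metis
    qed
  qed
  with fD show ?thesis by (rule that)
qed

text \<open>In finite dimension closed balls are compact: a ball is a closed subset of the image of a cube
  under the continuous map that forms linear combinations of an orthonormal basis.\<close>

lemma compact_cball_finite_dim:
  fixes B :: "'e::real_inner set"
  assumes B: "finite B" "\<And>v::'e. v = (\<Sum>b\<in>B. (v \<bullet> b) *\<^sub>R b)"
  shows "compact (cball (c::'e) r)"
proof -
  have cube: "compact {\<Sum>b\<in>B'. f b *\<^sub>R b | f. \<forall>b\<in>B'. f b \<in> {-(norm b * r) .. norm b * r}}"
    (is "compact (?K B')") if "finite B'" for B' :: "'e set"
    using that
  proof (induction B')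
    case empty
    have "?K {} = {0}" by (rule Set.set_eqI) simp
    then show ?case by simp
  next
    case (insert a B')
    have "?K (insert a B') = {x + y | x y. x \<in> (\<lambda>t. t *\<^sub>R a) ` {-(norm a * r) .. norm a * r} \<and> y \<in> ?K B'}"
      (is "_ = ?R")
    proof (intro Set.set_eqI iffI)
      fix z assume "z \<in> ?K (insert a B')"
      then obtain f where f: "\<forall>b\<in>insert a B'. f b \<in> {-(norm b * r) .. norm b * r}"
        and z: "z = (\<Sum>b\<in>insert a B'. f b *\<^sub>R b)" by blast
      show "z \<in> ?R"
        by (intro CollectI exI[of _ "f a *\<^sub>R a"] exI[of _ "\<Sum>b\<in>B'. f b *\<^sub>R b"])
          (use f z insert.hyps in auto)
    next
      fix z assume "z \<in> ?R"
      then obtain t f where t: "t \<in> {-(norm a * r) .. norm a * r}" and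
        f: "\<forall>b\<in>B'. f b \<in> {-(norm b * r) .. norm b * r}" and z: "z = t *\<^sub>R a + (\<Sum>b\<in>B'. f b *\<^sub>R b)"
        by blast
      have "(\<Sum>b\<in>B'. (f(a := t)) b *\<^sub>R b) = (\<Sum>b\<in>B'. f b *\<^sub>R b)"
        by (rule sum.cong) (use insert.hyps in auto)
      then have "z = (\<Sum>b\<in>insert a B'. (f(a := t)) b *\<^sub>R b)"
        using insert.hyps z by simp
      then show "z \<in> ?K (insert a B')" using t f insert.hyps
        by (intro CollectI exI[of _ "f(a := t)"]) auto
    qed
    moreover have "compact ?R"
      by (intro compact_sums compact_continuous_image insert.IH continuous_intros) auto
    ultimately show ?case by metis
  qed
  have "compact ((\<lambda>x. c + x) ` (?K B \<inter> cball 0 r))"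
    using cube[OF B(1)] by (intro compact_continuous_image continuous_intros compact_Int_closed) auto
  moreover have "(\<lambda>x. c + x) ` (?K B \<inter> cball 0 r) = cball c r"
  proof (intro Set.set_eqI iffI)
    fix z assume "z \<in> cball c r"
    then have n: "norm (z - c) \<le> r" by (simp add: dist_norm norm_minus_commute)
    have "\<bar>(z - c) \<bullet> b\<bar> \<le> norm b * r" for b
      using order_trans[OF Cauchy_Schwarz_ineq2[of "z - c" b] mult_right_mono[OF n, of "norm b"]]
      by (simp add: mult.commute)
    then have "z - c \<in> ?K B"
      using B(2)[of "z - c"] by (auto intro!: exI[of _ "\<lambda>b. (z - c) \<bullet> b"] simp: abs_le_iff minus_le_iff)
    then show "z \<in> (\<lambda>x. c + x) ` (?K B \<inter> cball 0 r)"
      using n by (intro image_eqI[of _ _ "z - c"]) auto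
  qed (auto simp: dist_norm)
  ultimately show ?thesis by simp
qed

section \<open>Invertible matrices over sheaves of functions\<close>

text \<open>Smooth functions and continuous functions are handled alike: all that the matrix calculus
  uses is a sheaf of complex algebras in which nowhere vanishing functions are invertible.\<close>

locale function_sheaf =
  fixes X :: "'a topology" and P :: "'a set \<Rightarrow> ('a \<Rightarrow> complex) \<Rightarrow> bool"
  assumes const: "openin X S \<Longrightarrow> P S (\<lambda>x. c)"
    and add: "openin X S \<Longrightarrow> P S f \<Longrightarrow> P S g \<Longrightarrow> P S (\<lambda>x. f x + g x)"
    and mult: "openin X S \<Longrightarrow> P S f \<Longrightarrow> P S g \<Longrightarrow> P S (\<lambda>x. f x * g x)"
    and inverse: "openin X S \<Longrightarrow> P S f \<Longrightarrow> (\<And>x. x \<in> S \<Longrightarrow> f x \<noteq> 0) \<Longrightarrow> P S (\<lambda>x. inverse (f x))"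
    and subset: "openin X S \<Longrightarrow> openin X T \<Longrightarrow> P S f \<Longrightarrow> T \<subseteq> S \<Longrightarrow> P T f"
    and local: "openin X S \<Longrightarrow>
      (\<And>x. x \<in> S \<Longrightarrow> \<exists>G f'. openin X G \<and> x \<in> G \<and> G \<subseteq> S \<and> P G f' \<and> (\<forall>y\<in>G. f y = f' y)) \<Longrightarrow> P S f"
begin

lemma cong: "openin X S \<Longrightarrow> P S f \<Longrightarrow> (\<And>x. x \<in> S \<Longrightarrow> f x = g x) \<Longrightarrow> P S g"
  by (rule local) (auto intro!: exI[of _ S] exI[of _ f])

lemma sum: "openin X S \<Longrightarrow> (\<And>a. a \<in> A \<Longrightarrow> P S (f a)) \<Longrightarrow> P S (\<lambda>x. \<Sum>a\<in>A. f a x)"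
  by (induction A rule: infinite_finite_induct) (auto intro: const add)

lemma prod: "openin X S \<Longrightarrow> (\<And>a. a \<in> A \<Longrightarrow> P S (f a)) \<Longrightarrow> P S (\<lambda>x. \<Prod>a\<in>A. f a x)"
  by (induction A rule: infinite_finite_induct) (auto intro: const mult)

definition regular_GL :: "'a set \<Rightarrow> nat \<Rightarrow> ('a \<Rightarrow> complex mat) \<Rightarrow> bool" where
  "regular_GL S n g \<longleftrightarrow> (\<forall>x\<in>S. g x \<in> GL n) \<and> (\<forall>i<n. \<forall>j<n. P S (\<lambda>x. g x $$ (i, j)))"

end

lemma GL_iff_det: "M \<in> GL n \<longleftrightarrow> M \<in> carrier_mat n n \<and> det M \<noteq> 0"
proof
  assume M: "M \<in> GL n"
  then have c: "M \<in> carrier_mat n n" by (simp add: GL_def)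
  obtain B where B: "M * B = 1\<^sub>m n" "B * M = 1\<^sub>m (dim_row B)"
    using M by (auto simp: GL_def invertible_mat_def inverts_mat_def)
  have "dim_col B = n" "dim_row B = n"
    using arg_cong[OF B(1), of dim_col] arg_cong[OF B(2), of dim_col] c by auto
  then have "B \<in> carrier_mat n n" by auto
  then have "det M * det B = 1" using det_mult[OF c, of B] B(1) by simp
  then show "M \<in> carrier_mat n n \<and> det M \<noteq> 0" using c by auto
next
  assume M: "M \<in> carrier_mat n n \<and> det M \<noteq> 0"
  then have a: "adj_mat M \<in> carrier_mat n n" by (simp add: adj_mat)
  let ?B = "inverse (det M) \<cdot>\<^sub>m adj_mat M"
  have "M * ?B = 1\<^sub>m n" "?B * M = 1\<^sub>m n"
    using M a adj_mat[of M n] by (simp_all add: mult_smult_distrib[of _ n n _ n] mult_smult_assoc_mat[of _ n n _ n])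
      (auto intro!: eq_matI)
  moreover have "dim_row ?B = n" "dim_row M = n" "dim_col M = n" using M a by auto
  ultimately show "M \<in> GL n" using M
    unfolding GL_def invertible_mat_def inverts_mat_def by auto
qed

definition mat_inv :: "complex mat \<Rightarrow> complex mat" where
  "mat_inv M = inverse (det M) \<cdot>\<^sub>m adj_mat M"

lemma GL_carrier [simp]: "M \<in> GL n \<Longrightarrow> M \<in> carrier_mat n n"
  by (simp add: GL_def)

lemma GL_det: "M \<in> GL n \<Longrightarrow> det M \<noteq> 0"
  by (simp add: GL_iff_det del: GL_carrier)

lemma GL_I: "M \<in> carrier_mat n n \<Longrightarrow> det M \<noteq> 0 \<Longrightarrow> M \<in> GL n"
  by (simp add: GL_iff_det del: GL_carrier)

lemma GL_mat_inv:
  assumes "M \<in> GL n"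
  shows "M * mat_inv M = 1\<^sub>m n" "mat_inv M * M = 1\<^sub>m n" "mat_inv M \<in> GL n"
proof -
  have M: "M \<in> carrier_mat n n" "det M \<noteq> 0" using assms by (auto simp: GL_det)
  then have a: "adj_mat M \<in> carrier_mat n n" by (simp add: adj_mat)
  show 1: "M * mat_inv M = 1\<^sub>m n" and 2: "mat_inv M * M = 1\<^sub>m n"
    unfolding mat_inv_def
    using M a adj_mat[of M n] by (simp_all add: mult_smult_distrib[of _ n n _ n] mult_smult_assoc_mat[of _ n n _ n])
      (auto intro!: eq_matI)
  have c: "mat_inv M \<in> carrier_mat n n" using a by (simp add: mat_inv_def)
  then have "det M * det (mat_inv M) = 1" using det_mult[OF M(1), of "mat_inv M"] 1 by simp
  then show "mat_inv M \<in> GL n" using c by (auto intro: GL_I)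
qed

lemma GL_right_inverse:
  assumes "A \<in> carrier_mat n n" "B \<in> carrier_mat n n" "A * B = 1\<^sub>m n"
  shows "A \<in> GL n" "B \<in> GL n" "B * A = 1\<^sub>m n"
proof -
  have "det A * det B = 1" using det_mult[OF assms(1,2)] assms(3) by simp
  then show A: "A \<in> GL n" "B \<in> GL n" using assms by (auto intro: GL_I)
  note i = GL_mat_inv[OF A(1)]
  have "B = (mat_inv A * A) * B" using i(2) assms(2) by simp
  also have "\<dots> = mat_inv A * (A * B)"
    using assms(1,2) i(3) by (intro assoc_mult_mat[of _ n n _ n _ n]) auto
  also have "\<dots> = mat_inv A" using assms(3) GL_carrier[OF i(3)] by simp
  finally show "B * A = 1\<^sub>m n" using GL_mat_inv(2)[OF A(1)] by simp
qed

lemma GL_mult: "A \<in> GL n \<Longrightarrow> B \<in> GL n \<Longrightarrow> A * B \<in> GL n"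
  by (intro GL_I) (auto simp: det_mult[of _ n] GL_det mult_carrier_mat[of _ n n])

lemma GL_one: "1\<^sub>m n \<in> GL n"
  by (auto intro: GL_I)

lemma GL_smult: "A \<in> GL n \<Longrightarrow> c \<noteq> 0 \<Longrightarrow> c \<cdot>\<^sub>m A \<in> GL n"
  by (auto intro!: GL_I simp: GL_det)

lemma GL_transpose: "A \<in> GL n \<Longrightarrow> A\<^sup>T \<in> GL n"
  by (intro GL_I) (auto simp: det_transpose[of _ n] GL_det)

lemma GL_cancel_left:
  assumes "A \<in> GL n" "B \<in> carrier_mat n n" "C \<in> carrier_mat n n" "A * B = A * C"
  shows "B = C"
proof -
  note i = GL_mat_inv[OF assms(1)]
  have "(mat_inv A * A) * B = (mat_inv A * A) * C"
    using assms i(3) by (simp add: assoc_mult_mat[of _ n n _ n _ n])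
  then show ?thesis using assms(2,3) i(2) by simp
qed

lemma block_sum_carrier: "A \<in> carrier_mat n n \<Longrightarrow> B \<in> carrier_mat m m \<Longrightarrow> block_sum n m A B \<in> carrier_mat (n + m) (n + m)"
  by (simp add: block_sum_def)

lemma block_sum_index:
  assumes "A \<in> carrier_mat n n" "B \<in> carrier_mat m m" "i < n + m" "j < n + m"
  shows "block_sum n m A B $$ (i, j) =
    (if i < n then if j < n then A $$ (i, j) else 0 else if j < n then 0 else B $$ (i - n, j - n))"
  using assms unfolding block_sum_def by (subst index_mat_four_block) auto

lemma block_sum_mult:
  assumes "A \<in> carrier_mat n n" "B \<in> carrier_mat m m" "C \<in> carrier_mat n n" "D \<in> carrier_mat m m"
  shows "block_sum n m A B * block_sum n m C D = block_sum n m (A * C) (B * D)"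
  unfolding block_sum_def
  by (subst mult_four_block_mat[OF assms(1) _ _ assms(2) assms(3) _ _ assms(4)])
    (use assms in \<open>auto simp: left_mult_zero_mat right_mult_zero_mat\<close>)

lemma block_sum_one: "block_sum n m (1\<^sub>m n) (1\<^sub>m m) = 1\<^sub>m (n + m)"
  by (auto simp: block_sum_def four_block_one_mat)

lemma block_sum_smult:
  assumes "A \<in> carrier_mat n n" "B \<in> carrier_mat m m"
  shows "c \<cdot>\<^sub>m block_sum n m A B = block_sum n m (c \<cdot>\<^sub>m A) (c \<cdot>\<^sub>m B)"
  unfolding block_sum_def using assms
  by (subst smult_four_block_mat[of _ n n _ m _ m]) auto

lemma block_sum_transpose:
  assumes "A \<in> carrier_mat n n" "B \<in> carrier_mat m m"
  shows "(block_sum n m A B)\<^sup>T = block_sum n m (A\<^sup>T) (B\<^sup>T)"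
  unfolding block_sum_def using assms
  by (subst transpose_four_block_mat[of _ n n _ m _ m]) auto

lemma GL_block_sum:
  assumes "A \<in> GL n" "B \<in> GL m"
  shows "block_sum n m A B \<in> GL (n + m)"
proof (rule GL_right_inverse(1))
  show "block_sum n m A B * block_sum n m (mat_inv A) (mat_inv B) = 1\<^sub>m (n + m)"
    using assms GL_mat_inv[OF assms(1)] GL_mat_inv[OF assms(2)]
    by (simp add: block_sum_mult block_sum_one)
qed (use assms GL_mat_inv[OF assms(1)] GL_mat_inv[OF assms(2)] in \<open>auto intro!: block_sum_carrier\<close>)

lemma mult_mat_index:
  assumes "A \<in> carrier_mat n n" "B \<in> carrier_mat n n" "i < n" "j < n"
  shows "(A * B) $$ (i, j) = (\<Sum>l\<in>{0..<n}. A $$ (i, l) * B $$ (l, j))"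
  using assms by (auto simp: scalar_prod_def intro!: sum.cong)

lemma mult_mat_assoc:
  "A \<in> carrier_mat n n \<Longrightarrow> B \<in> carrier_mat n n \<Longrightarrow> C \<in> carrier_mat n n \<Longrightarrow> (A * B) * C = A * (B * C)"
  by (rule assoc_mult_mat)

lemma mult_mat_carrier: "A \<in> carrier_mat n n \<Longrightarrow> B \<in> carrier_mat n n \<Longrightarrow> A * B \<in> carrier_mat n n"
  by (rule mult_carrier_mat)

lemma smult_mult_left: "(A :: complex mat) \<in> carrier_mat n n \<Longrightarrow> B \<in> carrier_mat n n \<Longrightarrow> (c \<cdot>\<^sub>m A) * B = c \<cdot>\<^sub>m (A * B)"
  by (rule mult_smult_assoc_mat)

lemma smult_mult_right: "(A :: complex mat) \<in> carrier_mat n n \<Longrightarrow> B \<in> carrier_mat n n \<Longrightarrow> A * (c \<cdot>\<^sub>m B) = c \<cdot>\<^sub>m (A * B)"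
  by (rule mult_smult_distrib)

lemma smult_smult_mat: "c \<cdot>\<^sub>m (d \<cdot>\<^sub>m A) = (c * d) \<cdot>\<^sub>m (A :: complex mat)"
  by (rule eq_matI) auto

lemma smult_carrier: "A \<in> carrier_mat n n \<Longrightarrow> c \<cdot>\<^sub>m A \<in> carrier_mat n n"
  by simp

lemmas mat_calc = mult_mat_assoc[of _ n] mult_mat_carrier[of _ n] smult_mult_left[of _ n] smult_mult_right[of _ n]
  smult_carrier[of _ n] left_mult_one_mat[of _ n n] right_mult_one_mat[of _ n n] for n

lemma mat_inv_unique:
  assumes "A \<in> GL n" "B \<in> carrier_mat n n" "A * B = C"
  shows "B = mat_inv A * C"
proof -
  note i = GL_mat_inv[OF assms(1)] and c = GL_carrier[OF assms(1)] GL_carrier[OF GL_mat_inv(3)[OF assms(1)]]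
  have "mat_inv A * C = (mat_inv A * A) * B"
    unfolding assms(3)[symmetric] using c assms(2) by (simp add: mat_calc[where n = n])
  then show ?thesis using i(2) assms(2) by simp
qed

lemma smult_one_mat: "1 \<cdot>\<^sub>m (A :: complex mat) = A"
  by (rule eq_matI) auto

lemma smult_cancel:
  assumes "c \<noteq> 0" "c \<cdot>\<^sub>m A = c \<cdot>\<^sub>m (B :: complex mat)"
  shows "A = B"
proof -
  have "inverse c \<cdot>\<^sub>m (c \<cdot>\<^sub>m A) = inverse c \<cdot>\<^sub>m (c \<cdot>\<^sub>m B)" using assms(2) by simp
  then show ?thesis using assms(1) by (simp add: smult_smult_mat smult_one_mat)
qed

lemma transpose_mult:
  "A \<in> carrier_mat n n \<Longrightarrow> B \<in> carrier_mat n n \<Longrightarrow> (A * B)\<^sup>T = B\<^sup>T * (A :: complex mat)\<^sup>T"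
  by (rule Matrix.transpose_mult)

lemma transpose_smult: "(c \<cdot>\<^sub>m A)\<^sup>T = c \<cdot>\<^sub>m (A :: complex mat)\<^sup>T"
  by (rule eq_matI) auto

text \<open>A nonzero vector in the kernel has an entry of largest modulus; the corresponding row of the kernel equation
  bounds this modulus by \<open>n / (n + 1)\<close> times itself.\<close>

lemma GL_near_one:
  assumes B: "B \<in> carrier_mat n n"
    and near: "\<And>i j. i < n \<Longrightarrow> j < n \<Longrightarrow> cmod (B $$ (i, j) - 1\<^sub>m n $$ (i, j)) < 1 / (real n + 1)"
  shows "B \<in> GL n"
proof (rule GL_I[OF B], rule notI)
  assume "det B = 0"
  then obtain v where v: "v \<in> carrier_vec n" "v \<noteq> 0\<^sub>v n" "B *\<^sub>v v = 0\<^sub>v n"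
    using det_0_iff_vec_prod_zero_field[OF B] by blast
  then obtain l where l: "l < n" "v $ l \<noteq> 0"
    by (metis carrier_vecD eq_vecI index_zero_vec)
  define m where "m = Max ((\<lambda>i. cmod (v $ i)) ` {0..<n})"
  have "m \<in> (\<lambda>i. cmod (v $ i)) ` {0..<n}" unfolding m_def using l by (intro Max_in) auto
  then obtain i where i: "i < n" "m = cmod (v $ i)" by auto
  have le: "cmod (v $ j) \<le> m" if "j < n" for j unfolding m_def using that by (intro Max_ge) auto
  have "0 < m" using le[OF l(1)] l(2) by (smt (verit) zero_less_norm_iff)
  have "(B *\<^sub>v v) $ i = (\<Sum>j\<in>{0..<n}. B $$ (i, j) * v $ j)"
    using B v(1) i(1) by (auto simp: scalar_prod_def intro!: sum.cong)
  then have "(\<Sum>j\<in>{0..<n}. B $$ (i, j) * v $ j) = 0" using v(3) i(1) by simp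
  moreover have "(\<Sum>j\<in>{0..<n}. 1\<^sub>m n $$ (i, j) * v $ j) = (\<Sum>j\<in>{0..<n}. if j = i then v $ j else 0)"
    by (rule sum.cong) (use i(1) in auto)
  ultimately have "(\<Sum>j\<in>{0..<n}. (B $$ (i, j) - 1\<^sub>m n $$ (i, j)) * v $ j) = - v $ i"
    using i(1) by (simp add: left_diff_distrib sum_subtractf sum.delta)
  then have "m = cmod (\<Sum>j\<in>{0..<n}. (B $$ (i, j) - 1\<^sub>m n $$ (i, j)) * v $ j)" using i(2) by simp
  also have "\<dots> \<le> (\<Sum>j\<in>{0..<n}. 1 / (real n + 1) * m)"
  proof (intro sum_norm_le)
    fix j assume "j \<in> {0..<n}"
    then have j: "j < n" by simp
    show "cmod ((B $$ (i, j) - 1\<^sub>m n $$ (i, j)) * v $ j) \<le> 1 / (real n + 1) * m"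
      unfolding norm_mult by (intro mult_mono less_imp_le[OF near[OF i(1) j]] le[OF j]) auto
  qed
  also have "\<dots> = real n / (real n + 1) * m" by simp
  also have "\<dots> < m" using \<open>0 < m\<close> by (simp add: field_simps)
  finally show False by simp
qed

context function_sheaf
begin

lemma regular_GLD:
  assumes "regular_GL S n g"
  shows "x \<in> S \<Longrightarrow> g x \<in> GL n" "i < n \<Longrightarrow> j < n \<Longrightarrow> P S (\<lambda>x. g x $$ (i, j))"
  using assms by (auto simp: regular_GL_def)

lemma regular_GL_subset:
  "openin X S \<Longrightarrow> openin X T \<Longrightarrow> regular_GL S n g \<Longrightarrow> T \<subseteq> S \<Longrightarrow> regular_GL T n g"
  unfolding regular_GL_def using subset by blast

lemma regular_GL_local:
  assumes "openin X S"
    "\<And>x. x \<in> S \<Longrightarrow> \<exists>G g'. openin X G \<and> x \<in> G \<and> G \<subseteq> S \<and> regular_GL G n g' \<and> (\<forall>y\<in>G. g y = g' y)"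
  shows "regular_GL S n g"
  unfolding regular_GL_def
proof (intro conjI ballI allI impI)
  show "g x \<in> GL n" if "x \<in> S" for x
    using assms(2)[OF that] by (auto simp: regular_GL_def)
  show "P S (\<lambda>x. g x $$ (i, j))" if "i < n" "j < n" for i j
  proof (rule local[OF assms(1)])
    fix x assume "x \<in> S"
    then obtain G g' where G: "openin X G" "x \<in> G" "G \<subseteq> S" "regular_GL G n g'" "\<forall>y\<in>G. g y = g' y"
      using assms(2) by meson
    then have "P G (\<lambda>x. g' x $$ (i, j))" using that by (auto simp: regular_GL_def)
    with G show "\<exists>G f'. openin X G \<and> x \<in> G \<and> G \<subseteq> S \<and> P G f' \<and> (\<forall>y\<in>G. g y $$ (i, j) = f' y)"
      by (intro exI[of _ G] exI[of _ "\<lambda>x. g' x $$ (i, j)"]) auto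
  qed
qed

lemma regular_GL_cong:
  "openin X S \<Longrightarrow> regular_GL S n f \<Longrightarrow> (\<And>x. x \<in> S \<Longrightarrow> f x = g x) \<Longrightarrow> regular_GL S n g"
  by (rule regular_GL_local) (auto intro!: exI[of _ S] exI[of _ f])

lemma regular_GL_const: "openin X S \<Longrightarrow> M \<in> GL n \<Longrightarrow> regular_GL S n (\<lambda>x. M)"
  unfolding regular_GL_def by (auto intro: const)

lemma regular_GL_mult:
  assumes "openin X S" "regular_GL S n f" "regular_GL S n g"
  shows "regular_GL S n (\<lambda>x. f x * g x)"
  unfolding regular_GL_def
proof (intro conjI ballI allI impI)
  show "f x * g x \<in> GL n" if "x \<in> S" for x
    using assms that by (auto intro: GL_mult regular_GLD)
  fix i j assume ij: "i < n" "j < n"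
  have "P S (\<lambda>x. \<Sum>k\<in>{0..<n}. f x $$ (i, k) * g x $$ (k, j))"
    using ij by (intro sum mult assms(1) regular_GLD(2)[OF assms(2)] regular_GLD(2)[OF assms(3)]) auto
  then show "P S (\<lambda>x. (f x * g x) $$ (i, j))"
  proof (rule cong[OF assms(1)])
    fix x assume "x \<in> S"
    then have "f x \<in> carrier_mat n n" "g x \<in> carrier_mat n n" using assms regular_GLD(1) by auto
    then show "(\<Sum>k\<in>{0..<n}. f x $$ (i, k) * g x $$ (k, j)) = (f x * g x) $$ (i, j)"
      using ij by (auto simp: scalar_prod_def intro!: sum.cong)
  qed
qed

lemma regular_GL_smult:
  assumes "openin X S" "P S c" "\<And>x. x \<in> S \<Longrightarrow> c x \<noteq> 0" "regular_GL S n g"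
  shows "regular_GL S n (\<lambda>x. c x \<cdot>\<^sub>m g x)"
  unfolding regular_GL_def
proof (intro conjI ballI allI impI)
  show "c x \<cdot>\<^sub>m g x \<in> GL n" if "x \<in> S" for x
    using assms that by (auto intro: GL_smult regular_GLD)
  fix i j assume ij: "i < n" "j < n"
  have "P S (\<lambda>x. c x * g x $$ (i, j))"
    using ij by (intro mult assms regular_GLD(2)[OF assms(4)])
  then show "P S (\<lambda>x. (c x \<cdot>\<^sub>m g x) $$ (i, j))"
  proof (rule cong[OF assms(1)])
    fix x assume "x \<in> S"
    then have "g x \<in> carrier_mat n n" using assms regular_GLD(1) by auto
    then show "c x * g x $$ (i, j) = (c x \<cdot>\<^sub>m g x) $$ (i, j)" using ij by auto
  qed
qed

lemma regular_GL_transpose: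
  assumes "openin X S" "regular_GL S n g"
  shows "regular_GL S n (\<lambda>x. (g x)\<^sup>T)"
  unfolding regular_GL_def
proof (intro conjI ballI allI impI)
  show "(g x)\<^sup>T \<in> GL n" if "x \<in> S" for x
    using assms that by (auto intro: GL_transpose regular_GLD)
  fix i j assume ij: "i < n" "j < n"
  show "P S (\<lambda>x. (g x)\<^sup>T $$ (i, j))"
  proof (rule cong[OF assms(1) regular_GLD(2)[OF assms(2) ij(2,1)]])
    fix x assume "x \<in> S"
    then have "g x \<in> carrier_mat n n" using assms regular_GLD(1) by auto
    then show "g x $$ (j, i) = (g x)\<^sup>T $$ (i, j)" using ij by auto
  qed
qed

lemma regular_GL_block_sum:
  assumes "openin X S" "regular_GL S n f" "regular_GL S m g"
  shows "regular_GL S (n + m) (\<lambda>x. block_sum n m (f x) (g x))"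
  unfolding regular_GL_def
proof (intro conjI ballI allI impI)
  show "block_sum n m (f x) (g x) \<in> GL (n + m)" if "x \<in> S" for x
    using assms that by (auto intro: GL_block_sum regular_GLD)
  fix i j assume ij: "i < n + m" "j < n + m"
  have "P S (\<lambda>x. if i < n then if j < n then f x $$ (i, j) else 0 else if j < n then 0 else g x $$ (i - n, j - n))"
    using ij regular_GLD(2)[OF assms(2), of i j] regular_GLD(2)[OF assms(3), of "i - n" "j - n"] const[OF assms(1), of 0]
    by (cases "i < n"; cases "j < n") auto
  then show "P S (\<lambda>x. block_sum n m (f x) (g x) $$ (i, j))"
  proof (rule cong[OF assms(1)])
    fix x assume x: "x \<in> S"
    show "(if i < n then if j < n then f x $$ (i, j) else 0 else if j < n then 0 else g x $$ (i - n, j - n))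
        = block_sum n m (f x) (g x) $$ (i, j)"
      using regular_GLD(1)[OF assms(2) x] regular_GLD(1)[OF assms(3) x] ij
      by (subst block_sum_index) auto
  qed
qed

lemma regular_det:
  assumes "openin X S" "\<And>x. x \<in> S \<Longrightarrow> A x \<in> carrier_mat n n"
    "\<And>i j. i < n \<Longrightarrow> j < n \<Longrightarrow> P S (\<lambda>x. A x $$ (i, j))"
  shows "P S (\<lambda>x. det (A x))"
proof (rule cong[OF assms(1)])
  show "P S (\<lambda>x. \<Sum>p | p permutes {0..<n}. signof p * (\<Prod>i = 0..<n. A x $$ (i, p i)))"
    by (intro sum mult prod assms const) (use permutes_in_image[of _ "{0..<n}"] in auto)
qed (subst det_def'[OF assms(2)], simp_all)

text \<open>Cramer's rule writes the inverse matrix through determinants, so its entries are again in the sheaf.\<close>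

lemma regular_GL_mat_inv:
  assumes "openin X S" "regular_GL S n g"
  shows "regular_GL S n (\<lambda>x. mat_inv (g x))"
  unfolding regular_GL_def
proof (intro conjI ballI allI impI)
  note g = regular_GLD[OF assms(2)]
  show "mat_inv (g x) \<in> GL n" if "x \<in> S" for x
    using g(1)[OF that] by (rule GL_mat_inv)
  fix i j assume ij: "i < n" "j < n"
  have d: "P S (\<lambda>x. det (g x))"
    using g by (intro regular_det[OF assms(1), of _ n]) auto
  have e: "mat_delete (g x) j i $$ (k, l) = g x $$ (if k < j then k else Suc k, if l < i then l else Suc l)"
    if "x \<in> S" "k < n - 1" "l < n - 1" for x k l
    using carrier_matD[OF GL_carrier[OF g(1)[OF that(1)]]] ij that by (auto simp: mat_delete_def)
  have "P S (\<lambda>x. det (mat_delete (g x) j i))"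
  proof (rule regular_det[OF assms(1), of _ "n - 1"])
    fix k l assume kl: "k < n - 1" "l < n - 1"
    have "P S (\<lambda>x. g x $$ (if k < j then k else Suc k, if l < i then l else Suc l))"
      using kl ij by (intro g(2)) auto
    then show "P S (\<lambda>x. mat_delete (g x) j i $$ (k, l))"
      by (rule cong[OF assms(1)]) (simp only: e[OF _ kl])
  qed (rule mat_delete_carrier[OF GL_carrier[OF g(1)]])
  then have "P S (\<lambda>x. inverse (det (g x)) * ((-1) ^ (j + i) * det (mat_delete (g x) j i)))"
    using g(1) by (intro mult inverse const assms(1) d) (use GL_det[OF g(1)] in simp)
  then show "P S (\<lambda>x. mat_inv (g x) $$ (i, j))"
  proof (rule cong[OF assms(1)])
    fix x assume "x \<in> S"
    then have c: "g x \<in> carrier_mat n n" using g(1) by simp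
    show "inverse (det (g x)) * ((-1) ^ (j + i) * det (mat_delete (g x) j i)) = mat_inv (g x) $$ (i, j)"
      using c ij by (simp add: mat_inv_def adj_mat_def cofactor_def)
  qed
qed

end

section \<open>Smooth functions on a manifold\<close>

lemma Ck_on_local:
  assumes "open S" "\<And>x. x \<in> S \<Longrightarrow> \<exists>G. open G \<and> x \<in> G \<and> G \<subseteq> S \<and> Ck_on k G f"
  shows "Ck_on k S f"
  using assms(2)
proof (induction k arbitrary: f)
  case 0
  have "isCont f x" if x: "x \<in> S" for x
  proof -
    obtain G where "open G" "x \<in> G" "continuous_on G f" using 0[OF x] by auto
    then show ?thesis by (simp add: continuous_on_eq_continuous_at)
  qed
  then show ?case by (simp add: continuous_at_imp_continuous_on)
next
  case (Suc k)
  have "f differentiable (at x)" if x: "x \<in> S" for x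
    using Suc.prems[OF x] by auto
  moreover have "Ck_on k S (\<lambda>x. frechet_derivative f (at x) v)" for v
    by (rule Suc.IH) (use Suc.prems in fastforce)
  ultimately show ?case by simp
qed

text \<open>Continuity is expressed through neighbourhood filters, so that the limit rules for filters, products of filters
  included, apply to an abstract topology.\<close>

definition continuous_fun :: "'a topology \<Rightarrow> 'a set \<Rightarrow> ('a \<Rightarrow> complex) \<Rightarrow> bool" where
  "continuous_fun X S f \<longleftrightarrow> (\<forall>x\<in>S. (f \<longlongrightarrow> f x) (nhdsin X x))"

lemma eventually_nhdsin_in: "openin X G \<Longrightarrow> x \<in> G \<Longrightarrow> eventually (\<lambda>y. y \<in> G) (nhdsin X x)"
  by (auto simp: eventually_nhdsin)

lemma continuous_function_sheaf: "function_sheaf X (continuous_fun X)"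
proof
  fix S f assume S: "openin X S" "\<And>x. x \<in> S \<Longrightarrow>
    \<exists>G f'. openin X G \<and> x \<in> G \<and> G \<subseteq> S \<and> continuous_fun X G f' \<and> (\<forall>y\<in>G. f y = f' y)"
  show "continuous_fun X S f"
    unfolding continuous_fun_def
  proof
    fix x assume "x \<in> S"
    then obtain G f' where G: "openin X G" "x \<in> G" "continuous_fun X G f'" "\<forall>y\<in>G. f y = f' y"
      using S(2) by meson
    then have "(f' \<longlongrightarrow> f x) (nhdsin X x)" by (auto simp: continuous_fun_def)
    moreover have "eventually (\<lambda>y. f' y = f y) (nhdsin X x)"
      using eventually_nhdsin_in[OF G(1,2)] by (rule eventually_mono) (use G(4) in simp)
    ultimately show "(f \<longlongrightarrow> f x) (nhdsin X x)" by (rule Lim_transform_eventually)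
  qed
qed (auto simp: continuous_fun_def intro: tendsto_add tendsto_mult tendsto_inverse)

locale smooth_mfd =
  fixes X :: "'a topology" and \<A> :: "('a set \<times> ('a \<Rightarrow> 'e::real_inner)) set"
  assumes mfd: "smooth_manifold X \<A>"
begin

lemma atlas: "smooth_atlas X \<A>" and Hausdorff: "Hausdorff_space X" and second: "second_countable X"
  using mfd by (auto simp: smooth_manifold_def)

lemma orthonormal_basis:
  obtains B :: "'e set" where "finite B" "\<And>v. v = (\<Sum>b\<in>B. (v \<bullet> b) *\<^sub>R b)"
  using mfd orthonormal_expansion unfolding smooth_manifold_def by metis

lemma chart:
  assumes "(D, \<phi>) \<in> \<A>"
  shows "openin X D" "homeomorphic_map (subtopology X D) (top_of_set (\<phi> ` D)) \<phi>" "inj_on \<phi> D"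
    and "openin X S \<Longrightarrow> open (\<phi> ` (D \<inter> S))"
proof -
  show D: "openin X D" and h: "homeomorphic_map (subtopology X D) (top_of_set (\<phi> ` D)) \<phi>"
    using atlas assms unfolding smooth_atlas_def by fastforce+
  have o: "open (\<phi> ` D)" using atlas assms unfolding smooth_atlas_def by fastforce
  have t: "topspace (subtopology X D) = D" using D openin_subset by fastforce
  show "inj_on \<phi> D" using homeomorphic_imp_injective_map[OF h] t by simp
  show "open (\<phi> ` (D \<inter> S))" if "openin X S"
  proof -
    have "openin (subtopology X D) (D \<inter> S)" using that by (simp add: openin_subtopology_Int2)
    then have "openin (top_of_set (\<phi> ` D)) (\<phi> ` (D \<inter> S))"
      using homeomorphic_imp_open_map[OF h] by (auto simp: open_map_def)
    then show ?thesis using o openin_open_trans by blast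
  qed
qed

lemma chart_cover:
  assumes "x \<in> topspace X"
  shows "\<exists>D \<phi>. (D, \<phi>) \<in> \<A> \<and> x \<in> D"
proof -
  have "(\<Union>(D, \<phi>)\<in>\<A>. D) = topspace X" using atlas unfolding smooth_atlas_def by blast
  then have "x \<in> (\<Union>(D, \<phi>)\<in>\<A>. D)" using assms by simp
  then show ?thesis by auto
qed

lemma chart_inv: "(D, \<phi>) \<in> \<A> \<Longrightarrow> x \<in> D \<Longrightarrow> inv_into D \<phi> (\<phi> x) = x"
  by (simp add: chart(3))

lemma smooth_funD: "smooth_fun \<A> S f \<Longrightarrow> (D, \<phi>) \<in> \<A> \<Longrightarrow> Ck_on k (\<phi> ` (D \<inter> S)) (f \<circ> inv_into D \<phi>)"
  unfolding smooth_fun_def smooth_on_def by fastforce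

lemma smooth_funI:
  "(\<And>D \<phi> k. (D, \<phi>) \<in> \<A> \<Longrightarrow> Ck_on k (\<phi> ` (D \<inter> S)) (f \<circ> inv_into D \<phi>)) \<Longrightarrow> smooth_fun \<A> S f"
  unfolding smooth_fun_def smooth_on_def by fastforce

lemma smooth_fun_compose:
  fixes g :: "complex \<Rightarrow> complex"
  assumes "openin X S" "open T" "\<And>k. Ck_on k T g" "smooth_fun \<A> S f" "f ` S \<subseteq> T"
  shows "smooth_fun \<A> S (\<lambda>x. g (f x))"
proof (rule smooth_funI)
  fix D \<phi> k assume c: "(D, \<phi>) \<in> \<A>"
  have "(f \<circ> inv_into D \<phi>) ` \<phi> ` (D \<inter> S) \<subseteq> T"
    using assms(5) chart_inv[OF c] by auto
  then have "Ck_on k (\<phi> ` (D \<inter> S)) (\<lambda>x. g ((f \<circ> inv_into D \<phi>) x))"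
    by (rule Ck_on_compose[OF finite_Basis complex_expand chart(4)[OF c assms(1)] assms(2) _
          smooth_funD[OF assms(4) c] assms(3)])
  then show "Ck_on k (\<phi> ` (D \<inter> S)) ((\<lambda>x. g (f x)) \<circ> inv_into D \<phi>)" by (simp add: o_def)
qed

sublocale smooth: function_sheaf X "smooth_fun \<A>"
proof
  fix S :: "'a set" and c :: complex
  assume "openin X S"
  then show "smooth_fun \<A> S (\<lambda>x. c)"
    by (intro smooth_funI) (simp add: o_def Ck_on_const chart(4))
next
  fix S :: "'a set" and f g
  assume S: "openin X S" "smooth_fun \<A> S f" "smooth_fun \<A> S g"
  show "smooth_fun \<A> S (\<lambda>x. f x + g x)"
    using Ck_on_add[OF chart(4)[OF _ S(1)] smooth_funD[OF S(2)] smooth_funD[OF S(3)]]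
    by (intro smooth_funI) (simp add: o_def)
  show "smooth_fun \<A> S (\<lambda>x. f x * g x)"
    using Ck_on_bilinear[OF bounded_bilinear_mult chart(4)[OF _ S(1)] smooth_funD[OF S(2)] smooth_funD[OF S(3)]]
    by (intro smooth_funI) (simp add: o_def)
next
  fix S :: "'a set" and f :: "'a \<Rightarrow> complex"
  assume S: "openin X S" "smooth_fun \<A> S f" "\<And>x. x \<in> S \<Longrightarrow> f x \<noteq> 0"
  then show "smooth_fun \<A> S (\<lambda>x. inverse (f x))"
    by (intro smooth_fun_compose[OF S(1) _ Ck_on_inverse S(2)]) auto
next
  fix S T :: "'a set" and f :: "'a \<Rightarrow> complex"
  assume S: "smooth_fun \<A> S f" "T \<subseteq> S"
  then show "smooth_fun \<A> T f"
    by (intro smooth_funI Ck_on_subset[OF smooth_funD[OF S(1)]]) auto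
next
  fix S :: "'a set" and f :: "'a \<Rightarrow> complex"
  assume S: "openin X S" "\<And>x. x \<in> S \<Longrightarrow>
    \<exists>G f'. openin X G \<and> x \<in> G \<and> G \<subseteq> S \<and> smooth_fun \<A> G f' \<and> (\<forall>y\<in>G. f y = f' y)"
  show "smooth_fun \<A> S f"
  proof (rule smooth_funI)
    fix D \<phi> k assume c: "(D, \<phi>) \<in> \<A>"
    show "Ck_on k (\<phi> ` (D \<inter> S)) (f \<circ> inv_into D \<phi>)"
    proof (rule Ck_on_local[OF chart(4)[OF c S(1)]])
      fix y assume "y \<in> \<phi> ` (D \<inter> S)"
      then obtain x where x: "x \<in> D" "x \<in> S" "y = \<phi> x" by blast
      obtain G f' where G: "openin X G" "x \<in> G" "G \<subseteq> S" "smooth_fun \<A> G f'" "\<forall>y\<in>G. f y = f' y"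
        using S(2)[OF x(2)] by blast
      have "Ck_on k (\<phi> ` (D \<inter> G)) (f \<circ> inv_into D \<phi>)"
        by (rule Ck_on_cong[OF chart(4)[OF c G(1)] _ smooth_funD[OF G(4) c]])
          (use G(5) chart_inv[OF c] in auto)
      then show "\<exists>G. open G \<and> y \<in> G \<and> G \<subseteq> \<phi> ` (D \<inter> S) \<and> Ck_on k G (f \<circ> inv_into D \<phi>)"
        using x G chart(4)[OF c G(1)] by (intro exI[of _ "\<phi> ` (D \<inter> G)"]) auto
    qed
  qed
qed

lemma smooth_GL_eq: "smooth_GL \<A> = smooth.regular_GL"
  by (intro ext) (simp add: smooth_GL_def smooth.regular_GL_def)

lemma smooth_fun_exp: "openin X S \<Longrightarrow> smooth_fun \<A> S f \<Longrightarrow> smooth_fun \<A> S (\<lambda>x. exp (f x))"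
  by (rule smooth_fun_compose[OF _ open_UNIV Ck_on_exp]) auto

lemma smooth_fun_minus: "openin X S \<Longrightarrow> smooth_fun \<A> S f \<Longrightarrow> smooth_fun \<A> S g \<Longrightarrow> smooth_fun \<A> S (\<lambda>x. f x - g x)"
  using smooth.add[of S f "\<lambda>x. (-1) * g x"] smooth.mult[of S "\<lambda>x. -1" g] smooth.const[of S "-1"] by simp

lemma smooth_fun_continuous:
  assumes S: "openin X S" "smooth_fun \<A> S f"
  shows "continuous_fun X S f"
  unfolding continuous_fun_def
proof
  fix x assume x: "x \<in> S"
  have t: "S \<subseteq> topspace X" using S(1) by (rule openin_subset)
  then obtain D \<phi> where c: "(D, \<phi>) \<in> \<A>" "x \<in> D" using x chart_cover by blast
  note D = chart(1)[OF c(1)]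
  have \<phi>: "filterlim \<phi> (nhds (\<phi> x)) (nhdsin X x)"
    unfolding filterlim_iff eventually_nhds
  proof (intro allI impI, elim exE conjE)
    fix Q U assume U: "open U" "\<phi> x \<in> U" "\<forall>y\<in>U. Q y"
    have "continuous_map (subtopology X D) euclidean \<phi>"
      using homeomorphic_imp_continuous_map[OF chart(2)[OF c(1)]] by (rule continuous_map_into_fulltopology)
    then have "openin (subtopology X D) {y \<in> topspace (subtopology X D). \<phi> y \<in> U}"
      by (rule openin_continuous_map_preimage) (use U in auto)
    then have "openin X {y \<in> topspace (subtopology X D). \<phi> y \<in> U}"
      using D openin_trans_full by blast
    then show "eventually (\<lambda>y. Q (\<phi> y)) (nhdsin X x)"
      using x c t U unfolding eventually_nhdsin
      by (intro disjI2 exI[of _ "{y \<in> topspace (subtopology X D). \<phi> y \<in> U}"]) auto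
  qed
  have "isCont (f \<circ> inv_into D \<phi>) (\<phi> x)"
    using smooth_funD[OF S(2) c(1), of 0] chart(4)[OF c(1) S(1)] x c
    by (auto simp: continuous_on_eq_continuous_at o_def)
  then have "((\<lambda>y. (f \<circ> inv_into D \<phi>) (\<phi> y)) \<longlongrightarrow> (f \<circ> inv_into D \<phi>) (\<phi> x)) (nhdsin X x)"
    by (intro tendsto_compose[OF _ \<phi>]) (simp add: isCont_def o_def)
  moreover have "eventually (\<lambda>y. (f \<circ> inv_into D \<phi>) (\<phi> y) = f y) (nhdsin X x)"
    using D c chart_inv[OF c(1)] by (auto simp: eventually_nhdsin intro!: exI[of _ D])
  ultimately show "(f \<longlongrightarrow> f x) (nhdsin X x)"
    using chart_inv[OF c] by (auto elim: Lim_transform_eventually)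
qed

lemma locally_constant_smooth:
  fixes f :: "'a \<Rightarrow> complex"
  assumes "openin X S" "locally_constant X S f"
  shows "smooth_fun \<A> S f"
proof (rule smooth.local[OF assms(1)])
  fix x assume x: "x \<in> S"
  have t: "S \<subseteq> topspace X" using assms(1) by (rule openin_subset)
  let ?G = "{y \<in> topspace (subtopology X S). f y \<in> {f x}}"
  have "openin (subtopology X S) ?G"
    using assms(2) unfolding locally_constant_def by (rule openin_continuous_map_preimage) simp
  then have "openin X ?G" using assms(1) openin_trans_full by blast
  then show "\<exists>G f'. openin X G \<and> x \<in> G \<and> G \<subseteq> S \<and> smooth_fun \<A> G f' \<and> (\<forall>y\<in>G. f y = f' y)"
    using x t by (intro exI[of _ ?G] exI[of _ "\<lambda>_. f x"]) (auto intro: smooth.const)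
qed

end

section \<open>Partitions of unity\<close>

text \<open>Each member is supported in one set of the cover and only finitely many members are nonzero near
  any given point; the members are numbered because finitely many of them can then be cut off at a number.\<close>

definition partition_of_unity ::
    "'a topology \<Rightarrow> 'a set \<Rightarrow> ('a \<Rightarrow> 'a set) \<Rightarrow> (nat \<Rightarrow> 'a) \<Rightarrow> (nat \<Rightarrow> 'a \<Rightarrow> real) \<Rightarrow> (nat \<Rightarrow> 'a set) \<Rightarrow> bool" where
  "partition_of_unity X M C q \<eta> S \<longleftrightarrow>
     (\<forall>k. q k \<in> M \<and> closedin X (S k) \<and> S k \<subseteq> C (q k)) \<and>
     (\<forall>k x. 0 \<le> \<eta> k x) \<and> (\<forall>k. \<forall>x\<in>M. \<eta> k x \<noteq> 0 \<longrightarrow> x \<in> S k) \<and>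
     (\<forall>x\<in>M. \<exists>G N. openin X G \<and> x \<in> G \<and> G \<subseteq> M \<and> (\<forall>y\<in>G. \<forall>k\<ge>N. \<eta> k y = 0)) \<and>
     (\<forall>x\<in>M. (\<Sum>k | \<eta> k x \<noteq> 0. \<eta> k x) = 1)"

lemma partition_of_unityD:
  assumes "partition_of_unity X M C q \<eta> S"
  shows "q k \<in> M" "closedin X (S k)" "S k \<subseteq> C (q k)" "0 \<le> \<eta> k x"
    and "x \<in> M \<Longrightarrow> \<eta> k x \<noteq> 0 \<Longrightarrow> x \<in> S k"
    and "x \<in> M \<Longrightarrow> \<exists>G N. openin X G \<and> x \<in> G \<and> G \<subseteq> M \<and> (\<forall>y\<in>G. \<forall>k\<ge>N. \<eta> k y = 0)"
    and "x \<in> M \<Longrightarrow> (\<Sum>k | \<eta> k x \<noteq> 0. \<eta> k x) = 1"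
    and "x \<in> M \<Longrightarrow> finite {k. \<eta> k x \<noteq> 0}"
proof -
  show 1: "x \<in> M \<Longrightarrow> \<exists>G N. openin X G \<and> x \<in> G \<and> G \<subseteq> M \<and> (\<forall>y\<in>G. \<forall>k\<ge>N. \<eta> k y = 0)"
    using assms unfolding partition_of_unity_def by blast
  show "finite {k. \<eta> k x \<noteq> 0}" if x: "x \<in> M"
  proof -
    obtain G N where "x \<in> G" "\<forall>y\<in>G. \<forall>k\<ge>N. \<eta> k y = 0" using 1[OF x] by blast
    then have "{k. \<eta> k x \<noteq> 0} \<subseteq> {..<N}" by (auto simp: not_le[symmetric])
    then show ?thesis using finite_subset by blast
  qed
qed (use assms in \<open>unfold partition_of_unity_def, blast+\<close>)

definition weighted_sum :: "(nat \<Rightarrow> 'a \<Rightarrow> real) \<Rightarrow> (nat \<Rightarrow> 'a \<Rightarrow> complex) \<Rightarrow> 'a \<Rightarrow> complex" where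
  "weighted_sum \<eta> F x = (\<Sum>k | \<eta> k x \<noteq> 0. complex_of_real (\<eta> k x) * F k x)"

lemma weighted_sum_const:
  assumes "partition_of_unity X M C q \<eta> S" "x \<in> M" "\<And>k. \<eta> k x \<noteq> 0 \<Longrightarrow> F k x = c"
  shows "weighted_sum \<eta> F x = c"
proof -
  have "weighted_sum \<eta> F x = (\<Sum>k | \<eta> k x \<noteq> 0. complex_of_real (\<eta> k x) * c)"
    unfolding weighted_sum_def by (rule sum.cong) (use assms(3) in auto)
  also have "\<dots> = complex_of_real (\<Sum>k | \<eta> k x \<noteq> 0. \<eta> k x) * c"
    by (simp add: sum_distrib_right)
  finally show ?thesis using partition_of_unityD(7)[OF assms(1,2)] by simp
qed

lemma weighted_sum_add: "weighted_sum \<eta> (\<lambda>k x. F k x + G k x) x = weighted_sum \<eta> F x + weighted_sum \<eta> G x"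
  by (simp add: weighted_sum_def distrib_left sum.distrib)

lemma weighted_sum_diff: "weighted_sum \<eta> (\<lambda>k x. F k x - G k x) x = weighted_sum \<eta> F x - weighted_sum \<eta> G x"
  by (simp add: weighted_sum_def right_diff_distrib sum_subtractf)

text \<open>The \<open>k\<close>-th summand only has to be regular on the \<open>k\<close>-th set of the cover, since it vanishes off the
  closed support.\<close>

lemma (in function_sheaf) weighted_sum:
  assumes pu: "partition_of_unity X M C q \<eta> S" and \<eta>: "\<And>k. P M (\<lambda>x. complex_of_real (\<eta> k x))"
    and M: "openin X M" and C: "\<And>x. x \<in> M \<Longrightarrow> openin X (C x)"
    and T: "openin X T" "T \<subseteq> M" and F: "\<And>k. P (T \<inter> C (q k)) (F k)"
  shows "P T (weighted_sum \<eta> F)"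
proof (rule local[OF T(1)])
  note pu' = partition_of_unityD[OF pu]
  fix x assume x: "x \<in> T"
  then obtain G N where G: "openin X G" "x \<in> G" "G \<subseteq> M" "\<forall>y\<in>G. \<forall>k\<ge>N. \<eta> k y = 0"
    using pu'(6)[of x] T(2) by blast
  let ?G = "G \<inter> T"
  have oG: "openin X ?G" using G(1) T(1) by blast
  have summand: "P ?G (\<lambda>y. complex_of_real (\<eta> k y) * F k y)" for k
  proof (rule local[OF oG])
    fix y assume y: "y \<in> ?G"
    show "\<exists>G' f'. openin X G' \<and> y \<in> G' \<and> G' \<subseteq> ?G \<and> P G' f' \<and> (\<forall>z\<in>G'. complex_of_real (\<eta> k z) * F k z = f' z)"
    proof (cases "y \<in> S k")
      case True
      let ?H = "?G \<inter> C (q k)"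
      have oC: "openin X (C (q k))" by (rule C[OF pu'(1)])
      have oH: "openin X ?H" using oG oC by blast
      have "P ?H (\<lambda>y. complex_of_real (\<eta> k y) * F k y)"
        by (intro mult oH subset[OF M oH \<eta>] subset[OF _ oH F])
          (use G(3) T(1) oC in auto)
      then show ?thesis using True y pu'(3)[of k] oH by (intro exI[of _ ?H]) auto
    next
      case False
      let ?H = "?G - S k"
      have "openin X ?H" using oG pu'(2) by (rule openin_diff)
      then show ?thesis using False y pu'(5)[of _ k] G(3)
        by (intro exI[of _ ?H] exI[of _ "\<lambda>z. 0"]) (auto intro: const)
    qed
  qed
  have "P ?G (\<lambda>y. \<Sum>k<N. complex_of_real (\<eta> k y) * F k y)"
    by (rule sum[OF oG summand])
  moreover have "\<forall>y\<in>?G. weighted_sum \<eta> F y = (\<Sum>k<N. complex_of_real (\<eta> k y) * F k y)"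
    unfolding weighted_sum_def using G(4)
    by (intro ballI sum.mono_neutral_left) (auto simp: not_le[symmetric])
  ultimately show "\<exists>G f'. openin X G \<and> x \<in> G \<and> G \<subseteq> T \<and> P G f' \<and> (\<forall>y\<in>G. weighted_sum \<eta> F y = f' y)"
    using oG G(2) x by (intro exI[of _ ?G]) auto
qed

context smooth_mfd
begin

text \<open>A flat function of the squared distance in a chart. Its support is compact, hence closed in the whole manifold
  by the Hausdorff property, and this is why the extension by zero is smooth.\<close>

lemma bump:
  assumes G: "openin X G" "q \<in> G"
  obtains b :: "'a \<Rightarrow> real" and K where
    "smooth_fun \<A> (topspace X) (\<lambda>x. complex_of_real (b x))" "\<And>x. 0 \<le> b x" "0 < b q"
    "closedin X K" "K \<subseteq> G" "\<And>x. b x \<noteq> 0 \<Longrightarrow> x \<in> K"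
proof -
  obtain B :: "'e set" where B: "finite B" "\<And>v. v = (\<Sum>b\<in>B. (v \<bullet> b) *\<^sub>R b)"
    using orthonormal_basis by blast
  have "q \<in> topspace X" using G openin_subset by blast
  then obtain D \<phi> where c: "(D, \<phi>) \<in> \<A>" "q \<in> D" using chart_cover by blast
  note ch = chart[OF c(1)]
  have tD: "D \<subseteq> topspace X" using ch(1) by (rule openin_subset)
  obtain r where r: "r > 0" "cball (\<phi> q) r \<subseteq> \<phi> ` (D \<inter> G)"
    using bspec[OF iffD1[OF open_contains_cball ch(4)[OF G(1)]] imageI[OF IntI[OF c(2) G(2)]]] by blast
  obtain g where g: "homeomorphic_maps (subtopology X D) (top_of_set (\<phi> ` D)) \<phi> g"
    using ch(2) by (auto simp: homeomorphic_map_maps)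
  have g\<phi>: "g (\<phi> x) = x" if "x \<in> D" for x
    using g that tD by (auto simp: homeomorphic_maps_def)
  define K where "K = g ` cball (\<phi> q) r"
  have KDG: "K \<subseteq> D \<inter> G" using r(2) g\<phi> by (auto simp: K_def)
  have "compactin (top_of_set (\<phi> ` D)) (cball (\<phi> q) r)"
    using r(2) compact_cball_finite_dim[OF B] by (auto simp: compactin_subtopology)
  then have "compactin (subtopology X D) K"
    unfolding K_def by (rule image_compactin) (use g in \<open>simp add: homeomorphic_maps_def\<close>)
  then have K: "closedin X K"
    using Hausdorff by (simp add: compactin_subtopology compactin_imp_closedin)
  define u where "u = (\<lambda>v. r\<^sup>2 - (v - \<phi> q) \<bullet> (v - \<phi> q))"
  define b where "b = (\<lambda>x. if x \<in> D then flat 0 (u (\<phi> x)) else 0)"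
  have u: "Ck_on k UNIV u" for k
  proof -
    have 1: "Ck_on k UNIV (\<lambda>v. v + (- \<phi> q))"
      by (intro Ck_on_add Ck_on_id Ck_on_const open_UNIV)
    have "Ck_on k UNIV (\<lambda>v. r\<^sup>2 + (- 1) * ((v + - \<phi> q) \<bullet> (v + - \<phi> q)))"
      by (intro Ck_on_add Ck_on_const open_UNIV Ck_on_linear[OF bounded_linear_mult_right]
          Ck_on_bilinear[OF bounded_bilinear_inner] 1)
    then show ?thesis by (simp add: u_def)
  qed
  have fu: "Ck_on k UNIV (\<lambda>v. flat 0 (u v))" for k
    by (rule Ck_on_compose[OF _ real_expand open_UNIV open_UNIV _ u Ck_on_flat]) auto
  have bD: "smooth_fun \<A> D (\<lambda>x. complex_of_real (b x))"
  proof (rule smooth_funI)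
    fix E \<psi> k assume e: "(E, \<psi>) \<in> \<A>"
    note o = chart(4)[OF e ch(1)]
    have "smooth_on (\<psi> ` (E \<inter> D)) (\<phi> \<circ> inv_into E \<psi>)"
      using atlas e c(1) unfolding smooth_atlas_def by fast
    then have "Ck_on k (\<psi> ` (E \<inter> D)) (\<phi> \<circ> inv_into E \<psi>)" by (simp add: smooth_on_def)
    then have "Ck_on k (\<psi> ` (E \<inter> D)) (\<lambda>y. flat 0 (u ((\<phi> \<circ> inv_into E \<psi>) y)))"
      by (rule Ck_on_compose[OF B o open_UNIV subset_UNIV _ fu])
    then have "Ck_on k (\<psi> ` (E \<inter> D)) (\<lambda>y. complex_of_real (flat 0 (u ((\<phi> \<circ> inv_into E \<psi>) y))))"
      by (rule Ck_on_linear[OF bounded_linear_of_real o])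
    then show "Ck_on k (\<psi> ` (E \<inter> D)) ((\<lambda>x. complex_of_real (b x)) \<circ> inv_into E \<psi>)"
      by (rule Ck_on_cong[OF o, rotated]) (use chart_inv[OF e] in \<open>auto simp: b_def\<close>)
  qed
  have bK: "x \<in> K" if "b x \<noteq> 0" for x
  proof -
    have x: "x \<in> D" "0 < flat 0 (u (\<phi> x))" using that flat_nonneg[of 0 "u (\<phi> x)"]
      by (auto simp: b_def split: if_splits)
    then have "(norm (\<phi> x - \<phi> q))\<^sup>2 \<le> r\<^sup>2" by (simp add: flat_pos_iff u_def power2_norm_eq_inner)
    then have "norm (\<phi> x - \<phi> q) \<le> r" using r(1) by (simp add: power2_le_iff_abs_le)
    then have "\<phi> x \<in> cball (\<phi> q) r" by (simp add: dist_norm norm_minus_commute)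
    then show ?thesis using g\<phi>[OF x(1)] unfolding K_def by (metis image_eqI)
  qed
  show thesis
  proof (rule that[of b K])
    show "smooth_fun \<A> (topspace X) (\<lambda>x. complex_of_real (b x))"
    proof (rule smooth.local)
      fix x assume x: "x \<in> topspace X"
      show "\<exists>G f'. openin X G \<and> x \<in> G \<and> G \<subseteq> topspace X \<and> smooth_fun \<A> G f' \<and> (\<forall>y\<in>G. complex_of_real (b y) = f' y)"
      proof (cases "x \<in> D")
        case True
        then show ?thesis using bD ch(1) tD by (intro exI[of _ D]) auto
      next
        case False
        have "openin X (topspace X - K)" using K by (rule openin_diff[OF openin_topspace])
        then show ?thesis using False x KDG bK
          by (intro exI[of _ "topspace X - K"] exI[of _ "\<lambda>x. 0"]) (auto intro: smooth.const)
      qed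
    qed simp
    show "0 \<le> b x" for x by (simp add: b_def flat_nonneg)
    show "0 < b q" using c(2) r(1) by (simp add: b_def flat_pos_iff u_def)
  qed (use K KDG bK in auto)
qed

lemma smooth_real_continuous:
  assumes "openin X S" "smooth_fun \<A> S (\<lambda>x. complex_of_real (f x))" "x \<in> S"
  shows "(f \<longlongrightarrow> f x) (nhdsin X x)"
  using smooth_fun_continuous[OF assms(1,2)] assms(3) tendsto_Re[of "\<lambda>x. complex_of_real (f x)"]
  by (fastforce simp: continuous_fun_def)

text \<open>Countably many bumps suffice by the Lindelof property. Cutting the \<open>k\<close>-th bump off where an earlier
  one exceeds \<open>1 / (k + 1)\<close> makes the family locally finite, and the first bump that is nonzero at a point
  survives there.\<close>

lemma partition_of_unity_exists:
  assumes M: "openin X M" "M \<noteq> {}" and C: "\<And>x. x \<in> M \<Longrightarrow> openin X (C x)" "\<And>x. x \<in> M \<Longrightarrow> x \<in> C x"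
  obtains q \<eta> S where "partition_of_unity X M C q \<eta> S" "\<And>k. smooth_fun \<A> M (\<lambda>x. complex_of_real (\<eta> k x))"
proof -
  have tM: "M \<subseteq> topspace X" using M(1) by (rule openin_subset)
  define good where "good = (\<lambda>p b K. smooth_fun \<A> (topspace X) (\<lambda>x. complex_of_real (b x)) \<and>
    (\<forall>x. 0 \<le> b x) \<and> 0 < b p \<and> closedin X K \<and> K \<subseteq> C p \<and> (\<forall>x. b x \<noteq> 0 \<longrightarrow> x \<in> K))"
  have "\<exists>b K. good p b K" if "p \<in> M" for p
    by (rule bump[OF C(1)[OF that] C(2)[OF that]]) (unfold good_def, blast)
  then obtain b K where "\<And>p. p \<in> M \<Longrightarrow> good p (b p) (K p)"
    by metis
  then have b: "\<And>p. p \<in> M \<Longrightarrow> smooth_fun \<A> (topspace X) (\<lambda>x. complex_of_real (b p x))"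
    "\<And>p x. p \<in> M \<Longrightarrow> 0 \<le> b p x" "\<And>p. p \<in> M \<Longrightarrow> 0 < b p p"
    "\<And>p. p \<in> M \<Longrightarrow> closedin X (K p)" "\<And>p. p \<in> M \<Longrightarrow> K p \<subseteq> C p"
    "\<And>p x. p \<in> M \<Longrightarrow> b p x \<noteq> 0 \<Longrightarrow> x \<in> K p"
    unfolding good_def by blast+
  have bM: "smooth_fun \<A> M (\<lambda>x. complex_of_real (b p x))" if "p \<in> M" for p
    by (rule smooth.subset[OF openin_topspace M(1) b(1)[OF that] tM])
  have op: "openin X {x \<in> M. b p x > c}" if "p \<in> M" for p c
  proof (subst openin_subopen, intro ballI)
    fix x assume x: "x \<in> {x \<in> M. b p x > c}"
    have "eventually (\<lambda>y. b p y > c) (nhdsin X x)"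
      using smooth_real_continuous[OF M(1) bM[OF that], of x] x order_tendstoD(1) by fastforce
    then obtain G where "openin X G" "x \<in> G" "\<forall>y\<in>G. b p y > c"
      using x tM by (auto simp: eventually_nhdsin)
    then show "\<exists>T. openin X T \<and> x \<in> T \<and> T \<subseteq> {x \<in> M. b p x > c}"
      using M(1) x by (intro exI[of _ "G \<inter> M"]) auto
  qed
  define R where "R = (\<lambda>p. {x \<in> M. b p x > 0})"
  have "Lindelof_space (subtopology X M)"
    by (simp add: second second_countable_imp_Lindelof_space second_countable_subtopology)
  moreover have "\<forall>V\<in>R ` M. openin (subtopology X M) V"
    using op by (auto simp: R_def openin_open_subtopology[OF M(1)])
  moreover have "\<Union>(R ` M) = topspace (subtopology X M)"
    using b(3) tM by (auto simp: R_def)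
  ultimately obtain \<V> where \<V>: "countable \<V>" "\<V> \<subseteq> R ` M" "\<Union>\<V> = M"
    unfolding Lindelof_space_def using tM by (metis inf.absorb2 topspace_subtopology)
  then obtain Q where Q: "countable Q" "Q \<subseteq> M" "\<V> = R ` Q"
    by (metis countable_subset_image)
  have "Q \<noteq> {}" using \<V>(3) Q(3) M(2) by auto
  define q where "q = from_nat_into Q"
  have rq: "range q = Q" unfolding q_def by (rule range_from_nat_into[OF \<open>Q \<noteq> {}\<close> Q(1)])
  have qM: "q k \<in> M" for k using rq Q(2) by auto
  have cov: "\<exists>k. 0 < b (q k) x" if "x \<in> M" for x
    using that \<V>(3) Q(3) rq by (auto simp: R_def)
  define f where "f = (\<lambda>k x. b (q k) x * (\<Prod>j<k. flat 0 (1 / (real k + 1) - b (q j) x)))"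
  have f0: "0 \<le> f k x" for k x
    unfolding f_def by (intro mult_nonneg_nonneg prod_nonneg b(2) qM) (simp add: flat_nonneg)
  have fflat: "Ck_on k UNIV (\<lambda>z. complex_of_real (flat 0 (c - Re z)))" for k c
  proof -
    have "Ck_on k UNIV (\<lambda>z. c + (-1) * Re z)"
      by (intro Ck_on_add Ck_on_const open_UNIV Ck_on_linear[OF bounded_linear_mult_right]
          Ck_on_linear[OF bounded_linear_Re] Ck_on_id)
    then have "Ck_on k UNIV (\<lambda>z. flat 0 (c + (-1) * Re z))"
      by (rule Ck_on_compose[OF _ real_expand open_UNIV open_UNIV subset_UNIV _ Ck_on_flat, rotated]) simp
    then show ?thesis by (simp add: Ck_on_linear[OF bounded_linear_of_real open_UNIV])
  qed
  have fs: "smooth_fun \<A> M (\<lambda>x. complex_of_real (f k x))" for k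
  proof -
    have "smooth_fun \<A> M (\<lambda>x. complex_of_real (flat 0 (c - Re (complex_of_real (b (q j) x)))))" for j c
      by (rule smooth_fun_compose[OF M(1) open_UNIV fflat bM[OF qM]]) simp
    then have "smooth_fun \<A> M (\<lambda>x. complex_of_real (b (q k) x) *
        (\<Prod>j<k. complex_of_real (flat 0 (1 / (real k + 1) - b (q j) x))))"
      by (intro smooth.mult smooth.prod M(1) bM qM) simp
    then show ?thesis by (simp add: f_def)
  qed
  have fin: "\<exists>G N. openin X G \<and> x \<in> G \<and> G \<subseteq> M \<and> (\<forall>y\<in>G. \<forall>k\<ge>N. f k y = 0)" if x: "x \<in> M" for x
  proof -
    obtain j where j: "0 < b (q j) x" using cov[OF x] by blast
    define \<epsilon> where "\<epsilon> = b (q j) x / 2"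
    obtain N0 where N0: "1 / (real N0 + 1) < \<epsilon>"
      using j reals_Archimedean[of \<epsilon>] by (auto simp: \<epsilon>_def inverse_eq_divide add.commute)
    let ?G = "{y \<in> M. b (q j) y > \<epsilon>}"
    have "f k y = 0" if y: "y \<in> ?G" and k: "k \<ge> max N0 (Suc j)" for y k
    proof -
      have "1 / (real k + 1) \<le> 1 / (real N0 + 1)" using k by (intro divide_left_mono) auto
      then have "1 / (real k + 1) - b (q j) y \<le> 0" using N0 y by simp
      then have "flat 0 (1 / (real k + 1) - b (q j) y) = 0" by (simp add: flat_def)
      moreover have "j < k" using k by simp
      ultimately show ?thesis unfolding f_def by (auto intro!: prod_zero)
    qed
    then show ?thesis using op[OF qM[of j], of \<epsilon>] x j
      by (intro exI[of _ ?G] exI[of _ "max N0 (Suc j)"]) (auto simp: \<epsilon>_def)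
  qed
  have fpos: "\<exists>k. 0 < f k x" if x: "x \<in> M" for x
  proof -
    define k where "k = (LEAST k. 0 < b (q k) x)"
    have k: "0 < b (q k) x" unfolding k_def by (rule LeastI_ex[OF cov[OF x]])
    have "b (q j) x = 0" if "j < k" for j
      using not_less_Least[OF that[unfolded k_def]] b(2)[OF qM, of j x] by simp
    then have "0 < (\<Prod>j<k. flat 0 (1 / (real k + 1) - b (q j) x))"
      by (intro prod_pos) (auto simp: flat_pos_iff)
    then show ?thesis using k by (auto simp: f_def intro!: exI[of _ k])
  qed
  define s where "s = (\<lambda>x. \<Sum>k | f k x \<noteq> 0. f k x)"
  have ffin: "finite {k. f k x \<noteq> 0}" if x: "x \<in> M" for x
  proof -
    obtain G N where "x \<in> G" "\<forall>y\<in>G. \<forall>k\<ge>N. f k y = 0" using fin[OF x] by blast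
    then have "k < N" if "f k x \<noteq> 0" for k using that not_le by blast
    then have "{k. f k x \<noteq> 0} \<subseteq> {..<N}" by blast
    then show ?thesis using finite_subset by blast
  qed
  have spos: "0 < s x" if x: "x \<in> M" for x
  proof -
    obtain k where "0 < f k x" using fpos[OF x] by blast
    then show ?thesis unfolding s_def using f0 by (intro sum_pos2[OF ffin[OF x], of k]) auto
  qed
  have ss: "smooth_fun \<A> M (\<lambda>x. complex_of_real (s x))"
  proof (rule smooth.local[OF M(1)])
    fix x assume x: "x \<in> M"
    obtain G N where G: "openin X G" "x \<in> G" "G \<subseteq> M" "\<forall>y\<in>G. \<forall>k\<ge>N. f k y = 0"
      using fin[OF x] by blast
    have "smooth_fun \<A> G (\<lambda>y. \<Sum>k<N. complex_of_real (f k y))"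
      by (intro smooth.sum G(1) smooth.subset[OF M(1) G(1) fs G(3)])
    moreover have "\<forall>y\<in>G. complex_of_real (s y) = (\<Sum>k<N. complex_of_real (f k y))"
      unfolding s_def of_real_sum using G(4)
      by (intro ballI sum.mono_neutral_left) (auto simp: not_le[symmetric])
    ultimately show "\<exists>G f'. openin X G \<and> x \<in> G \<and> G \<subseteq> M \<and> smooth_fun \<A> G f' \<and> (\<forall>y\<in>G. complex_of_real (s y) = f' y)"
      using G by (intro exI[of _ G]) auto
  qed
  have s0: "0 \<le> s x" for x unfolding s_def using f0 by (intro sum_nonneg) auto
  define \<eta> where "\<eta> = (\<lambda>k x. f k x * inverse (s x))"
  have \<eta>0: "\<eta> k x \<noteq> 0 \<longleftrightarrow> f k x \<noteq> 0" if "x \<in> M" for k x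
    using spos[OF that] by (simp add: \<eta>_def)
  show thesis
  proof (rule that[of q \<eta> "\<lambda>k. K (q k)"])
    show "smooth_fun \<A> M (\<lambda>x. complex_of_real (\<eta> k x))" for k
    proof -
      have "smooth_fun \<A> M (\<lambda>x. complex_of_real (f k x) * inverse (complex_of_real (s x)))"
        by (intro smooth.mult smooth.inverse M(1) fs ss) (use spos in force)
      then show ?thesis by (simp add: \<eta>_def)
    qed
    have total: "(\<Sum>k | \<eta> k x \<noteq> 0. \<eta> k x) = 1" if "x \<in> M" for x
    proof -
      have "(\<Sum>k | \<eta> k x \<noteq> 0. \<eta> k x) = s x * inverse (s x)"
        unfolding s_def sum_distrib_right by (rule sum.cong) (use \<eta>0[OF that] in \<open>auto simp: \<eta>_def s_def\<close>)
      then show ?thesis using spos[OF that] by simp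
    qed
    have locfin: "\<exists>G N. openin X G \<and> x \<in> G \<and> G \<subseteq> M \<and> (\<forall>y\<in>G. \<forall>k\<ge>N. \<eta> k y = 0)" if x: "x \<in> M" for x
    proof -
      obtain G N where G: "openin X G" "x \<in> G" "G \<subseteq> M" "\<forall>y\<in>G. \<forall>k\<ge>N. f k y = 0"
        using fin[OF x] by blast
      then show ?thesis by (intro exI[of _ G] exI[of _ N]) (simp add: \<eta>_def)
    qed
    have supp: "x \<in> K (q k)" if "x \<in> M" "\<eta> k x \<noteq> 0" for k x
      using that b(6)[OF qM, of k x] by (auto simp: \<eta>_def f_def)
    have nonneg: "0 \<le> \<eta> k x" for k x
      using f0[of k x] s0[of x] by (simp add: \<eta>_def)
    show "partition_of_unity X M C q \<eta> (\<lambda>k. K (q k))"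
      unfolding partition_of_unity_def
      by (intro conjI allI ballI impI) (fact qM b(4)[OF qM] b(5)[OF qM] nonneg supp locfin total)+
  qed
qed

end

section \<open>Weighted sums of matrices\<close>

definition weighted_mat :: "nat \<Rightarrow> (nat \<Rightarrow> 'a \<Rightarrow> real) \<Rightarrow> (nat \<Rightarrow> complex mat) \<Rightarrow> 'a \<Rightarrow> complex mat" where
  "weighted_mat n \<eta> F x = mat n n (\<lambda>(i, j). \<Sum>k | \<eta> k x \<noteq> 0. complex_of_real (\<eta> k x) * F k $$ (i, j))"

lemma weighted_mat_carrier [simp]: "weighted_mat n \<eta> F x \<in> carrier_mat n n"
  by (simp add: weighted_mat_def)

lemma weighted_mat_index:
  "i < n \<Longrightarrow> j < n \<Longrightarrow> weighted_mat n \<eta> (\<lambda>k. F k x) x $$ (i, j) = weighted_sum \<eta> (\<lambda>k x. F k x $$ (i, j)) x"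
  by (simp add: weighted_mat_def weighted_sum_def)

lemma weighted_mat_cong:
  "(\<And>k. \<eta> k x \<noteq> 0 \<Longrightarrow> F k = G k) \<Longrightarrow> weighted_mat n \<eta> F x = weighted_mat n \<eta> G x"
  unfolding weighted_mat_def by (intro cong_mat refl) (auto intro!: sum.cong)

lemma weighted_mat_mult_left:
  assumes "A \<in> carrier_mat n n" "\<And>k. \<eta> k x \<noteq> 0 \<Longrightarrow> F k \<in> carrier_mat n n"
  shows "A * weighted_mat n \<eta> F x = weighted_mat n \<eta> (\<lambda>k. A * F k) x"
proof (rule eq_matI)
  fix i j assume "i < dim_row (weighted_mat n \<eta> (\<lambda>k. A * F k) x)" "j < dim_col (weighted_mat n \<eta> (\<lambda>k. A * F k) x)"
  then have ij: "i < n" "j < n" by (auto simp: weighted_mat_def)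
  have "(A * weighted_mat n \<eta> F x) $$ (i, j) =
      (\<Sum>l\<in>{0..<n}. \<Sum>k | \<eta> k x \<noteq> 0. complex_of_real (\<eta> k x) * (A $$ (i, l) * F k $$ (l, j)))"
    using ij by (subst mult_mat_index[OF assms(1) weighted_mat_carrier ij])
      (auto simp: weighted_mat_def sum_distrib_left mult_ac intro!: sum.cong)
  also have "\<dots> = (\<Sum>k | \<eta> k x \<noteq> 0. \<Sum>l\<in>{0..<n}. complex_of_real (\<eta> k x) * (A $$ (i, l) * F k $$ (l, j)))"
    by (rule sum.swap)
  also have "\<dots> = (\<Sum>k | \<eta> k x \<noteq> 0. complex_of_real (\<eta> k x) * (A * F k) $$ (i, j))"
    by (rule sum.cong) (simp_all add: mult_mat_index[OF assms(1,2) ij] sum_distrib_left)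
  finally show "(A * weighted_mat n \<eta> F x) $$ (i, j) = weighted_mat n \<eta> (\<lambda>k. A * F k) x $$ (i, j)"
    using ij by (simp add: weighted_mat_def)
qed (use assms(1) in \<open>auto simp: weighted_mat_def\<close>)

lemma weighted_mat_mult_right:
  assumes "A \<in> carrier_mat n n" "\<And>k. \<eta> k x \<noteq> 0 \<Longrightarrow> F k \<in> carrier_mat n n"
  shows "weighted_mat n \<eta> F x * A = weighted_mat n \<eta> (\<lambda>k. F k * A) x"
proof (rule eq_matI)
  fix i j assume "i < dim_row (weighted_mat n \<eta> (\<lambda>k. F k * A) x)" "j < dim_col (weighted_mat n \<eta> (\<lambda>k. F k * A) x)"
  then have ij: "i < n" "j < n" by (auto simp: weighted_mat_def)
  have "(weighted_mat n \<eta> F x * A) $$ (i, j) =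
      (\<Sum>l\<in>{0..<n}. \<Sum>k | \<eta> k x \<noteq> 0. complex_of_real (\<eta> k x) * (F k $$ (i, l) * A $$ (l, j)))"
    using ij by (subst mult_mat_index[OF weighted_mat_carrier assms(1) ij])
      (auto simp: weighted_mat_def sum_distrib_right mult.assoc intro!: sum.cong)
  also have "\<dots> = (\<Sum>k | \<eta> k x \<noteq> 0. \<Sum>l\<in>{0..<n}. complex_of_real (\<eta> k x) * (F k $$ (i, l) * A $$ (l, j)))"
    by (rule sum.swap)
  also have "\<dots> = (\<Sum>k | \<eta> k x \<noteq> 0. complex_of_real (\<eta> k x) * (F k * A) $$ (i, j))"
    by (rule sum.cong) (simp_all add: mult_mat_index[OF assms(2,1) ij] sum_distrib_left)
  finally show "(weighted_mat n \<eta> F x * A) $$ (i, j) = weighted_mat n \<eta> (\<lambda>k. F k * A) x $$ (i, j)"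
    using ij by (simp add: weighted_mat_def)
qed (use assms(1) in \<open>auto simp: weighted_mat_def\<close>)

lemma weighted_mat_one:
  assumes "partition_of_unity X M C q \<eta> S" "x \<in> M" "\<And>k. \<eta> k x \<noteq> 0 \<Longrightarrow> F k = 1\<^sub>m n"
  shows "weighted_mat n \<eta> F x = 1\<^sub>m n"
proof (rule eq_matI)
  fix i j assume ij: "i < dim_row (1\<^sub>m n :: complex mat)" "j < dim_col (1\<^sub>m n :: complex mat)"
  have "weighted_sum \<eta> (\<lambda>k x. F k $$ (i, j)) x = 1\<^sub>m n $$ (i, j)"
    by (rule weighted_sum_const[OF assms(1,2)]) (simp add: assms(3))
  then show "weighted_mat n \<eta> F x $$ (i, j) = 1\<^sub>m n $$ (i, j)"
    using ij by (simp add: weighted_mat_def weighted_sum_def)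
qed (auto simp: weighted_mat_def)

lemma weighted_mat_near_one:
  assumes pu: "partition_of_unity X M C q \<eta> S" and x: "x \<in> M"
    and near: "\<And>k i j. \<eta> k x \<noteq> 0 \<Longrightarrow> i < n \<Longrightarrow> j < n \<Longrightarrow> cmod (F k $$ (i, j) - 1\<^sub>m n $$ (i, j)) < 1 / (real n + 1)"
  shows "weighted_mat n \<eta> F x \<in> GL n"
proof (rule GL_near_one)
  note pu' = partition_of_unityD[OF pu]
  fix i j assume ij: "i < n" "j < n"
  let ?K = "{k. \<eta> k x \<noteq> 0}"
  have K: "finite ?K" "?K \<noteq> {}" using pu'(8)[OF x] pu'(7)[OF x] by force+
  have "weighted_mat n \<eta> F x $$ (i, j) - 1\<^sub>m n $$ (i, j) =
      (\<Sum>k\<in>?K. complex_of_real (\<eta> k x) * F k $$ (i, j)) - complex_of_real (\<Sum>k\<in>?K. \<eta> k x) * 1\<^sub>m n $$ (i, j)"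
    using ij pu'(7)[OF x] by (simp add: weighted_mat_def)
  also have "\<dots> = (\<Sum>k\<in>?K. complex_of_real (\<eta> k x) * (F k $$ (i, j) - 1\<^sub>m n $$ (i, j)))"
    by (simp add: right_diff_distrib sum_subtractf sum_distrib_right)
  also have "cmod \<dots> \<le> (\<Sum>k\<in>?K. cmod (complex_of_real (\<eta> k x) * (F k $$ (i, j) - 1\<^sub>m n $$ (i, j))))"
    by (rule norm_sum)
  also have "\<dots> < (\<Sum>k\<in>?K. \<eta> k x * (1 / (real n + 1)))"
  proof (rule sum_strict_mono[OF K])
    fix k assume k: "k \<in> ?K"
    then have "0 < \<eta> k x" using pu'(4)[of k x] by simp
    then show "cmod (complex_of_real (\<eta> k x) * (F k $$ (i, j) - 1\<^sub>m n $$ (i, j))) < \<eta> k x * (1 / (real n + 1))"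
      using near[of k i j] k ij by (simp add: norm_mult del: times_divide_eq_right)
  qed
  also have "\<dots> = 1 / (real n + 1)" using pu'(7)[OF x] by (simp add: sum_distrib_right[symmetric] sum_divide_distrib[symmetric])
  finally show "cmod (weighted_mat n \<eta> F x $$ (i, j) - 1\<^sub>m n $$ (i, j)) < 1 / (real n + 1)" .
qed simp

section \<open>Cocycles over contractible open sets are trivial\<close>

sublocale smooth_mfd \<subseteq> cts: function_sheaf X "continuous_fun X"
  by (rule continuous_function_sheaf)

lemma (in smooth_mfd) smooth_GL_continuous:
  "openin X S \<Longrightarrow> smooth.regular_GL S n g \<Longrightarrow> cts.regular_GL S n g"
  unfolding smooth.regular_GL_def cts.regular_GL_def using smooth_fun_continuous by blast

text \<open>An ordinary vector bundle on \<open>M\<close>, given by transition functions for a cover indexed by the points of \<open>M\<close>. The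
  index of the cover doubles as the choice of a frame over each point: over \<open>p\<close> one may use the frame \<open>p\<close>.\<close>

locale gl_cocycle = smooth_mfd X \<A> for X :: "'a topology" and \<A> :: "('a set \<times> ('a \<Rightarrow> 'e::real_inner)) set" +
  fixes M :: "'a set" and W :: "'a \<Rightarrow> 'a set" and n :: nat and e :: "'a \<Rightarrow> 'a \<Rightarrow> 'a \<Rightarrow> complex mat"
  assumes M: "openin X M"
    and W: "x \<in> M \<Longrightarrow> openin X (W x)" "x \<in> M \<Longrightarrow> x \<in> W x" "x \<in> M \<Longrightarrow> W x \<subseteq> M"
    and e_smooth: "x \<in> M \<Longrightarrow> y \<in> M \<Longrightarrow> smooth.regular_GL (W x \<inter> W y) n (e x y)"
    and e_mult: "x \<in> M \<Longrightarrow> y \<in> M \<Longrightarrow> z \<in> M \<Longrightarrow> p \<in> W x \<Longrightarrow> p \<in> W y \<Longrightarrow> p \<in> W z \<Longrightarrow>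
      e x y p * e y z p = e x z p"
begin

lemma e_GL: "x \<in> M \<Longrightarrow> y \<in> M \<Longrightarrow> p \<in> W x \<Longrightarrow> p \<in> W y \<Longrightarrow> e x y p \<in> GL n"
  using smooth.regular_GLD(1)[OF e_smooth] by blast

lemma e_carrier: "x \<in> M \<Longrightarrow> y \<in> M \<Longrightarrow> p \<in> W x \<Longrightarrow> p \<in> W y \<Longrightarrow> e x y p \<in> carrier_mat n n"
  by (rule GL_carrier[OF e_GL])

lemma e_one: assumes "x \<in> M" "p \<in> W x" shows "e x x p = 1\<^sub>m n"
proof -
  have c: "e x x p \<in> GL n" using assms by (intro e_GL)
  have "e x x p * e x x p = e x x p * 1\<^sub>m n" 
    using e_mult[of x x x p] assms right_mult_one_mat[OF GL_carrier[OF c]] by simp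
  then show ?thesis by (rule GL_cancel_left[OF c GL_carrier[OF c] one_carrier_mat])
qed

lemma e_continuous:
  assumes "x \<in> M" "y \<in> M" "p \<in> W x" "p \<in> W y" "i < n" "j < n"
  shows "((\<lambda>p. e x y p $$ (i, j)) \<longlongrightarrow> e x y p $$ (i, j)) (nhdsin X p)"
proof -
  have "openin X (W x \<inter> W y)" using W(1) assms by blast
  then have "continuous_fun X (W x \<inter> W y) (\<lambda>p. e x y p $$ (i, j))"
    using assms by (intro smooth_fun_continuous smooth.regular_GLD(2)[OF e_smooth])
  then show ?thesis using assms by (simp add: continuous_fun_def)
qed

end

text \<open>A partition of unity averages the transition matrices to a transport from the frame \<open>y\<close> over \<open>b\<close> to
  the frame \<open>x\<close> over \<open>a\<close>. It is the identity for \<open>x = y\<close> and \<open>a = b\<close>, hence invertible near the diagonal.\<close>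

locale gl_transport = gl_cocycle X \<A> M W n e
  for X :: "'a topology" and \<A> :: "('a set \<times> ('a \<Rightarrow> 'e::real_inner)) set" and M W n e +
  fixes q :: "nat \<Rightarrow> 'a" and \<eta> :: "nat \<Rightarrow> 'a \<Rightarrow> real" and S :: "nat \<Rightarrow> 'a set"
  assumes pu: "partition_of_unity X M W q \<eta> S"
    and \<eta>_smooth: "smooth_fun \<A> M (\<lambda>x. complex_of_real (\<eta> k x))"
begin

lemmas pu' = partition_of_unityD[OF pu]

definition transport :: "'a \<Rightarrow> 'a \<Rightarrow> 'a \<Rightarrow> 'a \<Rightarrow> complex mat" where
  "transport x y a b = weighted_mat n \<eta> (\<lambda>k. e x (q k) a * e (q k) y b) b"

lemma support_W: "b \<in> M \<Longrightarrow> \<eta> k b \<noteq> 0 \<Longrightarrow> b \<in> W (q k)"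
  using pu'(3,5) by blast

lemma transport_frame:
  assumes "x \<in> M" "x' \<in> M" "y \<in> M" "y' \<in> M" "a \<in> W x" "a \<in> W x'" "b \<in> W y" "b \<in> W y'"
    and near: "\<And>k. \<eta> k b \<noteq> 0 \<Longrightarrow> a \<in> W (q k)"
  shows "e x' x a * transport x y a b * e y y' b = transport x' y' a b"
proof -
  have bM: "b \<in> M" using W(3) assms by blast
  have c: "e x (q k) a \<in> carrier_mat n n" "e (q k) y b \<in> carrier_mat n n" if "\<eta> k b \<noteq> 0" for k
    using assms that support_W[OF bM that] pu'(1) by (auto intro!: e_carrier)
  have c': "e x' x a \<in> carrier_mat n n" "e y y' b \<in> carrier_mat n n"
    using assms by (auto intro!: e_carrier)
  let ?F = "\<lambda>k. e x (q k) a * e (q k) y b"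
  have F: "?F k \<in> carrier_mat n n" "e x' x a * ?F k \<in> carrier_mat n n" if "\<eta> k b \<noteq> 0" for k
    by (intro mult_carrier_mat[of _ n n _ n] c[OF that] c'(1))+
  have "e x' x a * transport x y a b * e y y' b = weighted_mat n \<eta> (\<lambda>k. e x' x a * ?F k) b * e y y' b"
    unfolding transport_def by (subst weighted_mat_mult_left[OF c'(1) F(1)]) simp_all
  also have "\<dots> = weighted_mat n \<eta> (\<lambda>k. e x' x a * ?F k * e y y' b) b"
    by (rule weighted_mat_mult_right[OF c'(2) F(2)])
  also have "\<dots> = transport x' y' a b"
    unfolding transport_def
  proof (rule weighted_mat_cong)
    fix k assume k: "\<eta> k b \<noteq> 0"
    note ck = c[OF k] and bW = support_W[OF bM k] and aW = near[OF k]
    have "e x' x a * (e x (q k) a * e (q k) y b) * e y y' b = (e x' x a * e x (q k) a) * (e (q k) y b * e y y' b)"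
      using ck c' by (simp add: assoc_mult_mat[of _ n n _ n _ n])
    also have "\<dots> = e x' (q k) a * e (q k) y' b"
      using assms aW bW pu'(1) by (simp add: e_mult)
    finally show "e x' x a * (e x (q k) a * e (q k) y b) * e y y' b = e x' (q k) a * e (q k) y' b" .
  qed
  finally show ?thesis .
qed

lemma transport_diagonal:
  assumes "x \<in> M" "a \<in> W x"
  shows "transport x x a a = 1\<^sub>m n"
  unfolding transport_def
proof (rule weighted_mat_one[OF pu])
  show aM: "a \<in> M" using W(3) assms by blast
  show "e x (q k) a * e (q k) x a = 1\<^sub>m n" if "\<eta> k a \<noteq> 0" for k
    using assms support_W[OF aM that] pu'(1) by (simp add: e_mult e_one)
qed

lemma transport_index:
  assumes "z \<in> M" "a \<in> W z" "b \<in> W z" "\<And>k. k < N \<Longrightarrow> \<eta> k b \<noteq> 0 \<Longrightarrow> a \<in> W (q k)"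
    and N: "\<And>k. N \<le> k \<Longrightarrow> \<eta> k b = 0" and ij: "i < n" "j < n"
  shows "transport z z a b $$ (i, j) =
    (\<Sum>k<N. complex_of_real (\<eta> k b) * (\<Sum>l\<in>{0..<n}. e z (q k) a $$ (i, l) * e (q k) z b $$ (l, j)))"
proof -
  have bM: "b \<in> M" using W(3) assms by blast
  have lt: "k < N" if "\<eta> k b \<noteq> 0" for k using N that not_le by blast
  have "transport z z a b $$ (i, j) =
      (\<Sum>k | \<eta> k b \<noteq> 0. complex_of_real (\<eta> k b) * (e z (q k) a * e (q k) z b) $$ (i, j))"
    using ij by (simp add: transport_def weighted_mat_def)
  also have "\<dots> = (\<Sum>k | \<eta> k b \<noteq> 0. complex_of_real (\<eta> k b) *
      (\<Sum>l\<in>{0..<n}. e z (q k) a $$ (i, l) * e (q k) z b $$ (l, j)))"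
  proof (rule sum.cong)
    fix k assume "k \<in> {k. \<eta> k b \<noteq> 0}"
    then have k: "\<eta> k b \<noteq> 0" by simp
    have c: "e z (q k) a \<in> carrier_mat n n" "e (q k) z b \<in> carrier_mat n n"
      using assms(1-4) k lt[OF k] support_W[OF bM k] pu'(1) by (auto intro!: e_carrier)
    show "complex_of_real (\<eta> k b) * (e z (q k) a * e (q k) z b) $$ (i, j) =
        complex_of_real (\<eta> k b) * (\<Sum>l\<in>{0..<n}. e z (q k) a $$ (i, l) * e (q k) z b $$ (l, j))"
      by (simp only: mult_mat_index[OF c ij])
  qed simp
  also have "\<dots> = (\<Sum>k<N. complex_of_real (\<eta> k b) *
      (\<Sum>l\<in>{0..<n}. e z (q k) a $$ (i, l) * e (q k) z b $$ (l, j)))"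
    by (rule sum.mono_neutral_left) (use lt in auto)
  finally show ?thesis .
qed

text \<open>Near \<open>b\<close> only the first \<open>N\<close> members of the partition of unity matter. A member whose closed support misses \<open>b\<close>
  vanishes nearby; for the others the transition matrices at both points are continuous.\<close>

lemma transport_tendsto:
  assumes z: "z \<in> M" and a: "a \<in> W z" and b: "b \<in> W z"
    and G: "openin X G" "b \<in> G" "\<And>y k. y \<in> G \<Longrightarrow> N \<le> k \<Longrightarrow> \<eta> k y = 0"
    and near: "\<And>k. k < N \<Longrightarrow> b \<in> S k \<Longrightarrow> a \<in> W (q k)" and ij: "i < n" "j < n"
  shows "((\<lambda>r. transport z z (fst r) (snd r) $$ (i, j)) \<longlongrightarrow> transport z z a b $$ (i, j))
    (nhdsin X a \<times>\<^sub>F nhdsin X b)"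
proof -
  let ?F = "nhdsin X a \<times>\<^sub>F nhdsin X b"
  let ?t = "\<lambda>k a b. complex_of_real (\<eta> k b) * (\<Sum>l\<in>{0..<n}. e z (q k) a $$ (i, l) * e (q k) z b $$ (l, j))"
  have aM: "a \<in> M" and bM: "b \<in> M" using W(3) z a b by blast+
  have tX: "a \<in> topspace X" "b \<in> topspace X" using aM bM openin_subset[OF M] by blast+
  have evf: "eventually (\<lambda>r. fst r \<in> U) ?F" if "openin X U" "a \<in> U" for U
    by (rule eventually_compose_filterlim[OF eventually_nhdsin_in[OF that] filterlim_fst])
  have evs: "eventually (\<lambda>r. snd r \<in> U) ?F" if "openin X U" "b \<in> U" for U
    by (rule eventually_compose_filterlim[OF eventually_nhdsin_in[OF that] filterlim_snd])
  have off: "eventually (\<lambda>r. \<eta> k (snd r) = 0) ?F" "\<eta> k b = 0" if "b \<notin> S k" for k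
  proof -
    have o: "openin X (M - S k)" by (rule openin_diff[OF M pu'(2)])
    show "eventually (\<lambda>r. \<eta> k (snd r) = 0) ?F"
      by (rule eventually_mono[OF evs[OF o]]) (use bM that pu'(5)[of _ k] in blast)+
    show "\<eta> k b = 0" using pu'(5) bM that by blast
  qed
  have W': "openin X (W (q k))" for k by (rule W(1)[OF pu'(1)])
  have ev: "eventually (\<lambda>r. \<eta> k (snd r) \<noteq> 0 \<longrightarrow> fst r \<in> W (q k)) ?F" if "k < N" for k
  proof (cases "b \<in> S k")
    case True
    show ?thesis by (rule eventually_mono[OF evf[OF W' near[OF that True]]]) simp
  next
    case False
    show ?thesis by (rule eventually_mono[OF off(1)[OF False]]) simp
  qed
  have "eventually (\<lambda>r. \<forall>k\<in>{..<N}. \<eta> k (snd r) \<noteq> 0 \<longrightarrow> fst r \<in> W (q k)) ?F"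
    using ev by (intro eventually_ball_finite) auto
  then have eq: "eventually (\<lambda>r. (\<Sum>k<N. ?t k (fst r) (snd r)) = transport z z (fst r) (snd r) $$ (i, j)) ?F"
    using evf[OF W(1)[OF z] a] evs[OF W(1)[OF z] b] evs[OF G(1,2)]
    by eventually_elim (rule transport_index[symmetric, OF z]; use ij G(3) in auto)
  have lim: "((\<lambda>r. ?t k (fst r) (snd r)) \<longlongrightarrow> ?t k a b) ?F" if k: "k < N" for k
  proof (cases "b \<in> S k")
    case True
    have aq: "a \<in> W (q k)" and bq: "b \<in> W (q k)" using near[OF k True] pu'(3) True by blast+
    have 1: "((\<lambda>r. complex_of_real (\<eta> k (snd r))) \<longlongrightarrow> complex_of_real (\<eta> k b)) ?F"
      using smooth_real_continuous[OF M \<eta>_smooth bM]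
      by (intro tendsto_of_real) (rule filterlim_compose[OF _ filterlim_snd])
    have 2: "((\<lambda>r. e z (q k) (fst r) $$ (i, l)) \<longlongrightarrow> e z (q k) a $$ (i, l)) ?F" if "l < n" for l
      by (rule filterlim_compose[OF e_continuous[OF z pu'(1) a aq ij(1) that] filterlim_fst])
    have 3: "((\<lambda>r. e (q k) z (snd r) $$ (l, j)) \<longlongrightarrow> e (q k) z b $$ (l, j)) ?F" if "l < n" for l
      by (rule filterlim_compose[OF e_continuous[OF pu'(1) z bq b that ij(2)] filterlim_snd])
    show ?thesis by (intro tendsto_mult tendsto_sum 1 2 3) auto
  next
    case False
    have 0: "?t k a b = 0" using off(2)[OF False] by simp
    have "eventually (\<lambda>r. ?t k (fst r) (snd r) = 0) ?F"
      using off(1)[OF False] by eventually_elim simp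
    then show ?thesis unfolding 0 by (rule tendsto_eventually)
  qed
  have "((\<lambda>r. \<Sum>k<N. ?t k (fst r) (snd r)) \<longlongrightarrow> (\<Sum>k<N. ?t k a b)) ?F"
    by (rule tendsto_sum) (rule lim, simp)
  moreover have "(\<Sum>k<N. ?t k a b) = transport z z a b $$ (i, j)"
    by (rule transport_index[symmetric, OF z a b _ _ ij]) (use near off(2) G(2,3) in blast)+
  ultimately show ?thesis using Lim_transform_eventually[OF _ eq] by simp
qed

definition transport_nbhd :: "'a \<Rightarrow> 'a set \<Rightarrow> nat \<Rightarrow> bool" where
  "transport_nbhd z G N \<longleftrightarrow> openin X G \<and> z \<in> G \<and> G \<subseteq> W z \<and>
     (\<forall>y\<in>G. \<forall>k\<ge>N. \<eta> k y = 0) \<and> (\<forall>a\<in>G. \<forall>b\<in>G. \<forall>k<N. b \<in> S k \<longrightarrow> a \<in> W (q k)) \<and>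
     (\<forall>a\<in>G. \<forall>b\<in>G. transport z z a b \<in> GL n)"

text \<open>Among the finitely many members that are nonzero near \<open>z\<close>, avoid the closed supports that miss \<open>z\<close> and stay
  in the cover sets that belong to the others.\<close>

lemma transport_nbhd_exists:
  assumes z: "z \<in> M"
  shows "\<exists>G N. transport_nbhd z G N"
proof -
  obtain G0 N where G0: "openin X G0" "z \<in> G0" "G0 \<subseteq> M" "\<forall>y\<in>G0. \<forall>k\<ge>N. \<eta> k y = 0"
    using pu'(6)[OF z] by blast
  define H where "H = (\<lambda>k. if z \<in> S k then W (q k) else M - S k)"
  have H: "openin X (H k)" "z \<in> H k" for k
    using W(1)[OF pu'(1)] openin_diff[OF M pu'(2)] z pu'(3)[of k] by (auto simp: H_def)
  define G1 where "G1 = G0 \<inter> W z \<inter> (\<Inter>k\<in>{..<N}. H k)"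
  have oG1: "openin X G1"
  proof (cases "N = 0")
    case True
    then show ?thesis using G0 W(1)[OF z] by (auto simp: G1_def)
  next
    case False
    then have "openin X (\<Inter>k\<in>{..<N}. H k)" using H(1) by (intro openin_Inter) auto
    then show ?thesis using G0 W(1)[OF z] by (auto simp: G1_def)
  qed
  have zG1: "z \<in> G1" using G0 W(2)[OF z] H(2) by (auto simp: G1_def)
  have nb: "a \<in> W (q k)" if "a \<in> G1" "b \<in> G1" "k < N" "b \<in> S k" for a b k
  proof -
    have "a \<in> H k" "b \<in> H k" using that by (auto simp: G1_def)
    then show ?thesis using that(4) by (auto simp: H_def split: if_splits)
  qed
  have "eventually (\<lambda>r. \<forall>i\<in>{..<n}. \<forall>j\<in>{..<n}.
      cmod (transport z z (fst r) (snd r) $$ (i, j) - 1\<^sub>m n $$ (i, j)) < 1 / (real n + 1)) (nhdsin X z \<times>\<^sub>F nhdsin X z)"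
  proof (intro eventually_ball_finite ballI finite_lessThan)
    fix i j assume "i \<in> {..<n}" "j \<in> {..<n}"
    then have ij: "i < n" "j < n" by auto
    have "((\<lambda>r. transport z z (fst r) (snd r) $$ (i, j)) \<longlongrightarrow> transport z z z z $$ (i, j)) (nhdsin X z \<times>\<^sub>F nhdsin X z)"
      by (rule transport_tendsto[OF z W(2)[OF z] W(2)[OF z] oG1 zG1 _ _ ij])
        (use G0(4) nb zG1 in \<open>auto simp: G1_def\<close>)
    then have "eventually (\<lambda>r. dist (transport z z (fst r) (snd r) $$ (i, j)) (1\<^sub>m n $$ (i, j)) < 1 / (real n + 1))
        (nhdsin X z \<times>\<^sub>F nhdsin X z)"
      unfolding transport_diagonal[OF z W(2)[OF z]] by (rule tendstoD) simp
    then show "eventually (\<lambda>r. cmod (transport z z (fst r) (snd r) $$ (i, j) - 1\<^sub>m n $$ (i, j)) < 1 / (real n + 1))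
        (nhdsin X z \<times>\<^sub>F nhdsin X z)"
      by (simp add: dist_norm)
  qed
  then obtain Q where Q: "eventually Q (nhdsin X z)"
    "\<And>a b. Q a \<Longrightarrow> Q b \<Longrightarrow> (\<forall>i\<in>{..<n}. \<forall>j\<in>{..<n}. cmod (transport z z a b $$ (i, j) - 1\<^sub>m n $$ (i, j)) < 1 / (real n + 1))"
    unfolding eventually_prod_same by auto
  obtain G2 where G2: "openin X G2" "z \<in> G2" "\<forall>a\<in>G2. Q a"
    using Q(1) z openin_subset[OF M] by (auto simp: eventually_nhdsin)
  have "transport z z a b \<in> GL n" if "a \<in> G2" "b \<in> G2" for a b
    by (rule GL_near_one) (use Q(2)[of a b] G2(3) that in \<open>auto simp: transport_def\<close>)
  then have "transport_nbhd z (G1 \<inter> G2) N"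
    unfolding transport_nbhd_def using oG1 zG1 G2 nb G0(4) by (auto simp: G1_def)
  then show ?thesis by blast
qed

end

text \<open>Near a point of the homotopy, both parameters may be varied independently.\<close>

lemma homotopy_nbhd:
  assumes h: "continuous_map (prod_topology (top_of_set {0..1::real}) (subtopology X M)) (subtopology X M) h"
    and M: "openin X M" and t: "t \<in> {0..1}" and p: "p \<in> M" and G: "openin X G" "h (t, p) \<in> G"
  shows "\<exists>d P. 0 < d \<and> openin X P \<and> p \<in> P \<and> P \<subseteq> M \<and> (\<forall>t'\<in>{0..1}. \<forall>p'\<in>P. \<bar>t' - t\<bar> < d \<longrightarrow> h (t', p') \<in> G)"
proof -
  have tM: "topspace (subtopology X M) = M" using openin_subset[OF M] by auto
  let ?Y = "prod_topology (top_of_set {0..1::real}) (subtopology X M)"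
  have hM: "h (t, p) \<in> M"
    using continuous_map_image_subset_topspace[OF h] t p tM by (auto simp: image_subset_iff)
  have "openin (subtopology X M) (G \<inter> M)" using G(1) by (simp add: openin_subtopology_Int)
  then have "openin ?Y {z \<in> topspace ?Y. h z \<in> G \<inter> M}"
    by (rule openin_continuous_map_preimage[OF h])
  moreover have "(t, p) \<in> {z \<in> topspace ?Y. h z \<in> G \<inter> M}"
    using t p tM G(2) hM by simp
  ultimately obtain U V where UV: "openin (top_of_set {0..1}) U" "openin (subtopology X M) V" "t \<in> U" "p \<in> V"
    "U \<times> V \<subseteq> {z \<in> topspace ?Y. h z \<in> G \<inter> M}"
    unfolding openin_prod_topology_alt by meson
  obtain U' where U': "open U'" "U = U' \<inter> {0..1}" using UV(1) by (auto simp: openin_open)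
  obtain d where d: "0 < d" "ball t d \<subseteq> U'" using U' UV(3) open_contains_ball by blast
  have V: "openin X V" "V \<subseteq> M" using UV(2) M openin_trans_full openin_subset[OF UV(2)] tM by auto
  have "h (t', p') \<in> G" if "t' \<in> {0..1}" "p' \<in> V" "\<bar>t' - t\<bar> < d" for t' p'
  proof -
    have "t' \<in> U" using that d(2) U'(2) by (auto simp: dist_real_def abs_minus_commute)
    then show ?thesis using UV(5) that(2) by blast
  qed
  then show ?thesis using d(1) V UV(4) by (intro exI[of _ d] exI[of _ V]) auto
qed

context gl_transport
begin

text \<open>A step length short enough to keep neighbouring points of the contracting path of \<open>p\<close> in a common
  neighbourhood on which the transport is invertible. Locally it may be taken constant, by compactness of the
  unit interval; the partition of unity makes it depend continuously on \<open>p\<close>.\<close>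

lemma step_length:
  assumes h: "continuous_map (prod_topology (top_of_set {0..1::real}) (subtopology X M)) (subtopology X M) h"
    and G: "\<And>z. z \<in> M \<Longrightarrow> openin X (G z)" "\<And>z. z \<in> M \<Longrightarrow> z \<in> G z" and M0: "M \<noteq> {}"
  obtains \<delta> :: "'a \<Rightarrow> real" where "\<And>p. p \<in> M \<Longrightarrow> 0 < \<delta> p" "\<And>p. p \<in> M \<Longrightarrow> (\<delta> \<longlongrightarrow> \<delta> p) (nhdsin X p)"
    "\<And>p t t'. p \<in> M \<Longrightarrow> t \<in> {0..1} \<Longrightarrow> t' \<in> {0..1} \<Longrightarrow> \<bar>t - t'\<bar> \<le> \<delta> p \<Longrightarrow>
       \<exists>z\<in>M. h (t, p) \<in> G z \<and> h (t', p) \<in> G z"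
proof -
  have tM: "topspace (subtopology X M) = M" using openin_subset[OF M] by auto
  have hM: "h (t, p) \<in> M" if "t \<in> {0..1}" "p \<in> M" for t p
    using continuous_map_image_subset_topspace[OF h] that tM by (auto simp: image_subset_iff)
  define ok where "ok = (\<lambda>p d P. 0 < d \<and> openin X P \<and> p \<in> P \<and> P \<subseteq> M \<and>
    (\<forall>p'\<in>P. \<forall>t\<in>{0..1}. \<forall>t'\<in>{0..1}. \<bar>t - t'\<bar> \<le> d \<longrightarrow> (\<exists>z\<in>M. h (t, p') \<in> G z \<and> h (t', p') \<in> G z)))"
  have "\<exists>d P. ok p d P" if p: "p \<in> M" for p
  proof -
    define nb where "nb = (\<lambda>t d P. 0 < d \<and> openin X P \<and> p \<in> P \<and> P \<subseteq> M \<and>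
      (\<forall>t'\<in>{0..1}. \<forall>p'\<in>P. \<bar>t' - t\<bar> < d \<longrightarrow> h (t', p') \<in> G (h (t, p))))"
    have "\<exists>d P. nb t d P" if "t \<in> {0..1}" for t
      unfolding nb_def by (rule homotopy_nbhd[OF h M that p G(1)[OF hM[OF that p]] G(2)[OF hM[OF that p]]])
    then obtain d P where "\<And>t. t \<in> {0..1} \<Longrightarrow> nb t (d t) (P t)" by metis
    then have dP: "\<And>t. t \<in> {0..1} \<Longrightarrow> 0 < d t" "\<And>t. t \<in> {0..1} \<Longrightarrow> openin X (P t)"
      "\<And>t. t \<in> {0..1} \<Longrightarrow> p \<in> P t" "\<And>t. t \<in> {0..1} \<Longrightarrow> P t \<subseteq> M"
      "\<And>t t' p'. t \<in> {0..1} \<Longrightarrow> t' \<in> {0..1} \<Longrightarrow> p' \<in> P t \<Longrightarrow> \<bar>t' - t\<bar> < d t \<Longrightarrow> h (t', p') \<in> G (h (t, p))"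
      unfolding nb_def by blast+
    obtain C where C: "C \<subseteq> {0..1}" "finite C" "{0..1} \<subseteq> (\<Union>t\<in>C. ball t (d t / 2))"
    proof (rule compactE_image[of "{0..1::real}" "{0..1}" "\<lambda>t. ball t (d t / 2)"])
      show "{0..1} \<subseteq> (\<Union>t\<in>{0..1}. ball t (d t / 2))" using dP(1) by force
    qed auto
    have "C \<noteq> {}" using C(3) by force
    define D where "D = Min ((\<lambda>t. d t / 2) ` C)"
    define Q where "Q = (\<Inter>t\<in>C. P t)"
    have D: "D \<le> d t / 2" if "t \<in> C" for t
      unfolding D_def using C(2) that by (intro Min_le) auto
    have D0: "0 < D"
      using C(1,2) \<open>C \<noteq> {}\<close> dP(1) unfolding D_def by (subst Min_gr_iff) auto
    have "openin X Q"
      unfolding Q_def using C(1,2) \<open>C \<noteq> {}\<close> dP(2) by (intro openin_Inter) auto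
    moreover have "p \<in> Q" unfolding Q_def using C(1) dP(3) by blast
    moreover have "Q \<subseteq> M" unfolding Q_def using C(1) \<open>C \<noteq> {}\<close> dP(4) by blast
    ultimately have Q: "openin X Q" "p \<in> Q" "Q \<subseteq> M" by auto
    have "ok p D Q"
      unfolding ok_def
    proof (intro conjI ballI impI)
      fix p' t t' assume a: "p' \<in> Q" "t \<in> {0..1}" "t' \<in> {0..1}" "\<bar>t - t'\<bar> \<le> D"
      obtain c where c: "c \<in> C" "t \<in> ball c (d c / 2)" using C(3) a(2) by blast
      have c1: "c \<in> {0..1}" and p'c: "p' \<in> P c" using c(1) C(1) a(1) by (auto simp: Q_def)
      have "\<bar>c - t\<bar> < d c / 2" using c(2) by (simp add: dist_real_def)
      then have "\<bar>t - c\<bar> < d c" "\<bar>t' - c\<bar> < d c"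
        using D[OF c(1)] a(4) D0 by linarith+
      then show "\<exists>z\<in>M. h (t, p') \<in> G z \<and> h (t', p') \<in> G z"
        using dP(5)[OF c1 a(2) p'c] dP(5)[OF c1 a(3) p'c] hM[OF c1 p] by blast
    qed (use D0 Q in auto)
    then show ?thesis by blast
  qed
  then obtain d P where dP: "\<And>p. p \<in> M \<Longrightarrow> ok p (d p) (P p)" by metis
  obtain q' \<xi> S' where \<xi>: "partition_of_unity X M P q' \<xi> S'" "\<And>k. smooth_fun \<A> M (\<lambda>x. complex_of_real (\<xi> k x))"
    using partition_of_unity_exists[OF M M0, of P] dP unfolding ok_def by metis
  note \<xi>' = partition_of_unityD[OF \<xi>(1)]
  define \<delta> where "\<delta> = (\<lambda>p. \<Sum>k | \<xi> k p \<noteq> 0. \<xi> k p * d (q' k))"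
  have ex: "\<exists>k. \<xi> k p \<noteq> 0 \<and> \<delta> p \<le> d (q' k)" if p: "p \<in> M" for p
  proof (rule ccontr)
    assume no: "\<nexists>k. \<xi> k p \<noteq> 0 \<and> \<delta> p \<le> d (q' k)"
    let ?K = "{k. \<xi> k p \<noteq> 0}"
    have "?K \<noteq> {}" using \<xi>'(7)[OF p] by force
    have "(\<Sum>k\<in>?K. \<xi> k p * d (q' k)) < (\<Sum>k\<in>?K. \<xi> k p * \<delta> p)"
    proof (rule sum_strict_mono[OF \<xi>'(8)[OF p] \<open>?K \<noteq> {}\<close>])
      fix k assume k: "k \<in> ?K"
      then have "0 < \<xi> k p" using \<xi>'(4)[of k p] by simp
      moreover have "d (q' k) < \<delta> p" using no k by force
      ultimately show "\<xi> k p * d (q' k) < \<xi> k p * \<delta> p" by (rule mult_strict_left_mono[rotated])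
    qed
    also have "\<dots> = \<delta> p" using \<xi>'(7)[OF p] by (simp add: sum_distrib_right[symmetric])
    finally show False by (simp add: \<delta>_def)
  qed
  have d0: "0 < d p" if "p \<in> M" for p using dP[OF that] by (simp add: ok_def)
  show thesis
  proof (rule that[of \<delta>])
    fix p assume p: "p \<in> M"
    let ?K = "{k. \<xi> k p \<noteq> 0}"
    have "?K \<noteq> {}" using \<xi>'(7)[OF p] by force
    then show "0 < \<delta> p"
      unfolding \<delta>_def using \<xi>'(4) d0[OF \<xi>'(1)]
      by (intro sum_pos \<xi>'(8)[OF p] mult_pos_pos) (auto simp: order_less_le)
    have "smooth_fun \<A> M (weighted_sum \<xi> (\<lambda>k x. complex_of_real (d (q' k))))"
    proof (rule smooth.weighted_sum[OF \<xi> M _ M])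
      show oP: "openin X (P x)" if "x \<in> M" for x using dP[OF that] by (simp add: ok_def)
      show "smooth_fun \<A> (M \<inter> P (q' k)) (\<lambda>x. complex_of_real (d (q' k)))" for k
        using M oP[OF \<xi>'(1)] by (intro smooth.const) blast
    qed simp
    moreover have "weighted_sum \<xi> (\<lambda>k x. complex_of_real (d (q' k))) = (\<lambda>p. complex_of_real (\<delta> p))"
      by (auto simp: weighted_sum_def \<delta>_def)
    ultimately show "(\<delta> \<longlongrightarrow> \<delta> p) (nhdsin X p)"
      using smooth_real_continuous[OF M _ p] by metis
  next
    fix p and t t' :: real assume a: "p \<in> M" "t \<in> {0..1}" "t' \<in> {0..1}" "\<bar>t - t'\<bar> \<le> \<delta> p"
    obtain k where k: "\<xi> k p \<noteq> 0" "\<delta> p \<le> d (q' k)" using ex[OF a(1)] by blast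
    have "p \<in> P (q' k)" using \<xi>'(5)[OF a(1) k(1)] \<xi>'(3) by blast
    moreover have "\<bar>t - t'\<bar> \<le> d (q' k)" using a(4) k(2) by simp
    ultimately show "\<exists>z\<in>M. h (t, p) \<in> G z \<and> h (t', p) \<in> G z"
      using dP[OF \<xi>'(1)[of k]] a(2,3) unfolding ok_def by blast
  qed
qed

text \<open>Transport step by step along the contracting path. Past the end of the path further steps are identities,
  so the number of steps may be chosen locally constant, and the result is continuous.\<close>

lemma topological_trivialisation:
  assumes "contractible_space (subtopology X M)" and M0: "M \<noteq> {}"
  shows "\<exists>s. (\<forall>p. s p \<in> carrier_mat n n) \<and> (\<forall>z\<in>M. cts.regular_GL (W z) n (\<lambda>p. e z p p * s p))"
proof -
  have tM: "topspace (subtopology X M) = M" using openin_subset[OF M] by auto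
  obtain a0 h where h: "continuous_map (prod_topology (top_of_set {0..1::real}) (subtopology X M)) (subtopology X M) h"
    and h0: "\<And>p. h (0, p) = p" and h1: "\<And>p. h (1, p) = a0"
    using assms(1) unfolding contractible_space_def homotopic_with_def by auto
  have hM: "h (t, p) \<in> M" if "t \<in> {0..1}" "p \<in> M" for t p
    using continuous_map_image_subset_topspace[OF h] that tM by (auto simp: image_subset_iff)
  have a0M: "a0 \<in> M" using M0 hM[of 1] h1 by auto
  obtain G N where nb: "\<And>z. z \<in> M \<Longrightarrow> transport_nbhd z (G z) (N z)"
    using transport_nbhd_exists by metis
  have G: "openin X (G z)" "z \<in> G z" "G z \<subseteq> W z" "\<And>y k. y \<in> G z \<Longrightarrow> N z \<le> k \<Longrightarrow> \<eta> k y = 0"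
    "\<And>a b k. a \<in> G z \<Longrightarrow> b \<in> G z \<Longrightarrow> k < N z \<Longrightarrow> b \<in> S k \<Longrightarrow> a \<in> W (q k)"
    "\<And>a b. a \<in> G z \<Longrightarrow> b \<in> G z \<Longrightarrow> transport z z a b \<in> GL n" if "z \<in> M" for z
    using nb[OF that] unfolding transport_nbhd_def by blast+
  obtain \<delta> where \<delta>: "\<And>p. p \<in> M \<Longrightarrow> 0 < \<delta> p" "\<And>p. p \<in> M \<Longrightarrow> (\<delta> \<longlongrightarrow> \<delta> p) (nhdsin X p)"
    "\<And>p t t'. p \<in> M \<Longrightarrow> t \<in> {0..1} \<Longrightarrow> t' \<in> {0..1} \<Longrightarrow> \<bar>t - t'\<bar> \<le> \<delta> p \<Longrightarrow>
       \<exists>z\<in>M. h (t, p) \<in> G z \<and> h (t', p) \<in> G z"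
    using step_length[OF h G(1,2) M0] by metis
  define b where "b = (\<lambda>(m::nat) p. h (min 1 (real m * \<delta> p), p))"
  have tau: "min 1 (real m * \<delta> p) \<in> {0..1}" if "p \<in> M" for m p
    using \<delta>(1)[OF that] by auto
  have bM: "b m p \<in> M" if "p \<in> M" for m p
    unfolding b_def using hM[OF tau] that by simp
  have bcont: "filterlim (b m) (nhdsin X (b m p)) (nhdsin X p)" if p: "p \<in> M" for m p
    unfolding filterlim_iff
  proof (intro allI impI)
    fix Q assume "eventually Q (nhdsin X (b m p))"
    then obtain H where H: "openin X H" "b m p \<in> H" "\<forall>y\<in>H. Q y"
      using bM[OF p, of m] openin_subset[OF M] by (auto simp: eventually_nhdsin)
    obtain d P where dP: "0 < d" "openin X P" "p \<in> P" "P \<subseteq> M"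
      "\<forall>t'\<in>{0..1}. \<forall>p'\<in>P. \<bar>t' - min 1 (real m * \<delta> p)\<bar> < d \<longrightarrow> h (t', p') \<in> H"
      using homotopy_nbhd[OF h M tau[OF p] p H(1) H(2)[unfolded b_def]] by blast
    have "((\<lambda>p. min 1 (real m * \<delta> p)) \<longlongrightarrow> min 1 (real m * \<delta> p)) (nhdsin X p)"
      by (intro tendsto_min tendsto_mult tendsto_const \<delta>(2)[OF p])
    then have "eventually (\<lambda>p'. dist (min 1 (real m * \<delta> p')) (min 1 (real m * \<delta> p)) < d) (nhdsin X p)"
      by (rule tendstoD) (rule dP(1))
    then show "eventually (\<lambda>p'. Q (b m p')) (nhdsin X p)"
      using eventually_nhdsin_in[OF dP(2,3)]
    proof eventually_elim
      case (elim p')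
      have "h (min 1 (real m * \<delta> p'), p') \<in> H"
        using dP(5) tau[of p' m] elim dP(4) by (auto simp: dist_real_def)
      then show ?case using H(3) by (simp add: b_def)
    qed
  qed
  have bopen: "openin X {p \<in> T. b m p \<in> H}" if T: "openin X T" "T \<subseteq> M" and H: "openin X H" for T H m
  proof (subst openin_subopen, intro ballI)
    fix p assume p: "p \<in> {p \<in> T. b m p \<in> H}"
    then have pM: "p \<in> M" using T(2) by blast
    have "eventually (\<lambda>p'. b m p' \<in> H) (nhdsin X p)"
      using eventually_compose_filterlim[OF eventually_nhdsin_in[OF H] bcont[OF pM]] p by blast
    then obtain P where "openin X P" "p \<in> P" "\<forall>p'\<in>P. b m p' \<in> H"
      using pM openin_subset[OF M] by (auto simp: eventually_nhdsin)
    then show "\<exists>U. openin X U \<and> p \<in> U \<and> U \<subseteq> {p \<in> T. b m p \<in> H}"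
      using T(1) p by (intro exI[of _ "P \<inter> T"]) auto
  qed
  (* The transport from the m-th point of the path of p back to p. *)
  define s where "s = (\<lambda>m p. rec_nat (1\<^sub>m n) (\<lambda>m A. A * transport (b m p) (b (Suc m) p) (b m p) (b (Suc m) p)) m)"
  have s_0: "s 0 p = 1\<^sub>m n" and s_Suc: "s (Suc m) p = s m p * transport (b m p) (b (Suc m) p) (b m p) (b (Suc m) p)" for m p
    by (simp_all add: s_def)
  have b_0: "b 0 p = p" if "p \<in> M" for p using h0 by (simp add: b_def)
  have sc: "s m p \<in> carrier_mat n n" for m p
    by (induction m) (auto simp: s_0 s_Suc transport_def intro!: mult_carrier_mat[of _ n n _ n])
  have W_in: "p \<in> M" if "z \<in> M" "p \<in> W z" for z p using W(3) that by blast
  (* Seen in fixed frames at both ends, the transport along the first m steps is continuous in p. *)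
  have main: "cts.regular_GL {p \<in> W z. b m p \<in> W y} n (\<lambda>p. e z p p * s m p * e (b m p) y (b m p))"
    if "z \<in> M" "y \<in> M" for m z y
    using that
  proof (induction m arbitrary: y)
    case 0
    have eq: "{p \<in> W z. b 0 p \<in> W y} = W z \<inter> W y" using W_in[OF 0(1)] b_0 by auto
    have o: "openin X (W z \<inter> W y)" using W(1) 0 by blast
    show ?case unfolding eq
    proof (rule cts.regular_GL_cong[OF o smooth_GL_continuous[OF o e_smooth[OF 0]]])
      fix p assume p: "p \<in> W z \<inter> W y"
      have pM: "p \<in> M" using p W_in[OF 0(1)] by blast
      have c: "e z p p \<in> carrier_mat n n" using p 0 pM W(2) by (intro e_carrier) auto
      have "e z y p = e z p p * e p y p" using p 0 pM W(2) by (intro e_mult[symmetric]) auto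
      then show "e z y p = e z p p * s 0 p * e (b 0 p) y (b 0 p)"
        using c by (simp add: s_0 b_0[OF pM])
    qed
  next
    case (Suc m)
    note z = Suc.prems(1) and y = Suc.prems(2)
    let ?g = "\<lambda>m y p. e z p p * s m p * e (b m p) y (b m p)"
    have oQ: "openin X {p \<in> W z. b (Suc m) p \<in> W y}" by (intro bopen W(1,3) z y)
    show ?case
    proof (rule cts.regular_GL_local[OF oQ])
      fix p0 assume p0: "p0 \<in> {p \<in> W z. b (Suc m) p \<in> W y}"
      then have p0M: "p0 \<in> M" using W_in[OF z] by blast
      have "\<bar>min 1 (real m * \<delta> p0) - min 1 (real (Suc m) * \<delta> p0)\<bar> \<le> \<delta> p0"
        using \<delta>(1)[OF p0M] by (auto simp: min_def algebra_simps)
      then obtain u where u: "u \<in> M" "b m p0 \<in> G u" "b (Suc m) p0 \<in> G u"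
        using \<delta>(3)[OF p0M tau[OF p0M] tau[OF p0M]] unfolding b_def by blast
      define H where "H = {p \<in> {p \<in> W z. b m p \<in> G u}. b (Suc m) p \<in> G u \<inter> W y}"
      have oGW: "openin X (G u \<inter> W y)" using G(1)[OF u(1)] W(1)[OF y] by blast
      have oH: "openin X H"
        unfolding H_def using W(3)[OF z]
        by (intro bopen oGW G(1)[OF u(1)] W(1)[OF z]) auto
      have HM: "p \<in> M" if "p \<in> H" for p using that W_in[OF z] by (auto simp: H_def)
      have GW: "x \<in> W u" if "x \<in> G u" for x using G(3)[OF u(1)] that by blast
      have 1: "cts.regular_GL H n (?g m u)"
      proof (rule cts.regular_GL_subset[OF _ oH Suc.IH[OF z u(1)]])
        show "openin X {p \<in> W z. b m p \<in> W u}" by (intro bopen W(1,3) z u(1))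
      qed (auto simp: H_def GW)
      have 2: "cts.regular_GL H n (\<lambda>p. transport u u (b m p) (b (Suc m) p))"
        unfolding cts.regular_GL_def continuous_fun_def
      proof (intro conjI ballI allI impI)
        fix p assume p: "p \<in> H"
        then have bG: "b m p \<in> G u" "b (Suc m) p \<in> G u" by (auto simp: H_def)
        show "transport u u (b m p) (b (Suc m) p) \<in> GL n" by (rule G(6)[OF u(1) bG])
        fix i j assume ij: "i < n" "j < n"
        have "((\<lambda>r. transport u u (fst r) (snd r) $$ (i, j)) \<longlongrightarrow> transport u u (b m p) (b (Suc m) p) $$ (i, j))
            (nhdsin X (b m p) \<times>\<^sub>F nhdsin X (b (Suc m) p))"
          by (rule transport_tendsto[OF u(1) GW[OF bG(1)] GW[OF bG(2)] G(1)[OF u(1)] bG(2) G(4)[OF u(1)]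
                G(5)[OF u(1) bG] ij])
        moreover have "filterlim (\<lambda>p. (b m p, b (Suc m) p))
            (nhdsin X (b m p) \<times>\<^sub>F nhdsin X (b (Suc m) p)) (nhdsin X p)"
          by (intro filterlim_Pair bcont HM[OF p])
        ultimately show "((\<lambda>p. transport u u (b m p) (b (Suc m) p) $$ (i, j)) \<longlongrightarrow>
            transport u u (b m p) (b (Suc m) p) $$ (i, j)) (nhdsin X p)"
          using filterlim_compose by fastforce
      qed
      have 3: "cts.regular_GL H n (\<lambda>p. e u y (b (Suc m) p))"
        unfolding cts.regular_GL_def continuous_fun_def
      proof (intro conjI ballI allI impI)
        fix p assume p: "p \<in> H"
        then have bW: "b (Suc m) p \<in> W u" "b (Suc m) p \<in> W y" by (auto simp: H_def GW)
        show "e u y (b (Suc m) p) \<in> GL n" by (rule e_GL[OF u(1) y bW])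
        fix i j assume ij: "i < n" "j < n"
        show "((\<lambda>p. e u y (b (Suc m) p) $$ (i, j)) \<longlongrightarrow> e u y (b (Suc m) p) $$ (i, j)) (nhdsin X p)"
          by (rule filterlim_compose[OF e_continuous[OF u(1) y bW ij] bcont[OF HM[OF p]]])
      qed
      have eq: "?g (Suc m) y p = ?g m u p * transport u u (b m p) (b (Suc m) p) * e u y (b (Suc m) p)"
        if p: "p \<in> H" for p
      proof -
        let ?a = "b m p" and ?b = "b (Suc m) p"
        have pM: "p \<in> M" by (rule HM[OF p])
        have pz: "p \<in> W z" and bG: "?a \<in> G u" "?b \<in> G u" and yb: "?b \<in> W y" using p by (auto simp: H_def)
        note bm = bM[OF pM, of m] bM[OF pM, of "Suc m"]
        note bW = GW[OF bG(1)] GW[OF bG(2)] W(2)[OF bm(1)] W(2)[OF bm(2)]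
        have near: "?a \<in> W (q k)" if k: "\<eta> k ?b \<noteq> 0" for k
        proof -
          have "k < N u" using G(4)[OF u(1) bG(2)] k not_le by blast
          then show ?thesis using G(5)[OF u(1) bG] pu'(5)[OF bm(2) k] by blast
        qed
        have t: "transport u u ?a ?b = e u ?a ?a * transport ?a ?b ?a ?b * e ?b u ?b"
          by (rule transport_frame[OF bm(1) u(1) bm(2) u(1) bW(3,1,4,2) near, symmetric])
        have c: "e z p p \<in> carrier_mat n n" "e ?a u ?a \<in> carrier_mat n n" "e u ?a ?a \<in> carrier_mat n n"
          "e ?b u ?b \<in> carrier_mat n n" "e u y ?b \<in> carrier_mat n n" "e ?b y ?b \<in> carrier_mat n n"
          "transport ?a ?b ?a ?b \<in> carrier_mat n n" "s m p \<in> carrier_mat n n"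
          using z y u(1) pM bm bW yb pz W(2)[OF pM] by (auto intro!: e_carrier sc simp: transport_def)
        have 1: "e ?a u ?a * e u ?a ?a = 1\<^sub>m n"
          using bm u(1) bW by (simp add: e_mult e_one)
        have 2: "e ?b u ?b * e u y ?b = e ?b y ?b"
          using bm u(1) y bW yb by (intro e_mult) auto
        have "?g m u p * transport u u ?a ?b * e u y ?b =
            e z p p * (s m p * ((e ?a u ?a * e u ?a ?a) * (transport ?a ?b ?a ?b * (e ?b u ?b * e u y ?b))))"
          unfolding t using c by (simp add: assoc_mult_mat[of _ n n _ n _ n] mult_carrier_mat[of _ n n _ n])
        also have "\<dots> = e z p p * (s m p * (transport ?a ?b ?a ?b * e ?b y ?b))"
          unfolding 1 2 using c by (simp add: mult_carrier_mat[of _ n n _ n] left_mult_one_mat[of _ n n])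
        also have "\<dots> = ?g (Suc m) y p"
          unfolding s_Suc using c by (simp add: assoc_mult_mat[of _ n n _ n _ n] mult_carrier_mat[of _ n n _ n])
        finally show ?thesis by simp
      qed
      have "cts.regular_GL H n (\<lambda>p. ?g m u p * transport u u (b m p) (b (Suc m) p) * e u y (b (Suc m) p))"
        by (intro cts.regular_GL_mult oH 1 2 3)
      then show "\<exists>G g'. openin X G \<and> p0 \<in> G \<and> G \<subseteq> {p \<in> W z. b (Suc m) p \<in> W y} \<and>
          cts.regular_GL G n g' \<and> (\<forall>p\<in>G. ?g (Suc m) y p = g' p)"
        using oH p0 u eq by (intro exI[of _ H] exI conjI ballI) (auto simp: H_def)
    qed
  qed
  define k where "k = (\<lambda>p. nat \<lceil>1 / \<delta> p\<rceil>)"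
  have end_path: "b m p = a0" if p: "p \<in> M" and m: "1 \<le> real m * \<delta> p" for m p
    using m h1 by (simp add: b_def)
  have k: "1 \<le> real (k p) * \<delta> p" if p: "p \<in> M" for p
  proof -
    have "1 / \<delta> p \<le> real (k p)" unfolding k_def by linarith
    then show ?thesis using \<delta>(1)[OF p] by (simp add: field_simps)
  qed
  have stable: "s (k p + m) p = s (k p) p" if p: "p \<in> M" for p m
  proof (induction m)
    case (Suc m)
    have long: "1 \<le> real l * \<delta> p" if "k p \<le> l" for l
    proof -
      have "real (k p) * \<delta> p \<le> real l * \<delta> p"
        using that \<delta>(1)[OF p] by (intro mult_right_mono) auto
      then show ?thesis using k[OF p] by linarith
    qed
    have "b (k p + m) p = a0" "b (Suc (k p + m)) p = a0" by (intro end_path[OF p] long; simp)+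
    then show ?case
      using Suc transport_diagonal[OF a0M W(2)[OF a0M]] right_mult_one_mat[OF sc] by (simp add: s_Suc)
  qed simp
  show ?thesis
  proof (intro exI conjI allI ballI)
    show "s (k p) p \<in> carrier_mat n n" for p by (rule sc)
    fix z assume z: "z \<in> M"
    show "cts.regular_GL (W z) n (\<lambda>p. e z p p * s (k p) p)"
    proof (rule cts.regular_GL_local[OF W(1)[OF z]])
      fix p0 assume p0: "p0 \<in> W z"
      have p0M: "p0 \<in> M" by (rule W_in[OF z p0])
      define m where "m = Suc (k p0)"
      have "1 < real m * \<delta> p0" using k[OF p0M] \<delta>(1)[OF p0M] by (simp add: m_def algebra_simps)
      moreover have "((\<lambda>p. real m * \<delta> p) \<longlongrightarrow> real m * \<delta> p0) (nhdsin X p0)"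
        by (intro tendsto_mult tendsto_const \<delta>(2)[OF p0M])
      ultimately have "eventually (\<lambda>p. 1 < real m * \<delta> p) (nhdsin X p0)"
        by (simp add: order_tendstoD(1))
      then obtain P where P: "openin X P" "p0 \<in> P" "\<forall>p\<in>P. 1 < real m * \<delta> p"
        using p0M openin_subset[OF M] by (auto simp: eventually_nhdsin)
      let ?H = "P \<inter> W z"
      have oH: "openin X ?H" using P(1) W(1)[OF z] by blast
      have bH: "b m p = a0" if "p \<in> ?H" for p
        by (rule end_path) (use that P(3) W_in[OF z] in auto)
      have "openin X {p \<in> W z. b m p \<in> W a0}" by (intro bopen W(1,3) z a0M)
      then have "cts.regular_GL ?H n (\<lambda>p. e z p p * s m p * e (b m p) a0 (b m p))"
        by (rule cts.regular_GL_subset[OF _ oH main[OF z a0M]]) (use bH W(2)[OF a0M] in auto)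
      moreover have "e z p p * s (k p) p = e z p p * s m p * e (b m p) a0 (b m p)" if p: "p \<in> ?H" for p
      proof -
        have pM: "p \<in> M" using p W_in[OF z] by blast
        have "1 / \<delta> p \<le> real m" using P(3) p \<delta>(1)[OF pM] by (auto simp: field_simps)
        then have "k p \<le> m" unfolding k_def by linarith
        then have "s m p = s (k p) p" using stable[OF pM, of "m - k p"] by simp
        moreover have "e z p p * s m p \<in> carrier_mat n n"
          using p pM z W(2)[OF pM] by (intro mult_carrier_mat[of _ n n _ n] sc e_carrier) auto
        ultimately show ?thesis using bH[OF p] e_one[OF a0M W(2)[OF a0M]] right_mult_one_mat by metis
      qed
      ultimately show "\<exists>G g'. openin X G \<and> p0 \<in> G \<and> G \<subseteq> W z \<and> cts.regular_GL G n g' \<and>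
          (\<forall>p\<in>G. e z p p * s (k p) p = g' p)"
        using oH P(2) p0 by (intro exI[of _ ?H] exI conjI ballI) auto
    qed
  qed
qed

end

context gl_cocycle
begin

text \<open>The continuous trivialisation is replaced by the constants that it takes at the centres of a sufficiently fine
  partition of unity. Measured in the continuous trivialisation the average of these constants is near the identity.\<close>

lemma smooth_trivialisation:
  assumes contr: "contractible_space (subtopology X M)"
  shows "\<exists>s. (\<forall>p. s p \<in> carrier_mat n n) \<and> (\<forall>z\<in>M. smooth.regular_GL (W z) n (\<lambda>p. e z p p * s p))"
proof (cases "M = {}")
  case False
  obtain q \<eta> S where pu: "partition_of_unity X M W q \<eta> S" "\<And>k. smooth_fun \<A> M (\<lambda>x. complex_of_real (\<eta> k x))"
    using partition_of_unity_exists[OF M False W(1,2)] by metis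
  interpret gl_transport X \<A> M W n e q \<eta> S
    by unfold_locales (use pu in auto)
  obtain s where sc: "\<And>p. s p \<in> carrier_mat n n"
    and s: "\<And>z. z \<in> M \<Longrightarrow> cts.regular_GL (W z) n (\<lambda>p. e z p p * s p)"
    using topological_trivialisation[OF contr False] by blast
  define \<sigma> where "\<sigma> = (\<lambda>z p. e z p p * s p)"
  have \<sigma>: "cts.regular_GL (W z) n (\<sigma> z)" if "z \<in> M" for z
    using s[OF that] by (simp add: \<sigma>_def)
  have \<sigma>GL: "\<sigma> z p \<in> GL n" if "z \<in> M" "p \<in> W z" for z p
    by (rule cts.regular_GLD(1)[OF \<sigma>[OF that(1)] that(2)])
  have WM: "p \<in> M" if "z \<in> M" "p \<in> W z" for z p using W(3) that by blast
  have \<sigma>_e: "\<sigma> z p = e z y p * \<sigma> y p" if "z \<in> M" "y \<in> M" "p \<in> W z" "p \<in> W y" for z y p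
  proof -
    have pM: "p \<in> M" by (rule WM[OF that(1,3)])
    have "e z y p * \<sigma> y p = (e z y p * e y p p) * s p"
      unfolding \<sigma>_def using that W(2)[OF pM] pM sc
      by (intro assoc_mult_mat[symmetric, of _ n n _ n _ n] e_carrier) auto
    also have "e z y p * e y p p = e z p p" using that W(2)[OF pM] pM by (intro e_mult) auto
    finally show ?thesis by (simp add: \<sigma>_def)
  qed
  (* The frame that is constantly the one at c, measured in the continuous trivialisation. *)
  define f where "f = (\<lambda>c p. mat_inv (\<sigma> c p) * \<sigma> c c)"
  have "\<exists>P. openin X P \<and> c \<in> P \<and> P \<subseteq> W c \<and>
      (\<forall>p\<in>P. \<forall>i<n. \<forall>j<n. cmod (f c p $$ (i, j) - 1\<^sub>m n $$ (i, j)) < 1 / (real n + 1))" if c: "c \<in> M" for c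
  proof -
    have reg: "cts.regular_GL (W c) n (f c)"
      unfolding f_def by (intro cts.regular_GL_mult cts.regular_GL_mat_inv cts.regular_GL_const W(1)[OF c] \<sigma>[OF c]
          \<sigma>GL[OF c W(2)[OF c]])
    have 1: "f c c = 1\<^sub>m n" unfolding f_def by (rule GL_mat_inv(2)[OF \<sigma>GL[OF c W(2)[OF c]]])
    have "eventually (\<lambda>p. \<forall>i\<in>{..<n}. \<forall>j\<in>{..<n}. cmod (f c p $$ (i, j) - 1\<^sub>m n $$ (i, j)) < 1 / (real n + 1)) (nhdsin X c)"
    proof (intro eventually_ball_finite ballI finite_lessThan)
      fix i j assume "i \<in> {..<n}" "j \<in> {..<n}"
      then have "((\<lambda>p. f c p $$ (i, j)) \<longlongrightarrow> f c c $$ (i, j)) (nhdsin X c)"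
        using cts.regular_GLD(2)[OF reg, of i j] W(2)[OF c] by (auto simp: continuous_fun_def)
      then have "eventually (\<lambda>p. dist (f c p $$ (i, j)) (1\<^sub>m n $$ (i, j)) < 1 / (real n + 1)) (nhdsin X c)"
        unfolding 1 by (rule tendstoD) simp
      then show "eventually (\<lambda>p. cmod (f c p $$ (i, j) - 1\<^sub>m n $$ (i, j)) < 1 / (real n + 1)) (nhdsin X c)"
        by (simp add: dist_norm)
    qed
    then obtain P where "openin X P" "c \<in> P"
      "\<forall>p\<in>P. \<forall>i\<in>{..<n}. \<forall>j\<in>{..<n}. cmod (f c p $$ (i, j) - 1\<^sub>m n $$ (i, j)) < 1 / (real n + 1)"
      using c openin_subset[OF M] by (auto simp: eventually_nhdsin)
    then show ?thesis using W(1,2)[OF c] by (intro exI[of _ "P \<inter> W c"]) auto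
  qed
  then obtain P where "\<And>c. c \<in> M \<Longrightarrow> openin X (P c) \<and> c \<in> P c \<and> P c \<subseteq> W c \<and>
      (\<forall>p\<in>P c. \<forall>i<n. \<forall>j<n. cmod (f c p $$ (i, j) - 1\<^sub>m n $$ (i, j)) < 1 / (real n + 1))" by metis
  then have P: "\<And>c. c \<in> M \<Longrightarrow> openin X (P c)" "\<And>c. c \<in> M \<Longrightarrow> c \<in> P c" "\<And>c. c \<in> M \<Longrightarrow> P c \<subseteq> W c"
    "\<And>c p i j. c \<in> M \<Longrightarrow> p \<in> P c \<Longrightarrow> i < n \<Longrightarrow> j < n \<Longrightarrow> cmod (f c p $$ (i, j) - 1\<^sub>m n $$ (i, j)) < 1 / (real n + 1)"
    by blast+
  obtain r \<xi> R where \<xi>: "partition_of_unity X M P r \<xi> R" "\<And>k. smooth_fun \<A> M (\<lambda>x. complex_of_real (\<xi> k x))"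
    using partition_of_unity_exists[OF M False P(1,2)] by metis
  note \<xi>' = partition_of_unityD[OF \<xi>(1)]
  define C where "C = (\<lambda>k. \<sigma> (r k) (r k))"
  have C: "C k \<in> GL n" for k unfolding C_def by (rule \<sigma>GL[OF \<xi>'(1) W(2)[OF \<xi>'(1)]])
  have supp: "p \<in> P (r k)" "p \<in> W (r k)" if "p \<in> M" "\<xi> k p \<noteq> 0" for p k
    using \<xi>'(5)[OF that] \<xi>'(3) P(3)[OF \<xi>'(1)] by blast+
  define s' where "s' = (\<lambda>p. weighted_mat n \<xi> (\<lambda>k. e p (r k) p * C k) p)"
  have frame: "e z p p * s' p = weighted_mat n \<xi> (\<lambda>k. e z (r k) p * C k) p" if z: "z \<in> M" and p: "p \<in> W z" for z p
  proof -
    have pM: "p \<in> M" by (rule WM[OF z p])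
    have c: "e p (r k) p \<in> carrier_mat n n" if "\<xi> k p \<noteq> 0" for k
      using supp[OF pM that] \<xi>'(1) pM W(2)[OF pM] by (intro e_carrier) auto
    have c': "e z p p \<in> carrier_mat n n" using z p pM W(2)[OF pM] by (intro e_carrier) auto
    have "e z p p * s' p = weighted_mat n \<xi> (\<lambda>k. e z p p * (e p (r k) p * C k)) p"
      unfolding s'_def
      by (rule weighted_mat_mult_left[OF c']) (intro mult_carrier_mat[of _ n n _ n] c GL_carrier[OF C])
    also have "\<dots> = weighted_mat n \<xi> (\<lambda>k. e z (r k) p * C k) p"
    proof (rule weighted_mat_cong)
      fix k assume k: "\<xi> k p \<noteq> 0"
      have "e z p p * (e p (r k) p * C k) = (e z p p * e p (r k) p) * C k"
        by (rule assoc_mult_mat[symmetric, OF c' c[OF k] GL_carrier[OF C]])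
      then show "e z p p * (e p (r k) p * C k) = e z (r k) p * C k"
        using e_mult[of z p "r k" p] z p pM W(2)[OF pM] \<xi>'(1) supp(2)[OF pM k] by simp
    qed
    finally show ?thesis .
  qed
  have frame_GL: "weighted_mat n \<xi> (\<lambda>k. e z (r k) p * C k) p \<in> GL n" if z: "z \<in> M" and p: "p \<in> W z" for z p
  proof -
    have pM: "p \<in> M" by (rule WM[OF z p])
    have near: "weighted_mat n \<xi> (\<lambda>k. f (r k) p) p \<in> GL n"
      by (rule weighted_mat_near_one[OF \<xi>(1) pM]) (intro P(4) \<xi>'(1) supp(1)[OF pM])
    have f_GL: "f (r k) p \<in> GL n" if "\<xi> k p \<noteq> 0" for k
      using GL_mult[OF GL_mat_inv(3)[OF \<sigma>GL[OF \<xi>'(1) supp(2)[OF pM that]]] C] by (simp add: f_def C_def)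
    have "\<sigma> z p * weighted_mat n \<xi> (\<lambda>k. f (r k) p) p = weighted_mat n \<xi> (\<lambda>k. \<sigma> z p * f (r k) p) p"
      by (rule weighted_mat_mult_left[OF GL_carrier[OF \<sigma>GL[OF z p]] GL_carrier[OF f_GL]])
    also have "\<dots> = weighted_mat n \<xi> (\<lambda>k. e z (r k) p * C k) p"
    proof (rule weighted_mat_cong)
      fix k assume k: "\<xi> k p \<noteq> 0"
      note g = \<sigma>GL[OF \<xi>'(1)[of k] supp(2)[OF pM k]]
      have c: "e z (r k) p \<in> carrier_mat n n"
        using z p \<xi>'(1) supp(2)[OF pM k] by (intro e_carrier) auto
      have "\<sigma> z p * f (r k) p = (e z (r k) p * \<sigma> (r k) p) * (mat_inv (\<sigma> (r k) p) * C k)"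
        using \<sigma>_e[OF z \<xi>'(1) p supp(2)[OF pM k]] by (simp add: f_def C_def)
      also have "\<dots> = e z (r k) p * ((\<sigma> (r k) p * mat_inv (\<sigma> (r k) p)) * C k)"
        using c GL_carrier[OF g] GL_carrier[OF GL_mat_inv(3)[OF g]] GL_carrier[OF C[of k]]
        by (simp add: assoc_mult_mat[of _ n n _ n _ n] mult_carrier_mat[of _ n n _ n])
      also have "\<dots> = e z (r k) p * C k"
        using GL_mat_inv(1)[OF g] left_mult_one_mat[OF GL_carrier[OF C[of k]]] by simp
      finally show "\<sigma> z p * f (r k) p = e z (r k) p * C k" .
    qed
    finally show ?thesis using GL_mult[OF \<sigma>GL[OF z p] near] by simp
  qed
  have "smooth.regular_GL (W z) n (\<lambda>p. e z p p * s' p)" if z: "z \<in> M" for z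
  proof (rule smooth.regular_GL_cong[OF W(1)[OF z]])
    show "smooth.regular_GL (W z) n (\<lambda>p. weighted_mat n \<xi> (\<lambda>k. e z (r k) p * C k) p)"
      unfolding smooth.regular_GL_def
    proof (intro conjI ballI allI impI)
      show "weighted_mat n \<xi> (\<lambda>k. e z (r k) p * C k) p \<in> GL n" if "p \<in> W z" for p
        by (rule frame_GL[OF z that])
      fix i j assume ij: "i < n" "j < n"
      have "smooth_fun \<A> (W z) (weighted_sum \<xi> (\<lambda>k p. (e z (r k) p * C k) $$ (i, j)))"
      proof (rule smooth.weighted_sum[OF \<xi> M P(1) W(1)[OF z] W(3)[OF z]])
        fix k
        have o: "openin X (W z \<inter> P (r k))" "openin X (W z \<inter> W (r k))" using W(1) z P(1) \<xi>'(1) by blast+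
        have "smooth.regular_GL (W z \<inter> P (r k)) n (e z (r k))"
          by (rule smooth.regular_GL_subset[OF o(2) o(1) e_smooth[OF z \<xi>'(1)]]) (use P(3)[OF \<xi>'(1)[of k]] in blast)
        then have "smooth.regular_GL (W z \<inter> P (r k)) n (\<lambda>p. e z (r k) p * C k)"
          by (intro smooth.regular_GL_mult smooth.regular_GL_const o(1) C)
        then show "smooth_fun \<A> (W z \<inter> P (r k)) (\<lambda>p. (e z (r k) p * C k) $$ (i, j))"
          by (rule smooth.regular_GLD(2)[OF _ ij])
      qed
      then show "smooth_fun \<A> (W z) (\<lambda>p. weighted_mat n \<xi> (\<lambda>k. e z (r k) p * C k) p $$ (i, j))"
        using weighted_mat_index[OF ij, of \<xi> "\<lambda>k p. e z (r k) p * C k"] by simp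
    qed
  qed (rule frame[OF z, symmetric])
  moreover have "s' p \<in> carrier_mat n n" for p by (simp add: s'_def)
  ultimately show ?thesis by blast
qed (auto intro: exI[of _ "\<lambda>_. 1\<^sub>m n"])

end

section \<open>Isomorphic quotients and Grothendieck groups\<close>

text \<open>An isomorphism of Grothendieck groups only has to respect multiplications. Closedness of the first structure
  is part of the notion because it makes the relation symmetric, and refinements occur in both directions below.\<close>

definition mult_iso :: "('b, 'x) monoid_scheme \<Rightarrow> ('c, 'y) monoid_scheme \<Rightarrow> bool" where
  "mult_iso A B \<longleftrightarrow>
     (\<forall>x\<in>carrier A. \<forall>y\<in>carrier A. x \<otimes>\<^bsub>A\<^esub> y \<in> carrier A) \<and>
     (\<exists>\<phi>. bij_betw \<phi> (carrier A) (carrier B) \<and>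
        (\<forall>x\<in>carrier A. \<forall>y\<in>carrier A. \<phi> (x \<otimes>\<^bsub>A\<^esub> y) = \<phi> x \<otimes>\<^bsub>B\<^esub> \<phi> y))"

lemma mult_iso_trans:
  assumes "mult_iso A B" "mult_iso B C"
  shows "mult_iso A C"
proof -
  obtain \<phi> \<psi> where \<phi>: "bij_betw \<phi> (carrier A) (carrier B)"
    "\<And>x y. x \<in> carrier A \<Longrightarrow> y \<in> carrier A \<Longrightarrow> \<phi> (x \<otimes>\<^bsub>A\<^esub> y) = \<phi> x \<otimes>\<^bsub>B\<^esub> \<phi> y"
    and \<psi>: "bij_betw \<psi> (carrier B) (carrier C)"
    "\<And>x y. x \<in> carrier B \<Longrightarrow> y \<in> carrier B \<Longrightarrow> \<psi> (x \<otimes>\<^bsub>B\<^esub> y) = \<psi> x \<otimes>\<^bsub>C\<^esub> \<psi> y"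
    using assms unfolding mult_iso_def by blast
  have "\<phi> x \<in> carrier B" if "x \<in> carrier A" for x using \<phi>(1) that by (auto simp: bij_betw_def)
  then show ?thesis
    using assms(1) bij_betw_trans[OF \<phi>(1) \<psi>(1)] \<phi>(2) \<psi>(2)
    unfolding mult_iso_def by (intro conjI exI[of _ "\<psi> \<circ> \<phi>"]) auto
qed

lemma mult_iso_sym:
  assumes "mult_iso A B"
  shows "mult_iso B A"
proof -
  obtain \<phi> where cl: "\<And>x y. x \<in> carrier A \<Longrightarrow> y \<in> carrier A \<Longrightarrow> x \<otimes>\<^bsub>A\<^esub> y \<in> carrier A"
    and \<phi>: "bij_betw \<phi> (carrier A) (carrier B)"
    "\<And>x y. x \<in> carrier A \<Longrightarrow> y \<in> carrier A \<Longrightarrow> \<phi> (x \<otimes>\<^bsub>A\<^esub> y) = \<phi> x \<otimes>\<^bsub>B\<^esub> \<phi> y"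
    using assms unfolding mult_iso_def by blast
  let ?\<psi> = "inv_into (carrier A) \<phi>"
  have \<psi>: "bij_betw ?\<psi> (carrier B) (carrier A)" by (rule bij_betw_inv_into[OF \<phi>(1)])
  have key: "x \<otimes>\<^bsub>B\<^esub> y = \<phi> (?\<psi> x \<otimes>\<^bsub>A\<^esub> ?\<psi> y)" "?\<psi> x \<in> carrier A" if "x \<in> carrier B" "y \<in> carrier B" for x y
    using that \<phi> bij_betw_inv_into_right[OF \<phi>(1)] bij_betwE[OF \<psi>] by auto
  have "?\<psi> (x \<otimes>\<^bsub>B\<^esub> y) = ?\<psi> x \<otimes>\<^bsub>A\<^esub> ?\<psi> y \<and> x \<otimes>\<^bsub>B\<^esub> y \<in> carrier B" if "x \<in> carrier B" "y \<in> carrier B" for x y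
    using key[OF that] key(2)[OF that(2,1)] cl bij_betw_inv_into_left[OF \<phi>(1)] bij_betwE[OF \<phi>(1)] by auto
  then show ?thesis using \<psi> unfolding mult_iso_def by blast
qed

lemma mult_iso_grothendieck:
  assumes "mult_iso A B"
  shows "grothendieck_group A \<cong> grothendieck_group B"
proof -
  obtain \<phi> where cl: "\<And>x y. x \<in> carrier A \<Longrightarrow> y \<in> carrier A \<Longrightarrow> x \<otimes>\<^bsub>A\<^esub> y \<in> carrier A"
    and \<phi>: "bij_betw \<phi> (carrier A) (carrier B)"
    "\<And>x y. x \<in> carrier A \<Longrightarrow> y \<in> carrier A \<Longrightarrow> \<phi> (x \<otimes>\<^bsub>A\<^esub> y) = \<phi> x \<otimes>\<^bsub>B\<^esub> \<phi> y"
    using assms unfolding mult_iso_def by blast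
  have inj: "inj_on \<phi> (carrier A)" and surj: "\<phi> ` carrier A = carrier B"
    using \<phi>(1) by (auto simp: bij_betw_def)
  let ?CA = "carrier A \<times> carrier A" and ?CB = "carrier B \<times> carrier B"
  let ?RA = "grothendieck_rel A" and ?RB = "grothendieck_rel B"
  let ?\<Phi> = "map_prod \<phi> \<phi>"
  have injP: "inj_on ?\<Phi> ?CA" using inj by (intro map_prod_inj_on)
  have surjP: "?\<Phi> ` ?CA = ?CB" using surj by (simp add: map_prod_surj_on)
  have rel: "(x, y) \<in> ?RA \<longleftrightarrow> (?\<Phi> x, ?\<Phi> y) \<in> ?RB" if "x \<in> ?CA" "y \<in> ?CA" for x y
  proof -
    obtain a b c d where xy: "x = (a, b)" "y = (c, d)" by fastforce
    then have C: "a \<in> carrier A" "b \<in> carrier A" "c \<in> carrier A" "d \<in> carrier A" using that by auto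
    then have CB: "\<phi> a \<in> carrier B" "\<phi> b \<in> carrier B" "\<phi> c \<in> carrier B" "\<phi> d \<in> carrier B" using surj by auto
    have "(a \<otimes>\<^bsub>A\<^esub> d \<otimes>\<^bsub>A\<^esub> u = c \<otimes>\<^bsub>A\<^esub> b \<otimes>\<^bsub>A\<^esub> u) \<longleftrightarrow>
        (\<phi> a \<otimes>\<^bsub>B\<^esub> \<phi> d \<otimes>\<^bsub>B\<^esub> \<phi> u = \<phi> c \<otimes>\<^bsub>B\<^esub> \<phi> b \<otimes>\<^bsub>B\<^esub> \<phi> u)" if u: "u \<in> carrier A" for u
    proof -
      have "(\<phi> (a \<otimes>\<^bsub>A\<^esub> d \<otimes>\<^bsub>A\<^esub> u) = \<phi> (c \<otimes>\<^bsub>A\<^esub> b \<otimes>\<^bsub>A\<^esub> u)) \<longleftrightarrow> (a \<otimes>\<^bsub>A\<^esub> d \<otimes>\<^bsub>A\<^esub> u = c \<otimes>\<^bsub>A\<^esub> b \<otimes>\<^bsub>A\<^esub> u)"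
        using C u by (intro inj_on_eq_iff[OF inj] cl)
      then show ?thesis using C u by (simp add: \<phi>(2) cl)
    qed
    then have "(\<exists>u\<in>carrier A. a \<otimes>\<^bsub>A\<^esub> d \<otimes>\<^bsub>A\<^esub> u = c \<otimes>\<^bsub>A\<^esub> b \<otimes>\<^bsub>A\<^esub> u) \<longleftrightarrow>
        (\<exists>v\<in>carrier B. \<phi> a \<otimes>\<^bsub>B\<^esub> \<phi> d \<otimes>\<^bsub>B\<^esub> v = \<phi> c \<otimes>\<^bsub>B\<^esub> \<phi> b \<otimes>\<^bsub>B\<^esub> v)"
      unfolding surj[symmetric] by auto
    then show ?thesis using C CB unfolding xy grothendieck_rel_def by simp
  qed
  have RA: "?RA \<subseteq> ?CA \<times> ?CA" and RB: "?RB \<subseteq> ?CB \<times> ?CB" by (auto simp: grothendieck_rel_def)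
  have img: "?\<Phi> ` (?RA `` {x}) = ?RB `` {?\<Phi> x}" if x: "x \<in> ?CA" for x
  proof (intro equalityI subsetI)
    fix w assume "w \<in> ?\<Phi> ` (?RA `` {x})"
    then obtain y where y: "w = ?\<Phi> y" "y \<in> ?RA `` {x}" by (rule imageE)
    have xy: "(x, y) \<in> ?RA" using y(2) by (rule Image_singleton_iff[THEN iffD1])
    have yC: "y \<in> ?CA" using subsetD[OF RA xy] by (rule SigmaD2)
    have "(?\<Phi> x, w) \<in> ?RB" unfolding y(1) by (rule rel[OF x yC, THEN iffD1, OF xy])
    then show "w \<in> ?RB `` {?\<Phi> x}" by (rule Image_singleton_iff[THEN iffD2])
  next
    fix w assume "w \<in> ?RB `` {?\<Phi> x}"
    then have w: "(?\<Phi> x, w) \<in> ?RB" by (rule Image_singleton_iff[THEN iffD1])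
    have "w \<in> ?CB" using subsetD[OF RB w] by (rule SigmaD2)
    then have "w \<in> ?\<Phi> ` ?CA" unfolding surjP .
    then obtain y where y: "w = ?\<Phi> y" "y \<in> ?CA" by (rule imageE)
    have "(x, y) \<in> ?RA" using w unfolding y(1) by (rule rel[OF x y(2), THEN iffD2])
    then show "w \<in> ?\<Phi> ` (?RA `` {x})" unfolding y(1) by (intro imageI Image_singleton_iff[THEN iffD2])
  qed
  let ?GA = "grothendieck_group A" and ?GB = "grothendieck_group B"
  have cA: "carrier ?GA = ?CA // ?RA" and cB: "carrier ?GB = ?CB // ?RB"
    by (simp_all add: grothendieck_group_def quot_monoid_def)
  have sub: "P \<subseteq> ?CA" if "P \<in> carrier ?GA" for P
    using that RA unfolding cA quotient_def by blast
  have im: "(`) ?\<Phi> ` carrier ?GA = carrier ?GB"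
  proof -
    have "(`) ?\<Phi> ` carrier ?GA = (\<lambda>x. ?\<Phi> ` (?RA `` {x})) ` ?CA"
      unfolding cA quotient_def by (simp only: UN_singleton image_image UNION_singleton_eq_range)
    also have "\<dots> = (\<lambda>x. ?RB `` {?\<Phi> x}) ` ?CA" by (rule image_cong) (simp_all add: img)
    also have "\<dots> = (\<lambda>x. ?RB `` {x}) ` ?CB" unfolding surjP[symmetric] by (simp add: image_image)
    also have "\<dots> = carrier ?GB" unfolding cB quotient_def by (simp only: UNION_singleton_eq_range)
    finally show ?thesis .
  qed
  have bij: "bij_betw ((`) ?\<Phi>) (carrier ?GA) (carrier ?GB)"
    unfolding bij_betw_def
  proof
    show "inj_on ((`) ?\<Phi>) (carrier ?GA)"
      by (rule inj_onI) (rule inj_on_image_eq_iff[OF injP sub sub, THEN iffD1])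
  qed (rule im)
  have hom: "?\<Phi> ` (P \<otimes>\<^bsub>?GA\<^esub> Q) = (?\<Phi> ` P) \<otimes>\<^bsub>?GB\<^esub> (?\<Phi> ` Q)"
    if "P \<in> carrier ?GA" "Q \<in> carrier ?GA" for P Q
  proof -
    let ?fA = "\<lambda>(a, b) (c, d). (a \<otimes>\<^bsub>A\<^esub> c, b \<otimes>\<^bsub>A\<^esub> d)" and ?fB = "\<lambda>(a, b) (c, d). (a \<otimes>\<^bsub>B\<^esub> c, b \<otimes>\<^bsub>B\<^esub> d)"
    have f: "?\<Phi> (?fA x y) = ?fB (?\<Phi> x) (?\<Phi> y)" "?fA x y \<in> ?CA" if "x \<in> P" "y \<in> Q" for x y
    proof -
      have "x \<in> ?CA" "y \<in> ?CA" using sub that \<open>P \<in> carrier ?GA\<close> \<open>Q \<in> carrier ?GA\<close> by blast+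
      then show "?\<Phi> (?fA x y) = ?fB (?\<Phi> x) (?\<Phi> y)" "?fA x y \<in> ?CA" using \<phi>(2) cl by auto
    qed
    have "?\<Phi> ` (P \<otimes>\<^bsub>?GA\<^esub> Q) = (\<Union>x\<in>P. \<Union>y\<in>Q. ?\<Phi> ` (?RA `` {?fA x y}))"
      by (simp add: grothendieck_group_def quot_monoid_def image_UN)
    also have "\<dots> = (\<Union>x\<in>P. \<Union>y\<in>Q. ?RB `` {?fB (?\<Phi> x) (?\<Phi> y)})"
      by (intro SUP_cong refl) (simp only: img[OF f(2)] f(1))
    also have "\<dots> = (?\<Phi> ` P) \<otimes>\<^bsub>?GB\<^esub> (?\<Phi> ` Q)"
      by (simp add: grothendieck_group_def quot_monoid_def)
    finally show ?thesis .
  qed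
  have "(`) ?\<Phi> \<in> iso ?GA ?GB"
    unfolding iso_def hom_def using bij hom bij_betwE[OF bij] by blast
  then show ?thesis unfolding is_iso_def by blast
qed

text \<open>Here \<open>F\<close> is the object part of an equivalence of categories that respects sums up to isomorphism, so it is a
  bijection on isomorphism classes.\<close>

lemma mult_iso_quot:
  assumes E1: "equiv B1 E1" and E2: "equiv B2 E2"
    and f1: "\<And>a b. a \<in> B1 \<Longrightarrow> b \<in> B1 \<Longrightarrow> f1 a b \<in> B1"
      "\<And>a a' b b'. (a, a') \<in> E1 \<Longrightarrow> (b, b') \<in> E1 \<Longrightarrow> (f1 a b, f1 a' b') \<in> E1"
    and f2: "\<And>a a' b b'. (a, a') \<in> E2 \<Longrightarrow> (b, b') \<in> E2 \<Longrightarrow> (f2 a b, f2 a' b') \<in> E2"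
    and F: "\<And>a. a \<in> B1 \<Longrightarrow> F a \<in> B2"
    and full: "\<And>a b. a \<in> B1 \<Longrightarrow> b \<in> B1 \<Longrightarrow> (a, b) \<in> E1 \<longleftrightarrow> (F a, F b) \<in> E2"
    and surj: "\<And>c. c \<in> B2 \<Longrightarrow> \<exists>a\<in>B1. (F a, c) \<in> E2"
    and sum: "\<And>a b. a \<in> B1 \<Longrightarrow> b \<in> B1 \<Longrightarrow> (F (f1 a b), f2 (F a) (F b)) \<in> E2"
  shows "mult_iso (quot_monoid B1 E1 f1 z1) (quot_monoid B2 E2 f2 z2)"
proof -
  let ?Q1 = "quot_monoid B1 E1 f1 z1" and ?Q2 = "quot_monoid B2 E2 f2 z2"
  define \<phi> where "\<phi> = (\<lambda>P. \<Union>a\<in>P. E2 `` {F a})"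
  have \<phi>: "\<phi> (E1 `` {a}) = E2 `` {F a}" if a: "a \<in> B1" for a
  proof -
    have "E2 `` {F b} = E2 `` {F a}" if "b \<in> E1 `` {a}" for b
    proof -
      have "b \<in> B1" "(a, b) \<in> E1" using that E1 by (auto simp: equiv_def refl_on_def)
      then show ?thesis using full[OF a] equiv_class_eq[OF E2] by metis
    qed
    moreover have "a \<in> E1 `` {a}" using equiv_class_self[OF E1 a] .
    ultimately show ?thesis unfolding \<phi>_def by blast
  qed
  have mult1: "E1 `` {a} \<otimes>\<^bsub>?Q1\<^esub> E1 `` {b} = E1 `` {f1 a b}" if "a \<in> B1" "b \<in> B1" for a b
  proof -
    have "E1 `` {f1 x y} = E1 `` {f1 a b}" if "x \<in> E1 `` {a}" "y \<in> E1 `` {b}" for x y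
      using that f1(2)[of a x b y] equiv_class_eq[OF E1] by (metis ImageE singletonD)
    then have "E1 `` {a} \<otimes>\<^bsub>?Q1\<^esub> E1 `` {b} = (\<Union>x\<in>E1 `` {a}. \<Union>y\<in>E1 `` {b}. E1 `` {f1 a b})"
      by (simp add: quot_monoid_def)
    moreover have "E1 `` {a} \<noteq> {}" "E1 `` {b} \<noteq> {}" using equiv_class_self[OF E1] that by blast+
    ultimately show ?thesis by simp
  qed
  have mult2: "E2 `` {a} \<otimes>\<^bsub>?Q2\<^esub> E2 `` {b} = E2 `` {f2 a b}" if "a \<in> B2" "b \<in> B2" for a b
  proof -
    have "E2 `` {f2 x y} = E2 `` {f2 a b}" if "x \<in> E2 `` {a}" "y \<in> E2 `` {b}" for x y
      using that f2(1)[of a x b y] equiv_class_eq[OF E2] by (metis ImageE singletonD)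
    then have "E2 `` {a} \<otimes>\<^bsub>?Q2\<^esub> E2 `` {b} = (\<Union>x\<in>E2 `` {a}. \<Union>y\<in>E2 `` {b}. E2 `` {f2 a b})"
      by (simp add: quot_monoid_def)
    moreover have "E2 `` {a} \<noteq> {}" "E2 `` {b} \<noteq> {}" using equiv_class_self[OF E2] that by blast+
    ultimately show ?thesis by simp
  qed
  have c1: "carrier ?Q1 = (\<lambda>a. E1 `` {a}) ` B1" and c2: "carrier ?Q2 = (\<lambda>a. E2 `` {a}) ` B2"
    by (auto simp: quot_monoid_def quotient_def)
  have inj: "inj_on \<phi> (carrier ?Q1)"
  proof (rule inj_onI)
    fix P Q assume PQ: "P \<in> carrier ?Q1" "Q \<in> carrier ?Q1" "\<phi> P = \<phi> Q"
    then obtain a b where ab: "a \<in> B1" "P = E1 `` {a}" "b \<in> B1" "Q = E1 `` {b}" unfolding c1 by blast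
    then have "E2 `` {F a} = E2 `` {F b}" using PQ(3) \<phi> by simp
    then have "(F a, F b) \<in> E2" using eq_equiv_class[OF _ E2 F[OF ab(3)]] by blast
    then show "P = Q" using full[OF ab(1,3)] ab equiv_class_eq[OF E1] by metis
  qed
  have im: "\<phi> ` carrier ?Q1 = carrier ?Q2"
  proof (intro equalityI subsetI)
    fix P assume "P \<in> \<phi> ` carrier ?Q1"
    then show "P \<in> carrier ?Q2" unfolding c1 c2 using \<phi> F by auto
  next
    fix P assume "P \<in> carrier ?Q2"
    then obtain c where c: "c \<in> B2" "P = E2 `` {c}" unfolding c2 by blast
    then obtain a where a: "a \<in> B1" "(F a, c) \<in> E2" using surj by blast
    then have "P = \<phi> (E1 `` {a})" using \<phi> c equiv_class_eq[OF E2] by metis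
    then show "P \<in> \<phi> ` carrier ?Q1" unfolding c1 using a(1) by blast
  qed
  have "P \<otimes>\<^bsub>?Q1\<^esub> Q \<in> carrier ?Q1 \<and> \<phi> (P \<otimes>\<^bsub>?Q1\<^esub> Q) = \<phi> P \<otimes>\<^bsub>?Q2\<^esub> \<phi> Q"
    if PQ: "P \<in> carrier ?Q1" "Q \<in> carrier ?Q1" for P Q
  proof -
    obtain a b where ab: "a \<in> B1" "P = E1 `` {a}" "b \<in> B1" "Q = E1 `` {b}" using PQ unfolding c1 by blast
    have "E2 `` {F (f1 a b)} = E2 `` {f2 (F a) (F b)}"
      by (rule equiv_class_eq[OF E2 sum[OF ab(1,3)]])
    then show ?thesis
      using ab mult1[OF ab(1,3)] mult2[OF F[OF ab(1)] F[OF ab(3)]] \<phi> f1(1)[OF ab(1,3)] c1 by auto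
  qed
  then show ?thesis unfolding mult_iso_def bij_betw_def using inj im
    by (intro conjI ballI exI[of _ \<phi>]) auto
qed

section \<open>Twisted bundles\<close>

text \<open>The twisting functions under consideration: smooth, nowhere zero, alternating cocycles. A gerbe and a
  cocycle of roots of unity both give one.\<close>

locale twist = smooth_mfd X \<A> for X :: "'a topology" and \<A> :: "('a set \<times> ('a \<Rightarrow> 'e::real_inner)) set" +
  fixes J :: "'j set" and V :: "'j \<Rightarrow> 'a set" and h :: "'j \<Rightarrow> 'j \<Rightarrow> 'j \<Rightarrow> 'a \<Rightarrow> complex"
  assumes V_open: "j \<in> J \<Longrightarrow> openin X (V j)"
    and h_smooth: "i \<in> J \<Longrightarrow> j \<in> J \<Longrightarrow> k \<in> J \<Longrightarrow> smooth_fun \<A> (V i \<inter> V j \<inter> V k) (h i j k)"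
    and h_nz: "i \<in> J \<Longrightarrow> j \<in> J \<Longrightarrow> k \<in> J \<Longrightarrow> p \<in> V i \<Longrightarrow> p \<in> V j \<Longrightarrow> p \<in> V k \<Longrightarrow> h i j k p \<noteq> 0"
    and h_cyc: "i \<in> J \<Longrightarrow> j \<in> J \<Longrightarrow> k \<in> J \<Longrightarrow> p \<in> V i \<Longrightarrow> p \<in> V j \<Longrightarrow> p \<in> V k \<Longrightarrow> h j k i p = h i j k p"
    and h_rev: "i \<in> J \<Longrightarrow> j \<in> J \<Longrightarrow> k \<in> J \<Longrightarrow> p \<in> V i \<Longrightarrow> p \<in> V j \<Longrightarrow> p \<in> V k \<Longrightarrow>
      h k j i p = inverse (h i j k p)"
    and h_coc: "i \<in> J \<Longrightarrow> j \<in> J \<Longrightarrow> k \<in> J \<Longrightarrow> l \<in> J \<Longrightarrow> p \<in> V i \<Longrightarrow> p \<in> V j \<Longrightarrow> p \<in> V k \<Longrightarrow> p \<in> V l \<Longrightarrow>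
      h j k l p * h i j l p = h i k l p * h i j k p"
begin

abbreviation "bundles \<equiv> twisted_bundles \<A> J V h"
abbreviation "bundle_iso \<equiv> twisted_iso \<A> J V h"

definition "bundle_monoid = quot_monoid bundles bundle_iso
  (\<lambda>(m, g) (m', g'). (m + m', \<lambda>i j x. block_sum m m' (g i j x) (g' i j x))) (0, \<lambda>i j x. 1\<^sub>m 0)"

lemma twisted_K_eq: "twisted_K \<A> J V h = grothendieck_group bundle_monoid"
  by (simp add: twisted_K_def bundle_monoid_def)

lemma V2_open: "i \<in> J \<Longrightarrow> j \<in> J \<Longrightarrow> openin X (V i \<inter> V j)"
  using V_open by blast

lemma bundleD:
  assumes "(m, g) \<in> bundles"
  shows "i \<in> J \<Longrightarrow> j \<in> J \<Longrightarrow> smooth.regular_GL (V i \<inter> V j) m (g i j)"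
    and "i \<in> J \<Longrightarrow> j \<in> J \<Longrightarrow> p \<in> V i \<Longrightarrow> p \<in> V j \<Longrightarrow> g i j p \<in> GL m"
    and "i \<in> J \<Longrightarrow> j \<in> J \<Longrightarrow> p \<in> V i \<Longrightarrow> p \<in> V j \<Longrightarrow> g i j p \<in> carrier_mat m m"
    and "i \<in> J \<Longrightarrow> j \<in> J \<Longrightarrow> p \<in> V i \<Longrightarrow> p \<in> V j \<Longrightarrow> g i j p * g j i p = 1\<^sub>m m"
    and "i \<in> J \<Longrightarrow> j \<in> J \<Longrightarrow> k \<in> J \<Longrightarrow> p \<in> V i \<Longrightarrow> p \<in> V j \<Longrightarrow> p \<in> V k \<Longrightarrow>
      g i j p * g j k p = h i j k p \<cdot>\<^sub>m g i k p"
proof -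
  have b: "\<forall>i\<in>J. \<forall>j\<in>J. smooth.regular_GL (V i \<inter> V j) m (g i j)"
    "\<forall>i\<in>J. \<forall>j\<in>J. \<forall>x\<in>V i \<inter> V j. g i j x * g j i x = 1\<^sub>m m"
    "\<forall>i\<in>J. \<forall>j\<in>J. \<forall>k\<in>J. \<forall>x\<in>V i \<inter> V j \<inter> V k. g i j x * g j k x * g k i x = h i j k x \<cdot>\<^sub>m 1\<^sub>m m"
    using assms unfolding twisted_bundles_def smooth_GL_eq by auto
  show r: "smooth.regular_GL (V i \<inter> V j) m (g i j)" if "i \<in> J" "j \<in> J" for i j
    using b(1) that by blast
  show "g i j p \<in> GL m" if "i \<in> J" "j \<in> J" "p \<in> V i" "p \<in> V j" for i j
    using smooth.regular_GLD(1)[OF r] that by blast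
  then show c: "g i j p \<in> carrier_mat m m" if "i \<in> J" "j \<in> J" "p \<in> V i" "p \<in> V j" for i j
    using that GL_carrier by blast
  show inv: "g i j p * g j i p = 1\<^sub>m m" if "i \<in> J" "j \<in> J" "p \<in> V i" "p \<in> V j" for i j
    using b(2) that by blast
  show "g i j p * g j k p = h i j k p \<cdot>\<^sub>m g i k p" if a: "i \<in> J" "j \<in> J" "k \<in> J" "p \<in> V i" "p \<in> V j" "p \<in> V k"
  proof -
    have cs: "g i j p \<in> carrier_mat m m" "g j k p \<in> carrier_mat m m" "g k i p \<in> carrier_mat m m"
      "g i k p \<in> carrier_mat m m" using c a by auto
    have "g i j p * g j k p = g i j p * g j k p * (g k i p * g i k p)"
      using inv[of k i] a cs by (simp add: mat_calc[where n = m])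
    also have "\<dots> = (g i j p * g j k p * g k i p) * g i k p"
      using cs by (simp add: mat_calc[where n = m])
    also have "g i j p * g j k p * g k i p = h i j k p \<cdot>\<^sub>m 1\<^sub>m m" using b(3) a by blast
    also have "(h i j k p \<cdot>\<^sub>m 1\<^sub>m m) * g i k p = h i j k p \<cdot>\<^sub>m g i k p"
      using cs by (simp add: mat_calc[where n = m])
    finally show ?thesis .
  qed
qed

lemma bundleI:
  assumes "\<And>i j. i \<in> J \<Longrightarrow> j \<in> J \<Longrightarrow> smooth.regular_GL (V i \<inter> V j) m (g i j)"
    and inv: "\<And>i j p. i \<in> J \<Longrightarrow> j \<in> J \<Longrightarrow> p \<in> V i \<Longrightarrow> p \<in> V j \<Longrightarrow> g i j p * g j i p = 1\<^sub>m m"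
    and mult: "\<And>i j k p. i \<in> J \<Longrightarrow> j \<in> J \<Longrightarrow> k \<in> J \<Longrightarrow> p \<in> V i \<Longrightarrow> p \<in> V j \<Longrightarrow> p \<in> V k \<Longrightarrow>
      g i j p * g j k p = h i j k p \<cdot>\<^sub>m g i k p"
  shows "(m, g) \<in> bundles"
proof -
  have "g i j x * g j k x * g k i x = h i j k x \<cdot>\<^sub>m 1\<^sub>m m"
    if a: "i \<in> J" "j \<in> J" "k \<in> J" "x \<in> V i \<inter> V j \<inter> V k" for i j k x
  proof -
    have c: "g i k x \<in> carrier_mat m m" "g k i x \<in> carrier_mat m m"
      using smooth.regular_GLD(1)[OF assms(1)] a GL_carrier by blast+
    have "g i j x * g j k x * g k i x = (h i j k x \<cdot>\<^sub>m g i k x) * g k i x" using mult a by simp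
    also have "\<dots> = h i j k x \<cdot>\<^sub>m (g i k x * g k i x)" using c by (simp add: mat_calc[where n = m])
    finally show ?thesis using inv a by simp
  qed
  then show ?thesis unfolding twisted_bundles_def smooth_GL_eq using assms by auto
qed

lemma bundle_iso_iff:
  "((m, g), (m', g')) \<in> bundle_iso \<longleftrightarrow> (m, g) \<in> bundles \<and> (m', g') \<in> bundles \<and> m = m' \<and>
     (\<exists>f. (\<forall>i\<in>J. smooth.regular_GL (V i) m (f i)) \<and>
       (\<forall>i\<in>J. \<forall>j\<in>J. \<forall>x\<in>V i \<inter> V j. f i x * g i j x = g' i j x * f j x))"
  by (simp add: twisted_iso_def smooth_GL_eq)

lemma bundle_isoI:
  assumes "(m, g) \<in> bundles" "(m, g') \<in> bundles" "\<And>i. i \<in> J \<Longrightarrow> smooth.regular_GL (V i) m (f i)"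
    "\<And>i j p. i \<in> J \<Longrightarrow> j \<in> J \<Longrightarrow> p \<in> V i \<Longrightarrow> p \<in> V j \<Longrightarrow> f i p * g i j p = g' i j p * f j p"
  shows "((m, g), (m, g')) \<in> bundle_iso"
  unfolding bundle_iso_iff using assms by (intro conjI refl exI[of _ f]) auto

definition bundle_map :: "nat \<Rightarrow> ('j \<Rightarrow> 'j \<Rightarrow> 'a \<Rightarrow> complex mat) \<Rightarrow> ('j \<Rightarrow> 'j \<Rightarrow> 'a \<Rightarrow> complex mat) \<Rightarrow>
    ('j \<Rightarrow> 'a \<Rightarrow> complex mat) \<Rightarrow> bool" where
  "bundle_map m g g' f \<longleftrightarrow> (\<forall>i\<in>J. smooth.regular_GL (V i) m (f i)) \<and>
     (\<forall>i\<in>J. \<forall>j\<in>J. \<forall>x\<in>V i \<inter> V j. f i x * g i j x = g' i j x * f j x)"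

lemma bundle_mapD:
  assumes "bundle_map m g g' f"
  shows "i \<in> J \<Longrightarrow> smooth.regular_GL (V i) m (f i)"
    and "i \<in> J \<Longrightarrow> p \<in> V i \<Longrightarrow> f i p \<in> GL m"
    and "i \<in> J \<Longrightarrow> j \<in> J \<Longrightarrow> p \<in> V i \<Longrightarrow> p \<in> V j \<Longrightarrow> f i p * g i j p = g' i j p * f j p"
  using assms smooth.regular_GLD(1) unfolding bundle_map_def by blast+

lemma bundle_isoE:
  assumes "((m, g), (m', g')) \<in> bundle_iso"
  obtains f where "m' = m" "(m, g) \<in> bundles" "(m, g') \<in> bundles" "bundle_map m g g' f"
  using assms unfolding bundle_iso_iff bundle_map_def by blast

lemma bundle_iso_refl:
  assumes "(m, g) \<in> bundles"
  shows "((m, g), (m, g)) \<in> bundle_iso"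
proof (rule bundle_isoI[OF assms assms])
  show "smooth.regular_GL (V i) m (\<lambda>_. 1\<^sub>m m)" if "i \<in> J" for i
    using that by (intro smooth.regular_GL_const V_open GL_one)
  show "1\<^sub>m m * g i j p = g i j p * 1\<^sub>m m" if "i \<in> J" "j \<in> J" "p \<in> V i" "p \<in> V j" for i j p
    using bundleD(3)[OF assms that] by simp
qed

lemma bundle_equiv: "equiv bundles bundle_iso"
proof (rule equivI)
  show "bundle_iso \<subseteq> bundles \<times> bundles" by (auto simp: twisted_iso_def)
  show "refl_on bundles bundle_iso" unfolding refl_on_def using bundle_iso_refl by auto
  show "sym bundle_iso"
  proof (rule symI, clarify)
    fix m g m' g' assume "((m, g), (m', g')) \<in> bundle_iso"
    then obtain f where f: "m' = m" "(m, g) \<in> bundles" "(m, g') \<in> bundles" "bundle_map m g g' f"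
      by (rule bundle_isoE)
    note f = f(1-3) bundle_mapD[OF f(4)]
    show "((m', g'), (m, g)) \<in> bundle_iso" unfolding f(1)
    proof (rule bundle_isoI[OF f(3,2)])
      show "smooth.regular_GL (V i) m (\<lambda>p. mat_inv (f i p))" if "i \<in> J" for i
        using that by (intro smooth.regular_GL_mat_inv V_open f(4))
      fix i j p assume a: "i \<in> J" "j \<in> J" "p \<in> V i" "p \<in> V j"
      note c = GL_carrier[OF f(5)[OF a(1,3)]] GL_carrier[OF f(5)[OF a(2,4)]] bundleD(3)[OF f(2) a] bundleD(3)[OF f(3) a]
        GL_carrier[OF GL_mat_inv(3)[OF f(5)[OF a(1,3)]]] GL_carrier[OF GL_mat_inv(3)[OF f(5)[OF a(2,4)]]]
      have "mat_inv (f i p) * g' i j p = mat_inv (f i p) * ((g' i j p * f j p) * mat_inv (f j p))"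
        using c GL_mat_inv(1)[OF f(5)[OF a(2,4)]] by (simp add: mat_calc[where n = m])
      also have "\<dots> = (mat_inv (f i p) * f i p) * (g i j p * mat_inv (f j p))"
        unfolding f(6)[OF a, symmetric] using c by (simp add: mat_calc[where n = m])
      also have "\<dots> = g i j p * mat_inv (f j p)"
        unfolding GL_mat_inv(2)[OF f(5)[OF a(1,3)]] using c by (simp add: mat_calc[where n = m])
      finally show "mat_inv (f i p) * g' i j p = g i j p * mat_inv (f j p)" .
    qed
  qed
  show "trans bundle_iso"
  proof (rule transI, clarify)
    fix m g m' g' m'' g'' assume 1: "((m, g), (m', g')) \<in> bundle_iso" and 2: "((m', g'), (m'', g'')) \<in> bundle_iso"
    obtain f where f: "m' = m" "(m, g) \<in> bundles" "(m, g') \<in> bundles" "bundle_map m g g' f"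
      using 1 by (rule bundle_isoE)
    note f = f(1-3) bundle_mapD[OF f(4)]
    obtain f' where f': "m'' = m'" "(m', g') \<in> bundles" "(m', g'') \<in> bundles" "bundle_map m' g' g'' f'"
      using 2 by (rule bundle_isoE)
    note f' = f'(1-3) bundle_mapD[OF f'(4)]
    note f' = f'(1) f'(2-6)[unfolded f(1)]
    show "((m, g), (m'', g'')) \<in> bundle_iso" unfolding f'(1) f(1)
    proof (rule bundle_isoI[OF f(2) f'(3)])
      show "smooth.regular_GL (V i) m (\<lambda>p. f' i p * f i p)" if "i \<in> J" for i
        using that by (intro smooth.regular_GL_mult V_open f(4) f'(4))
      fix i j p assume a: "i \<in> J" "j \<in> J" "p \<in> V i" "p \<in> V j"
      note c = GL_carrier[OF f(5)[OF a(1,3)]] GL_carrier[OF f(5)[OF a(2,4)]] bundleD(3)[OF f(2) a] bundleD(3)[OF f(3) a]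
        GL_carrier[OF f'(5)[OF a(1,3)]] GL_carrier[OF f'(5)[OF a(2,4)]] bundleD(3)[OF f'(3) a]
      have "f' i p * f i p * g i j p = f' i p * (f i p * g i j p)" using c by (simp add: mat_calc[where n = m])
      also have "\<dots> = (f' i p * g' i j p) * f j p" unfolding f(6)[OF a] using c by (simp add: mat_calc[where n = m])
      also have "\<dots> = g'' i j p * (f' j p * f j p)" unfolding f'(6)[OF a] using c by (simp add: mat_calc[where n = m])
      finally show "f' i p * f i p * g i j p = g'' i j p * (f' j p * f j p)" .
    qed
  qed
qed

lemma bundle_sum:
  assumes b: "(m, g) \<in> bundles" and b': "(m', g') \<in> bundles"
  shows "(m + m', \<lambda>i j x. block_sum m m' (g i j x) (g' i j x)) \<in> bundles"
proof (rule bundleI)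
  show "smooth.regular_GL (V i \<inter> V j) (m + m') (\<lambda>x. block_sum m m' (g i j x) (g' i j x))" if "i \<in> J" "j \<in> J" for i j
    using that by (intro smooth.regular_GL_block_sum V2_open bundleD(1)[OF b] bundleD(1)[OF b'])
  show "block_sum m m' (g i j p) (g' i j p) * block_sum m m' (g j i p) (g' j i p) = 1\<^sub>m (m + m')"
    if a: "i \<in> J" "j \<in> J" "p \<in> V i" "p \<in> V j" for i j p
    using a by (simp add: block_sum_mult bundleD[OF b] bundleD[OF b'] block_sum_one)
  show "block_sum m m' (g i j p) (g' i j p) * block_sum m m' (g j k p) (g' j k p) =
      h i j k p \<cdot>\<^sub>m block_sum m m' (g i k p) (g' i k p)"
    if a: "i \<in> J" "j \<in> J" "k \<in> J" "p \<in> V i" "p \<in> V j" "p \<in> V k" for i j k p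
    using a by (simp add: block_sum_mult bundleD(3,5)[OF b] bundleD(3,5)[OF b'] block_sum_smult)
qed

lemma bundle_sum_iso:
  assumes 1: "((m, g), (n, k)) \<in> bundle_iso" and 2: "((m', g'), (n', k')) \<in> bundle_iso"
  shows "((m + m', \<lambda>i j x. block_sum m m' (g i j x) (g' i j x)), (n + n', \<lambda>i j x. block_sum n n' (k i j x) (k' i j x))) \<in> bundle_iso"
proof -
  obtain f where f: "n = m" "(m, g) \<in> bundles" "(m, k) \<in> bundles" "bundle_map m g k f"
    using 1 by (rule bundle_isoE)
  note f = f(1-3) bundle_mapD[OF f(4)]
  obtain f' where f': "n' = m'" "(m', g') \<in> bundles" "(m', k') \<in> bundles" "bundle_map m' g' k' f'"
    using 2 by (rule bundle_isoE)
  note f' = f'(1-3) bundle_mapD[OF f'(4)]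
  show ?thesis unfolding f(1) f'(1)
  proof (rule bundle_isoI[OF bundle_sum[OF f(2) f'(2)] bundle_sum[OF f(3) f'(3)]])
    show "smooth.regular_GL (V i) (m + m') (\<lambda>p. block_sum m m' (f i p) (f' i p))" if "i \<in> J" for i
      using that by (intro smooth.regular_GL_block_sum V_open f(4) f'(4))
    fix i j p assume a: "i \<in> J" "j \<in> J" "p \<in> V i" "p \<in> V j"
    show "block_sum m m' (f i p) (f' i p) * block_sum m m' (g i j p) (g' i j p) =
        block_sum m m' (k i j p) (k' i j p) * block_sum m m' (f j p) (f' j p)"
      using a by (simp add: block_sum_mult bundleD(3)[OF f(2)] bundleD(3)[OF f'(2)] bundleD(3)[OF f(3)] bundleD(3)[OF f'(3)]
          GL_carrier[OF f(5)] GL_carrier[OF f'(5)] f(6) f'(6))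
  qed
qed

text \<open>The functors between categories of twisted bundles that occur below keep the rank and change the transition
  functions only.\<close>

lemma mult_iso_bundle_monoid:
  assumes tw: "twist X \<A> J' V' h'"
    and F: "\<And>m g. (m, g) \<in> bundles \<Longrightarrow> (m, F g) \<in> twisted_bundles \<A> J' V' h'"
    and full: "\<And>m g m' g'. (m, g) \<in> bundles \<Longrightarrow> (m', g') \<in> bundles \<Longrightarrow>
      ((m, g), (m', g')) \<in> bundle_iso \<longleftrightarrow> ((m, F g), (m', F g')) \<in> twisted_iso \<A> J' V' h'"
    and surj: "\<And>m g'. (m, g') \<in> twisted_bundles \<A> J' V' h' \<Longrightarrow>
      \<exists>g. (m, g) \<in> bundles \<and> ((m, F g), (m, g')) \<in> twisted_iso \<A> J' V' h'"
    and sum: "\<And>m g m' g'. (m, g) \<in> bundles \<Longrightarrow> (m', g') \<in> bundles \<Longrightarrow>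
      ((m + m', F (\<lambda>i j x. block_sum m m' (g i j x) (g' i j x))),
       (m + m', \<lambda>i j x. block_sum m m' (F g i j x) (F g' i j x))) \<in> twisted_iso \<A> J' V' h'"
  shows "mult_iso bundle_monoid (twist.bundle_monoid \<A> J' V' h')"
proof -
  interpret T: twist X \<A> J' V' h' by (rule tw)
  show ?thesis
    unfolding bundle_monoid_def T.bundle_monoid_def
  proof (rule mult_iso_quot[OF bundle_equiv T.bundle_equiv, where F = "\<lambda>(m, g). (m, F g)"])
    fix c assume "c \<in> T.bundles"
    then obtain m g' where c: "c = (m, g')" "(m, g') \<in> T.bundles" by (cases c) auto
    obtain g where "(m, g) \<in> bundles" "((m, F g), (m, g')) \<in> T.bundle_iso" using surj[OF c(2)] by blast
    then show "\<exists>a\<in>bundles. ((case a of (m, g) \<Rightarrow> (m, F g)), c) \<in> T.bundle_iso"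
      unfolding c(1) by (intro bexI[of _ "(m, g)"]) auto
  qed (use bundle_sum bundle_sum_iso T.bundle_sum_iso F full sum in \<open>auto split: prod.splits\<close>)
qed

end

section \<open>Cohomologous twistings\<close>

locale scaling = twist X \<A> J V h + T: twist X \<A> J V h'
  for X :: "'a topology" and \<A> :: "('a set \<times> ('a \<Rightarrow> 'e::real_inner)) set"
    and J :: "'j set" and V :: "'j \<Rightarrow> 'a set" and h h' :: "'j \<Rightarrow> 'j \<Rightarrow> 'j \<Rightarrow> 'a \<Rightarrow> complex" +
  fixes l :: "'j \<Rightarrow> 'j \<Rightarrow> 'a \<Rightarrow> complex"
  assumes l: "i \<in> J \<Longrightarrow> j \<in> J \<Longrightarrow> smooth_fun \<A> (V i \<inter> V j) (l i j)" "l i j p \<noteq> 0"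
      "i \<in> J \<Longrightarrow> j \<in> J \<Longrightarrow> p \<in> V i \<Longrightarrow> p \<in> V j \<Longrightarrow> l i j p * l j i p = 1"
    and h': "i \<in> J \<Longrightarrow> j \<in> J \<Longrightarrow> k \<in> J \<Longrightarrow> p \<in> V i \<Longrightarrow> p \<in> V j \<Longrightarrow> p \<in> V k \<Longrightarrow>
      h' i j k p = l i j p * l j k p * l k i p * h i j k p"
begin

text \<open>Multiplying the transition functions by \<open>l\<close> multiplies the twisting by the coboundary of \<open>l\<close>.\<close>

lemma scale_bundle:
  assumes b: "(m, g) \<in> bundles"
  shows "(m, \<lambda>i j p. l i j p \<cdot>\<^sub>m g i j p) \<in> twisted_bundles \<A> J V h'"
proof -
  show ?thesis
  proof (rule T.bundleI)
    show "smooth.regular_GL (V i \<inter> V j) m (\<lambda>p. l i j p \<cdot>\<^sub>m g i j p)" if "i \<in> J" "j \<in> J" for i j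
      using that by (intro smooth.regular_GL_smult V2_open l bundleD(1)[OF b])
    show "l i j p \<cdot>\<^sub>m g i j p * (l j i p \<cdot>\<^sub>m g j i p) = 1\<^sub>m m" if a: "i \<in> J" "j \<in> J" "p \<in> V i" "p \<in> V j" for i j p
      using a bundleD(3)[OF b, of i j p] bundleD(3)[OF b, of j i p] bundleD(4)[OF b, of i j p] l(3)[OF a]
      by (simp add: mat_calc[where n = m] smult_smult_mat mult.commute smult_one_mat)
    show "l i j p \<cdot>\<^sub>m g i j p * (l j k p \<cdot>\<^sub>m g j k p) = h' i j k p \<cdot>\<^sub>m (l i k p \<cdot>\<^sub>m g i k p)"
      if a: "i \<in> J" "j \<in> J" "k \<in> J" "p \<in> V i" "p \<in> V j" "p \<in> V k" for i j k p
    proof -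
      have "l i j p \<cdot>\<^sub>m g i j p * (l j k p \<cdot>\<^sub>m g j k p) = (l i j p * l j k p * h i j k p) \<cdot>\<^sub>m g i k p"
        using a bundleD(3)[OF b, of i j p] bundleD(3)[OF b, of j k p] bundleD(5)[OF b, of i j k p]
        by (simp add: mat_calc[where n = m] smult_smult_mat mult_ac)
      also have "l i j p * l j k p * h i j k p = h' i j k p * l i k p"
        using l(3)[of k i p] h'[OF a] a by (simp add: mult_ac)
      finally show ?thesis by (simp add: smult_smult_mat)
    qed
  qed
qed

lemma scale_iso:
  assumes iso: "((m, g), (m', g')) \<in> bundle_iso"
  shows "((m, \<lambda>i j p. l i j p \<cdot>\<^sub>m g i j p), (m', \<lambda>i j p. l i j p \<cdot>\<^sub>m g' i j p)) \<in> twisted_iso \<A> J V h'"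
proof -
  obtain f where f: "m' = m" "(m, g) \<in> bundles" "(m, g') \<in> bundles" "bundle_map m g g' f"
    using iso by (rule bundle_isoE)
  note f = f(1-3) bundle_mapD[OF f(4)]
  note sb = scale_bundle
  show ?thesis unfolding f(1)
  proof (rule T.bundle_isoI[OF sb[OF f(2)] sb[OF f(3)] f(4)])
    fix i j p assume a: "i \<in> J" "j \<in> J" "p \<in> V i" "p \<in> V j"
    show "f i p * (l i j p \<cdot>\<^sub>m g i j p) = l i j p \<cdot>\<^sub>m g' i j p * f j p"
      using bundleD(3)[OF f(2) a] bundleD(3)[OF f(3) a] GL_carrier[OF f(5)[OF a(1,3)]] GL_carrier[OF f(5)[OF a(2,4)]] f(6)[OF a]
      by (simp add: mat_calc[where n = m])
  qed
qed

lemma mult_iso_scale: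
  shows "mult_iso bundle_monoid (twist.bundle_monoid \<A> J V h')"
proof -
  let ?l' = "\<lambda>i j p. inverse (l i j p)"
  have l': "\<And>i j. i \<in> J \<Longrightarrow> j \<in> J \<Longrightarrow> smooth_fun \<A> (V i \<inter> V j) (?l' i j)" "\<And>i j p. ?l' i j p \<noteq> 0"
      "\<And>i j p. i \<in> J \<Longrightarrow> j \<in> J \<Longrightarrow> p \<in> V i \<Longrightarrow> p \<in> V j \<Longrightarrow> ?l' i j p * ?l' j i p = 1"
    using l(2,3) by (auto intro!: smooth.inverse V2_open l(1) simp: inverse_mult_distrib[symmetric])
  have hh: "h i j k p = ?l' i j p * ?l' j k p * ?l' k i p * h' i j k p"
    if "i \<in> J" "j \<in> J" "k \<in> J" "p \<in> V i" "p \<in> V j" "p \<in> V k" for i j k p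
    using h'[OF that] l(2)[of i j p] l(2)[of j k p] l(2)[of k i p] by (simp add: field_simps)
  interpret I: scaling X \<A> J V h' h ?l'
    by unfold_locales (fact l' hh)+
  have inv1: "(\<lambda>i j p. ?l' i j p \<cdot>\<^sub>m (l i j p \<cdot>\<^sub>m g i j p)) = g" and
    inv2: "(\<lambda>i j p. l i j p \<cdot>\<^sub>m (?l' i j p \<cdot>\<^sub>m g i j p)) = g" for g
    using l(2) by (auto simp: fun_eq_iff smult_smult_mat smult_one_mat)
  show ?thesis
  proof (rule mult_iso_bundle_monoid[OF T.twist_axioms, where F = "\<lambda>g i j p. l i j p \<cdot>\<^sub>m g i j p"])
    fix m g assume b: "(m, g) \<in> bundles"
    show "(m, \<lambda>i j p. l i j p \<cdot>\<^sub>m g i j p) \<in> T.bundles" by (rule scale_bundle[OF b])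
    fix m' g' assume b': "(m', g') \<in> bundles"
    show "((m, g), (m', g')) \<in> bundle_iso \<longleftrightarrow>
        ((m, \<lambda>i j p. l i j p \<cdot>\<^sub>m g i j p), (m', \<lambda>i j p. l i j p \<cdot>\<^sub>m g' i j p)) \<in> T.bundle_iso"
    proof
      assume "((m, g), (m', g')) \<in> bundle_iso"
      then show "((m, \<lambda>i j p. l i j p \<cdot>\<^sub>m g i j p), (m', \<lambda>i j p. l i j p \<cdot>\<^sub>m g' i j p)) \<in> T.bundle_iso"
        by (rule scale_iso)
    next
      assume "((m, \<lambda>i j p. l i j p \<cdot>\<^sub>m g i j p), (m', \<lambda>i j p. l i j p \<cdot>\<^sub>m g' i j p)) \<in> T.bundle_iso"
      from I.scale_iso[OF this] show "((m, g), (m', g')) \<in> bundle_iso" by (simp only: inv1)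
    qed
    have e: "(m + m', \<lambda>i j p. l i j p \<cdot>\<^sub>m block_sum m m' (g i j p) (g' i j p)) \<in> T.bundles"
      by (rule scale_bundle[OF bundle_sum[OF b b']])
    have e': "(m + m', \<lambda>i j x. block_sum m m' (l i j x \<cdot>\<^sub>m g i j x) (l i j x \<cdot>\<^sub>m g' i j x)) \<in> T.bundles"
      by (rule T.bundle_sum[OF scale_bundle[OF b] scale_bundle[OF b']])
    show "((m + m', \<lambda>i j p. l i j p \<cdot>\<^sub>m block_sum m m' (g i j p) (g' i j p)),
        (m + m', \<lambda>i j x. block_sum m m' (l i j x \<cdot>\<^sub>m g i j x) (l i j x \<cdot>\<^sub>m g' i j x))) \<in> T.bundle_iso"
    proof (rule T.bundle_isoI[OF e e', where f = "\<lambda>i p. 1\<^sub>m (m + m')"])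
      show "smooth.regular_GL (V i) (m + m') (\<lambda>p. 1\<^sub>m (m + m'))" if "i \<in> J" for i
        using that by (intro smooth.regular_GL_const V_open GL_one)
      fix i j p assume a: "i \<in> J" "j \<in> J" "p \<in> V i" "p \<in> V j"
      note c = bundleD(3)[OF b a] bundleD(3)[OF b' a]
      show "1\<^sub>m (m + m') * (l i j p \<cdot>\<^sub>m block_sum m m' (g i j p) (g' i j p)) =
          block_sum m m' (l i j p \<cdot>\<^sub>m g i j p) (l i j p \<cdot>\<^sub>m g' i j p) * 1\<^sub>m (m + m')"
        using c block_sum_carrier[OF c] block_sum_carrier[OF smult_carrier[OF c(1), of "l i j p"] smult_carrier[OF c(2), of "l i j p"]]
        by (simp add: block_sum_smult[OF c])
    qed
  next
    fix m g' assume b: "(m, g') \<in> T.bundles"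
    have 1: "(m, \<lambda>i j p. ?l' i j p \<cdot>\<^sub>m g' i j p) \<in> bundles" by (rule I.scale_bundle[OF b])
    show "\<exists>g. (m, g) \<in> bundles \<and> ((m, \<lambda>i j p. l i j p \<cdot>\<^sub>m g i j p), (m, g')) \<in> T.bundle_iso"
      by (intro exI conjI, rule 1) (simp only: inv2 T.bundle_iso_refl[OF b])
  qed
qed

end

section \<open>Refinement of the cover\<close>

context twist
begin

text \<open>The cocycle condition and the cyclic symmetry remove the second index; an alternating function of one repeated
  index is its own inverse.\<close>

lemma h_sign:
  assumes "i \<in> J" "j \<in> J" "p \<in> V i" "p \<in> V j"
  shows "h i j i p = h i i i p" "h i i i p * h i i i p = 1"
proof -
  have "h j i i p * h i j i p = h i i i p * h i j i p" using h_coc[of i j i i p] assms by simp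
  then have "h j i i p = h i i i p" using h_nz[of i j i p] assms by simp
  moreover have "h j i i p = h i j i p" using h_cyc[of i j i p] assms by simp
  ultimately show "h i j i p = h i i i p" by simp
  show "h i i i p * h i i i p = 1"
    using h_rev[of i i i p] h_nz[of i i i p] assms by (metis right_inverse)
qed

end

text \<open>The refinement is indexed by the points of the manifold, and \<open>\<sigma>\<close> is the refinement map.\<close>

locale refinement = twist X \<A> J V h
  for X :: "'a topology" and \<A> :: "('a set \<times> ('a \<Rightarrow> 'e::real_inner)) set"
    and J :: "'j set" and V :: "'j \<Rightarrow> 'a set" and h :: "'j \<Rightarrow> 'j \<Rightarrow> 'j \<Rightarrow> 'a \<Rightarrow> complex" +
  fixes W :: "'a \<Rightarrow> 'a set" and \<sigma> :: "'a \<Rightarrow> 'j"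
  assumes contractible: "j \<in> J \<Longrightarrow> contractible_space (subtopology X (V j))"
    and W_open: "x \<in> topspace X \<Longrightarrow> openin X (W x)" and W_self: "x \<in> topspace X \<Longrightarrow> x \<in> W x"
    and \<sigma>: "x \<in> topspace X \<Longrightarrow> \<sigma> x \<in> J" and W_sub: "x \<in> topspace X \<Longrightarrow> W x \<subseteq> V (\<sigma> x)"
begin

abbreviation "h\<sigma> \<equiv> \<lambda>x y z. h (\<sigma> x) (\<sigma> y) (\<sigma> z)"

lemma W_V: "x \<in> topspace X \<Longrightarrow> p \<in> W x \<Longrightarrow> p \<in> V (\<sigma> x)"
  using W_sub by blast

lemma V_top: "j \<in> J \<Longrightarrow> p \<in> V j \<Longrightarrow> p \<in> topspace X"
  using openin_subset[OF V_open] by blast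

lemma W_top: "x \<in> topspace X \<Longrightarrow> p \<in> W x \<Longrightarrow> p \<in> topspace X"
  using openin_subset[OF W_open] by blast

lemma refined_twist: "twist X \<A> (topspace X) W h\<sigma>"
proof
  show "openin X (W j)" if "j \<in> topspace X" for j by (rule W_open[OF that])
  show "smooth_fun \<A> (W i \<inter> W j \<inter> W k) (h\<sigma> i j k)" if "i \<in> topspace X" "j \<in> topspace X" "k \<in> topspace X" for i j k
  proof (rule smooth.subset[OF _ _ h_smooth[OF \<sigma>[OF that(1)] \<sigma>[OF that(2)] \<sigma>[OF that(3)]]])
    show "openin X (V (\<sigma> i) \<inter> V (\<sigma> j) \<inter> V (\<sigma> k))" using V_open \<sigma> that by blast
    show "openin X (W i \<inter> W j \<inter> W k)" using W_open that by blast
  qed (use W_sub that in blast)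
next
  fix i j k p assume a: "i \<in> topspace X" "j \<in> topspace X" "k \<in> topspace X" "p \<in> W i" "p \<in> W j" "p \<in> W k"
  note b = \<sigma>[OF a(1)] \<sigma>[OF a(2)] \<sigma>[OF a(3)] W_V[OF a(1,4)] W_V[OF a(2,5)] W_V[OF a(3,6)]
  show "h\<sigma> i j k p \<noteq> 0" by (rule h_nz[OF b])
  show "h\<sigma> j k i p = h\<sigma> i j k p" by (rule h_cyc[OF b])
  show "h\<sigma> k j i p = inverse (h\<sigma> i j k p)" by (rule h_rev[OF b])
  fix l assume l: "l \<in> topspace X" "p \<in> W l"
  show "h\<sigma> j k l p * h\<sigma> i j l p = h\<sigma> i k l p * h\<sigma> i j k p"
    by (rule h_coc[OF b(1-3) \<sigma>[OF l(1)] b(4-6) W_V[OF l]])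
qed

sublocale R: twist X \<A> "topspace X" W h\<sigma>
  by (rule refined_twist)

lemma restrict_bundle:
  assumes b: "(m, g) \<in> bundles"
  shows "(m, \<lambda>x y. g (\<sigma> x) (\<sigma> y)) \<in> R.bundles"
proof (rule R.bundleI)
  show "smooth.regular_GL (W x \<inter> W y) m (g (\<sigma> x) (\<sigma> y))" if "x \<in> topspace X" "y \<in> topspace X" for x y
    by (rule smooth.regular_GL_subset[OF V2_open[OF \<sigma>[OF that(1)] \<sigma>[OF that(2)]] R.V2_open[OF that] bundleD(1)[OF b]])
      (use \<sigma> W_sub that in blast)+
qed (use bundleD(4,5)[OF b] \<sigma> W_V in simp_all)

text \<open>Conjugating by transition functions carries an isomorphism of the restrictions to the sets \<open>V j\<close>, where the
  local expressions agree.\<close>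

lemma extend_iso:
  assumes b: "(m, g) \<in> bundles" and b': "(m, g') \<in> bundles" and f: "R.bundle_map m (\<lambda>x y. g (\<sigma> x) (\<sigma> y)) (\<lambda>x y. g' (\<sigma> x) (\<sigma> y)) f"
  shows "((m, g), (m, g')) \<in> bundle_iso"
proof -
  note f = R.bundle_mapD[OF f]
  define \<Phi> where "\<Phi> = (\<lambda>y j p. g' j (\<sigma> y) p * f y p * g (\<sigma> y) j p)"
  have c: "g' j (\<sigma> y) p \<in> carrier_mat m m" "g (\<sigma> y) j p \<in> carrier_mat m m" "f y p \<in> carrier_mat m m"
    if "y \<in> topspace X" "j \<in> J" "p \<in> W y" "p \<in> V j" for y j p
    using bundleD(3)[OF b] bundleD(3)[OF b'] \<sigma> W_V that GL_carrier[OF f(2)] by auto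
  have indep: "\<Phi> y j p = \<Phi> x j p"
    if a: "x \<in> topspace X" "y \<in> topspace X" "j \<in> J" "p \<in> W x" "p \<in> W y" "p \<in> V j" for x y j p
  proof -
    note aJ = \<sigma>[OF a(1)] \<sigma>[OF a(2)] W_V[OF a(1,4)] W_V[OF a(2,5)]
    note cc = c[OF a(1,3,4,6)] c[OF a(2,3,5,6)]
    have cyx: "g (\<sigma> y) (\<sigma> x) p \<in> carrier_mat m m" "g' (\<sigma> y) (\<sigma> x) p \<in> carrier_mat m m"
      using bundleD(3)[OF b] bundleD(3)[OF b'] aJ by auto
    have "h (\<sigma> y) (\<sigma> x) j p \<cdot>\<^sub>m \<Phi> y j p = g' j (\<sigma> y) p * f y p * (g (\<sigma> y) (\<sigma> x) p * g (\<sigma> x) j p)"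
      using cc bundleD(5)[OF b, of "\<sigma> y" "\<sigma> x" j p] aJ a by (simp add: \<Phi>_def mat_calc[where n = m])
    also have "\<dots> = g' j (\<sigma> y) p * (f y p * g (\<sigma> y) (\<sigma> x) p) * g (\<sigma> x) j p"
      using cc cyx by (simp add: mat_calc[where n = m])
    also have "\<dots> = (g' j (\<sigma> y) p * g' (\<sigma> y) (\<sigma> x) p) * f x p * g (\<sigma> x) j p"
      unfolding f(3)[OF a(2,1,5,4)] using cc cyx by (simp add: mat_calc[where n = m])
    also have "\<dots> = h j (\<sigma> y) (\<sigma> x) p \<cdot>\<^sub>m \<Phi> x j p"
      using cc bundleD(5)[OF b', of j "\<sigma> y" "\<sigma> x" p] aJ a by (simp add: \<Phi>_def mat_calc[where n = m])
    also have "h j (\<sigma> y) (\<sigma> x) p = h (\<sigma> y) (\<sigma> x) j p" using h_cyc[of j "\<sigma> y" "\<sigma> x" p] aJ a by simp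
    finally show ?thesis by (rule smult_cancel[rotated]) (use h_nz aJ a in simp)
  qed
  show ?thesis
  proof (rule bundle_isoI[OF b b', where f = "\<lambda>j p. \<Phi> p j p"])
    fix j assume j: "j \<in> J"
    show "smooth.regular_GL (V j) m (\<lambda>p. \<Phi> p j p)"
    proof (rule smooth.regular_GL_local[OF V_open[OF j]])
      fix x assume x: "x \<in> V j"
      have xt: "x \<in> topspace X" by (rule V_top[OF j x])
      let ?G = "W x \<inter> V j"
      have o: "openin X ?G" using W_open[OF xt] V_open[OF j] by blast
      note sx = \<sigma>[OF xt]
      have "smooth.regular_GL ?G m (\<Phi> x j)"
        unfolding \<Phi>_def
      proof (intro smooth.regular_GL_mult o)
        show "smooth.regular_GL ?G m (g' j (\<sigma> x))"
          by (rule smooth.regular_GL_subset[OF V2_open[OF j sx] o bundleD(1)[OF b' j sx]]) (use W_sub[OF xt] in blast)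
        show "smooth.regular_GL ?G m (g (\<sigma> x) j)"
          by (rule smooth.regular_GL_subset[OF V2_open[OF sx j] o bundleD(1)[OF b sx j]]) (use W_sub[OF xt] in blast)
        show "smooth.regular_GL ?G m (f x)"
          by (rule smooth.regular_GL_subset[OF W_open[OF xt] o f(1)[OF xt]]) blast
      qed
      moreover have "\<Phi> p j p = \<Phi> x j p" if "p \<in> ?G" for p
        using indep[of x p j p] xt W_top[OF xt] W_self j that by auto
      ultimately show "\<exists>G g'. openin X G \<and> x \<in> G \<and> G \<subseteq> V j \<and> smooth.regular_GL G m g' \<and> (\<forall>y\<in>G. \<Phi> y j y = g' y)"
        using o x W_self[OF xt] by (intro exI[of _ ?G] exI[of _ "\<Phi> x j"]) auto
    qed
  next
    fix i j p assume a: "i \<in> J" "j \<in> J" "p \<in> V i" "p \<in> V j"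
    have pt: "p \<in> topspace X" by (rule V_top[OF a(1,3)])
    note aJ = \<sigma>[OF pt] W_self[OF pt] W_V[OF pt W_self[OF pt]]
    note cc = c[OF pt a(1) aJ(2) a(3)] c[OF pt a(2) aJ(2) a(4)] bundleD(3)[OF b a] bundleD(3)[OF b' a]
    have "\<Phi> p i p * g i j p = g' i (\<sigma> p) p * f p p * (g (\<sigma> p) i p * g i j p)"
      using cc by (simp add: \<Phi>_def mat_calc[where n = m])
    also have "\<dots> = h (\<sigma> p) i j p \<cdot>\<^sub>m (g' i (\<sigma> p) p * f p p * g (\<sigma> p) j p)"
      using cc bundleD(5)[OF b, of "\<sigma> p" i j p] aJ a by (simp add: mat_calc[where n = m])
    also have "h (\<sigma> p) i j p = h i j (\<sigma> p) p" using h_cyc[of "\<sigma> p" i j p] aJ a by simp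
    also have "h i j (\<sigma> p) p \<cdot>\<^sub>m (g' i (\<sigma> p) p * f p p * g (\<sigma> p) j p) = (g' i j p * g' j (\<sigma> p) p) * f p p * g (\<sigma> p) j p"
      using cc bundleD(5)[OF b', of i j "\<sigma> p" p] aJ a by (simp add: mat_calc[where n = m])
    also have "\<dots> = g' i j p * \<Phi> p j p" using cc by (simp add: \<Phi>_def mat_calc[where n = m])
    finally show "\<Phi> p i p * g i j p = g' i j p * \<Phi> p j p" .
  qed
qed

end

context refinement
begin

text \<open>On a single set \<open>V j\<close> the twisting becomes a coboundary, so that a twisted bundle on the refinement
  restricts to an honest bundle there. That bundle is trivial by contractibility, and the transition functions between
  the trivialisations on \<open>V i\<close> and \<open>V j\<close> form the extended bundle.\<close>

lemma extend_bundle: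
  assumes b: "(m, g) \<in> R.bundles"
  shows "\<exists>G. (m, G) \<in> bundles \<and> ((m, \<lambda>x y. G (\<sigma> x) (\<sigma> y)), (m, g)) \<in> R.bundle_iso"
proof -
  (* By the cocycle condition for h, dividing by h with the first index j removes the twisting over V j. *)
  define e where "e = (\<lambda>j x y p. inverse (h j (\<sigma> x) (\<sigma> y) p) \<cdot>\<^sub>m g x y p)"
  have e_smooth: "smooth.regular_GL (W x \<inter> W y \<inter> V j) m (e j x y)"
    if a: "j \<in> J" "x \<in> topspace X" "y \<in> topspace X" for j x y
  proof -
    have o: "openin X (W x \<inter> W y \<inter> V j)" using R.V2_open[OF a(2,3)] V_open[OF a(1)] by blast
    have o': "openin X (V j \<inter> V (\<sigma> x) \<inter> V (\<sigma> y))" using V_open \<sigma> a by blast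
    have s: "W x \<inter> W y \<inter> V j \<subseteq> V j \<inter> V (\<sigma> x) \<inter> V (\<sigma> y)" using W_sub a by blast
    have nz: "h j (\<sigma> x) (\<sigma> y) p \<noteq> 0" if "p \<in> W x \<inter> W y \<inter> V j" for p
      using s that by (intro h_nz a \<sigma>) auto
    show ?thesis
      unfolding e_def
    proof (intro smooth.regular_GL_smult smooth.inverse o)
      show "smooth_fun \<A> (W x \<inter> W y \<inter> V j) (h j (\<sigma> x) (\<sigma> y))"
        by (rule smooth.subset[OF o' o h_smooth[OF a(1) \<sigma>[OF a(2)] \<sigma>[OF a(3)]] s])
      show "smooth.regular_GL (W x \<inter> W y \<inter> V j) m (g x y)"
        by (rule smooth.regular_GL_subset[OF R.V2_open[OF a(2,3)] o R.bundleD(1)[OF b a(2,3)]]) blast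
    qed (use nz in auto)
  qed
  have e_mult: "e j x y p * e j y z p = e j x z p"
    if a: "j \<in> J" "x \<in> topspace X" "y \<in> topspace X" "z \<in> topspace X" "p \<in> W x" "p \<in> W y" "p \<in> W z" "p \<in> V j"
    for j x y z p
  proof -
    note aJ = \<sigma>[OF a(2)] \<sigma>[OF a(3)] \<sigma>[OF a(4)] W_V[OF a(2,5)] W_V[OF a(3,6)] W_V[OF a(4,7)]
    have nz: "h j (\<sigma> x) (\<sigma> y) p \<noteq> 0" "h j (\<sigma> y) (\<sigma> z) p \<noteq> 0" "h j (\<sigma> x) (\<sigma> z) p \<noteq> 0"
      using h_nz aJ a by simp_all
    have "e j x y p * e j y z p =
        (inverse (h j (\<sigma> x) (\<sigma> y) p) * inverse (h j (\<sigma> y) (\<sigma> z) p) * h (\<sigma> x) (\<sigma> y) (\<sigma> z) p) \<cdot>\<^sub>m g x z p"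
      using R.bundleD(3)[OF b a(2,3,5,6)] R.bundleD(3)[OF b a(3,4,6,7)] R.bundleD(3)[OF b a(2,4,5,7)]
        R.bundleD(5)[OF b a(2,3,4,5,6,7)]
      by (simp add: e_def mat_calc[where n = m] smult_smult_mat mult_ac)
    also have "inverse (h j (\<sigma> x) (\<sigma> y) p) * inverse (h j (\<sigma> y) (\<sigma> z) p) * h (\<sigma> x) (\<sigma> y) (\<sigma> z) p
        = inverse (h j (\<sigma> x) (\<sigma> z) p)"
      using h_coc[OF a(1) aJ(1-3) a(8) aJ(4-6)] nz by (simp add: field_simps)
    finally show ?thesis by (simp add: e_def)
  qed
  have ec: "e j x y p \<in> carrier_mat m m" if "j \<in> J" "x \<in> topspace X" "y \<in> topspace X" "p \<in> W x" "p \<in> W y" "p \<in> V j" for j x y p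
    using smooth.regular_GLD(1)[OF e_smooth[OF that(1-3)]] that GL_carrier by blast
  have "\<exists>s. (\<forall>p. s p \<in> carrier_mat m m) \<and> (\<forall>z\<in>V j. smooth.regular_GL (W z \<inter> V j) m (\<lambda>p. e j z p p * s p))"
    if j: "j \<in> J" for j
  proof -
    interpret gl_cocycle X \<A> "V j" "\<lambda>x. W x \<inter> V j" m "e j"
    proof
      fix x y z p assume x: "x \<in> V j"
      note xt = V_top[OF j x]
      show "openin X (W x \<inter> V j)" using W_open[OF xt] V_open[OF j] by blast
      show "x \<in> W x \<inter> V j" using W_self[OF xt] x by blast
      assume y: "y \<in> V j"
      have "W x \<inter> V j \<inter> (W y \<inter> V j) = W x \<inter> W y \<inter> V j" by blast
      then show "smooth.regular_GL (W x \<inter> V j \<inter> (W y \<inter> V j)) m (e j x y)"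
        using e_smooth[OF j xt V_top[OF j y]] by simp
      assume "z \<in> V j" "p \<in> W x \<inter> V j" "p \<in> W y \<inter> V j" "p \<in> W z \<inter> V j"
      then show "e j x y p * e j y z p = e j x z p"
        using e_mult[OF j xt V_top[OF j y] V_top[OF j]] by blast
    qed (use V_open[OF j] in auto)
    show ?thesis by (rule smooth_trivialisation[OF contractible[OF j]])
  qed
  then obtain s where s: "\<And>j p. j \<in> J \<Longrightarrow> s j p \<in> carrier_mat m m"
    "\<And>j z. j \<in> J \<Longrightarrow> z \<in> V j \<Longrightarrow> smooth.regular_GL (W z \<inter> V j) m (\<lambda>p. e j z p p * s j p)"
    by metis
  (* The trivialisation over V j, expressed in the frame x. *)
  define S where "S = (\<lambda>j x p. e j x p p * s j p)"
  have S_e: "S j x p = e j x y p * S j y p"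
    if a: "j \<in> J" "x \<in> topspace X" "y \<in> topspace X" "p \<in> W x" "p \<in> W y" "p \<in> V j" for j x y p
  proof -
    note pt = V_top[OF a(1,6)]
    note c = ec[OF a(1,2,3,4,5,6)] ec[OF a(1,3) pt a(5) W_self[OF pt] a(6)] s(1)[OF a(1), of p]
    have "e j x y p * S j y p = (e j x y p * e j y p p) * s j p"
      using c by (simp add: S_def mat_calc[where n = m])
    then show ?thesis using e_mult[OF a(1,2,3) pt a(4,5) W_self[OF pt] a(6)] by (simp add: S_def)
  qed
  have S_smooth: "smooth.regular_GL (W x \<inter> V j) m (S j x)" if j: "j \<in> J" and x: "x \<in> topspace X" for j x
  proof (rule smooth.regular_GL_local)
    show "openin X (W x \<inter> V j)" using W_open[OF x] V_open[OF j] by blast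
    fix y assume y: "y \<in> W x \<inter> V j"
    note yt = W_top[OF x IntD1[OF y]]
    let ?H = "W x \<inter> W y \<inter> V j"
    have o: "openin X ?H" "openin X (W y \<inter> V j)" using W_open[OF x] W_open[OF yt] V_open[OF j] by blast+
    have "smooth.regular_GL ?H m (\<lambda>p. e j x y p * S j y p)"
    proof (intro smooth.regular_GL_mult o(1) e_smooth j x yt)
      show "smooth.regular_GL ?H m (S j y)"
        by (rule smooth.regular_GL_subset[OF o(2) o(1)]) (use s(2)[OF j, of y] y in \<open>auto simp: S_def\<close>)
    qed
    then show "\<exists>G g'. openin X G \<and> y \<in> G \<and> G \<subseteq> W x \<inter> V j \<and> smooth.regular_GL G m g' \<and> (\<forall>p\<in>G. S j x p = g' p)"
      using o(1) y W_self[OF yt] S_e[OF j x yt] by (intro exI[of _ ?H] exI[of _ "\<lambda>p. e j x y p * S j y p"]) auto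
  qed
  have S_GL: "S j x p \<in> GL m" if "j \<in> J" "x \<in> topspace X" "p \<in> W x" "p \<in> V j" for j x p
    using smooth.regular_GLD(1)[OF S_smooth[OF that(1,2)]] that by blast
  note Sc = GL_carrier[OF S_GL]
  define G where "G = (\<lambda>i j p. mat_inv (S i p p) * (h i j (\<sigma> p) p \<cdot>\<^sub>m S j p p))"
  have G_GL: "G i j p \<in> GL m" if a: "i \<in> J" "j \<in> J" "p \<in> V i" "p \<in> V j" for i j p
  proof -
    note pt = V_top[OF a(1,3)]
    have "h i j (\<sigma> p) p \<noteq> 0" by (rule h_nz[OF a(1,2) \<sigma>[OF pt] a(3,4) W_V[OF pt W_self[OF pt]]])
    then show ?thesis unfolding G_def
      by (intro GL_mult GL_mat_inv(3) GL_smult S_GL a pt W_self[OF pt])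
  qed
  note Gc = GL_carrier[OF G_GL]
  (* Every frame y determines the same matrix, so G may be studied near a point in a fixed frame. *)
  have G_char: "S i y p * G i j p = h i j (\<sigma> y) p \<cdot>\<^sub>m S j y p"
    if a: "i \<in> J" "j \<in> J" "y \<in> topspace X" "p \<in> W y" "p \<in> V i" "p \<in> V j" for i j y p
  proof -
    note pt = V_top[OF a(1,5)]
    note pW = W_self[OF pt] and yJ = \<sigma>[OF a(3)] W_V[OF a(3,4)] and pJ = \<sigma>[OF pt] W_V[OF pt W_self[OF pt]]
    note c = ec[OF a(1,3) pt a(4) pW a(5)] Sc[OF a(1) pt pW a(5)] Sc[OF a(2) pt pW a(6)] Gc[OF a(1,2,5,6)]
      GL_carrier[OF GL_mat_inv(3)[OF S_GL[OF a(1) pt pW a(5)]]] R.bundleD(3)[OF b a(3) pt a(4) pW]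
    have nz: "h i (\<sigma> y) (\<sigma> p) p \<noteq> 0" "h j (\<sigma> y) (\<sigma> p) p \<noteq> 0" using h_nz a yJ pJ by simp_all
    have base: "S i p p * G i j p = h i j (\<sigma> p) p \<cdot>\<^sub>m S j p p"
    proof -
      have "S i p p * G i j p = (S i p p * mat_inv (S i p p)) * (h i j (\<sigma> p) p \<cdot>\<^sub>m S j p p)"
        using c by (simp add: G_def mat_calc[where n = m])
      then show ?thesis using GL_mat_inv(1)[OF S_GL[OF a(1) pt pW a(5)]] c by (simp add: mat_calc[where n = m])
    qed
    have "S i y p * G i j p = e i y p p * (S i p p * G i j p)"
      using c S_e[OF a(1,3) pt a(4) pW a(5)] by (simp add: mat_calc[where n = m])
    also have "\<dots> = (inverse (h i (\<sigma> y) (\<sigma> p) p) * h i j (\<sigma> p) p) \<cdot>\<^sub>m (g y p p * S j p p)"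
      unfolding base using c by (simp add: e_def mat_calc[where n = m] smult_smult_mat mult_ac)
    also have "inverse (h i (\<sigma> y) (\<sigma> p) p) * h i j (\<sigma> p) p = h i j (\<sigma> y) p * inverse (h j (\<sigma> y) (\<sigma> p) p)"
      using h_coc[OF a(1,2) yJ(1) pJ(1) a(5,6) yJ(2) pJ(2)] nz by (simp add: field_simps)
    also have "(h i j (\<sigma> y) p * inverse (h j (\<sigma> y) (\<sigma> p) p)) \<cdot>\<^sub>m (g y p p * S j p p) =
        h i j (\<sigma> y) p \<cdot>\<^sub>m (e j y p p * S j p p)"
      using c by (simp add: e_def mat_calc[where n = m] smult_smult_mat)
    finally show ?thesis using S_e[OF a(2,3) pt a(4) pW a(6)] by simp
  qed
  have bG: "(m, G) \<in> bundles"
  proof (rule bundleI)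
    fix i j assume ij: "i \<in> J" "j \<in> J"
    show "smooth.regular_GL (V i \<inter> V j) m (G i j)"
    proof (rule smooth.regular_GL_local[OF V2_open[OF ij]])
      fix y assume y: "y \<in> V i \<inter> V j"
      then have yt: "y \<in> topspace X" using V_top[OF ij(1)] by blast
      let ?H = "W y \<inter> (V i \<inter> V j)"
      have o: "openin X ?H" "openin X (W y \<inter> V i)" "openin X (W y \<inter> V j)" "openin X (V i \<inter> V j \<inter> V (\<sigma> y))"
        using W_open[OF yt] V_open[OF ij(1)] V_open[OF ij(2)] V_open[OF \<sigma>[OF yt]] by blast+
      have "smooth.regular_GL ?H m (\<lambda>p. mat_inv (S i y p) * (h i j (\<sigma> y) p \<cdot>\<^sub>m S j y p))"
      proof (intro smooth.regular_GL_mult smooth.regular_GL_mat_inv smooth.regular_GL_smult o(1))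
        show "smooth.regular_GL ?H m (S i y)"
          by (rule smooth.regular_GL_subset[OF o(2) o(1) S_smooth[OF ij(1) yt]]) blast
        show "smooth.regular_GL ?H m (S j y)"
          by (rule smooth.regular_GL_subset[OF o(3) o(1) S_smooth[OF ij(2) yt]]) blast
        show "smooth_fun \<A> ?H (h i j (\<sigma> y))"
          by (rule smooth.subset[OF o(4) o(1) h_smooth[OF ij \<sigma>[OF yt]]]) (use W_sub[OF yt] in blast)
        show "h i j (\<sigma> y) p \<noteq> 0" if "p \<in> ?H" for p
          by (rule h_nz[OF ij \<sigma>[OF yt]]) (use that W_V[OF yt] in auto)
      qed
      moreover have "G i j p = mat_inv (S i y p) * (h i j (\<sigma> y) p \<cdot>\<^sub>m S j y p)" if p: "p \<in> ?H" for p
        by (rule mat_inv_unique[OF S_GL[OF ij(1) yt] Gc[OF ij] G_char[OF ij yt]]) (use p in auto)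
      ultimately show "\<exists>H g'. openin X H \<and> y \<in> H \<and> H \<subseteq> V i \<inter> V j \<and> smooth.regular_GL H m g' \<and> (\<forall>p\<in>H. G i j p = g' p)"
        using o(1) y W_self[OF yt]
        by (intro exI[of _ ?H] exI[of _ "\<lambda>p. mat_inv (S i y p) * (h i j (\<sigma> y) p \<cdot>\<^sub>m S j y p)"]) auto
    qed
    fix p assume p: "p \<in> V i" "p \<in> V j"
    note pt = V_top[OF ij(1) p(1)]
    note pW = W_self[OF pt] and pJ = \<sigma>[OF pt] W_V[OF pt W_self[OF pt]]
    note c = Sc[OF ij(1) pt pW p(1)] Sc[OF ij(2) pt pW p(2)] Gc[OF ij p] Gc[OF ij(2,1) p(2,1)]
    have "h j i (\<sigma> p) p * h i j (\<sigma> p) p = 1"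
      using h_rev[OF pJ(1) ij pJ(2) p] h_cyc[OF pJ(1) ij pJ(2) p] h_nz[OF ij pJ(1) p pJ(2)] by simp
    moreover have "S i p p * (G i j p * G j i p) = (S i p p * G i j p) * G j i p"
      using c by (simp add: mat_calc[where n = m])
    moreover have "\<dots> = (h j i (\<sigma> p) p * h i j (\<sigma> p) p) \<cdot>\<^sub>m S i p p"
      unfolding G_char[OF ij pt pW p] using c G_char[OF ij(2,1) pt pW p(2,1)]
      by (simp add: mat_calc[where n = m] smult_smult_mat mult_ac)
    ultimately have "S i p p * (G i j p * G j i p) = S i p p * 1\<^sub>m m"
      using c by (simp add: smult_one_mat)
    then show "G i j p * G j i p = 1\<^sub>m m"
      by (rule GL_cancel_left[OF S_GL[OF ij(1) pt pW p(1)] mult_mat_carrier[OF c(3,4)] one_carrier_mat])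
    fix k assume k: "k \<in> J" "p \<in> V k"
    note c = c Sc[OF k(1) pt pW k(2)] Gc[OF ij(2) k(1) p(2) k(2)] Gc[OF ij(1) k(1) p(1) k(2)]
    have "S i p p * (G i j p * G j k p) = (S i p p * G i j p) * G j k p"
      using c by (simp add: mat_calc[where n = m])
    also have "\<dots> = (h j k (\<sigma> p) p * h i j (\<sigma> p) p) \<cdot>\<^sub>m S k p p"
      unfolding G_char[OF ij pt pW p] using c G_char[OF ij(2) k(1) pt pW p(2) k(2)]
      by (simp add: mat_calc[where n = m] smult_smult_mat mult_ac)
    also have "h j k (\<sigma> p) p * h i j (\<sigma> p) p = h i j k p * h i k (\<sigma> p) p"
      using h_coc[OF ij k(1) pJ(1) p k(2) pJ(2)] by (simp add: mult_ac)
    also have "(h i j k p * h i k (\<sigma> p) p) \<cdot>\<^sub>m S k p p = S i p p * (h i j k p \<cdot>\<^sub>m G i k p)"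
      using c G_char[OF ij(1) k(1) pt pW p(1) k(2)] by (simp add: mat_calc[where n = m] smult_smult_mat)
    finally show "G i j p * G j k p = h i j k p \<cdot>\<^sub>m G i k p"
      by (rule GL_cancel_left[OF S_GL[OF ij(1) pt pW p(1)] mult_mat_carrier[OF c(3) c(6)] smult_carrier[OF c(7)]])
  qed
  have "((m, \<lambda>x y. G (\<sigma> x) (\<sigma> y)), (m, g)) \<in> R.bundle_iso"
  \<comment> \<open>The sign makes up for the repeated indices in the values of \<open>h\<close> that occur here.\<close>
  proof (rule R.bundle_isoI[OF restrict_bundle[OF bG] b, where f = "\<lambda>x p. h\<sigma> x x x p \<cdot>\<^sub>m S (\<sigma> x) x p"])
    fix x assume x: "x \<in> topspace X"
    note sx = \<sigma>[OF x]
    have o: "openin X (V (\<sigma> x) \<inter> V (\<sigma> x) \<inter> V (\<sigma> x))" using V_open[OF sx] by simp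
    show "smooth.regular_GL (W x) m (\<lambda>p. h\<sigma> x x x p \<cdot>\<^sub>m S (\<sigma> x) x p)"
    proof (intro smooth.regular_GL_smult W_open[OF x])
      show "smooth_fun \<A> (W x) (h\<sigma> x x x)"
        by (rule smooth.subset[OF o W_open[OF x] h_smooth[OF sx sx sx]]) (use W_sub[OF x] in blast)
      have "W x \<inter> V (\<sigma> x) = W x" using W_sub[OF x] by blast
      then show "smooth.regular_GL (W x) m (S (\<sigma> x) x)" using S_smooth[OF sx x] by simp
      show "h\<sigma> x x x p \<noteq> 0" if "p \<in> W x" for p using h_nz[OF sx sx sx] W_V[OF x that] by blast
    qed
    fix y p assume y: "y \<in> topspace X" and p: "p \<in> W x" "p \<in> W y"
    note sy = \<sigma>[OF y] and pV = W_V[OF x p(1)] W_V[OF y p(2)]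
    note c = Sc[OF sx x p(1) pV(1)] Sc[OF sy x p(1) pV(2)] Sc[OF sy y p(2) pV(2)] Gc[OF sx sy pV]
      R.bundleD(3)[OF b x y p] ec[OF sy x y p pV(2)]
    note \<epsilon>x = h_sign[OF sx sy pV] and \<epsilon>y = h_sign[OF sy sx pV(2,1)]
    have "h\<sigma> x x x p \<cdot>\<^sub>m S (\<sigma> x) x p * G (\<sigma> x) (\<sigma> y) p = (h\<sigma> x x x p * h\<sigma> x x x p) \<cdot>\<^sub>m S (\<sigma> y) x p"
      using c G_char[OF sx sy x p(1) pV] \<epsilon>x(1) by (simp add: mat_calc[where n = m] smult_smult_mat)
    also have "\<dots> = S (\<sigma> y) x p" using \<epsilon>x(2) by (simp add: smult_one_mat)
    also have "\<dots> = inverse (h\<sigma> y x y p) \<cdot>\<^sub>m (g x y p * S (\<sigma> y) y p)"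
      using S_e[OF sy x y p pV(2)] c by (simp add: e_def mat_calc[where n = m])
    also have "inverse (h\<sigma> y x y p) = h\<sigma> y y y p"
      using \<epsilon>y inverse_unique[OF \<epsilon>y(2)] by simp
    also have "h\<sigma> y y y p \<cdot>\<^sub>m (g x y p * S (\<sigma> y) y p) = g x y p * (h\<sigma> y y y p \<cdot>\<^sub>m S (\<sigma> y) y p)"
      using c by (simp add: mat_calc[where n = m])
    finally show "h\<sigma> x x x p \<cdot>\<^sub>m S (\<sigma> x) x p * G (\<sigma> x) (\<sigma> y) p = g x y p * (h\<sigma> y y y p \<cdot>\<^sub>m S (\<sigma> y) y p)" .
  qed
  then show ?thesis using bG by blast
qed

lemma mult_iso_refinement: "mult_iso bundle_monoid R.bundle_monoid"
proof (rule mult_iso_bundle_monoid[OF refined_twist, where F = "\<lambda>g x y. g (\<sigma> x) (\<sigma> y)"])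
  fix m g assume b: "(m, g) \<in> bundles"
  show "(m, \<lambda>x y. g (\<sigma> x) (\<sigma> y)) \<in> R.bundles" by (rule restrict_bundle[OF b])
  fix m' g' assume b': "(m', g') \<in> bundles"
  show "((m, g), (m', g')) \<in> bundle_iso \<longleftrightarrow> ((m, \<lambda>x y. g (\<sigma> x) (\<sigma> y)), (m', \<lambda>x y. g' (\<sigma> x) (\<sigma> y))) \<in> R.bundle_iso"
  proof
    assume "((m, g), (m', g')) \<in> bundle_iso"
    then obtain f where f: "m' = m" "(m, g) \<in> bundles" "(m, g') \<in> bundles" "bundle_map m g g' f"
      by (rule bundle_isoE)
    note f = f(1-3) bundle_mapD[OF f(4)]
    show "((m, \<lambda>x y. g (\<sigma> x) (\<sigma> y)), (m', \<lambda>x y. g' (\<sigma> x) (\<sigma> y))) \<in> R.bundle_iso"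
      unfolding f(1)
    proof (rule R.bundle_isoI[OF restrict_bundle[OF f(2)] restrict_bundle[OF f(3)], where f = "\<lambda>x. f (\<sigma> x)"])
      fix x assume x: "x \<in> topspace X"
      show "smooth.regular_GL (W x) m (f (\<sigma> x))"
        by (rule smooth.regular_GL_subset[OF V_open[OF \<sigma>[OF x]] W_open[OF x] f(4)[OF \<sigma>[OF x]] W_sub[OF x]])
      fix y p assume y: "y \<in> topspace X" and p: "p \<in> W x" "p \<in> W y"
      show "f (\<sigma> x) p * g (\<sigma> x) (\<sigma> y) p = g' (\<sigma> x) (\<sigma> y) p * f (\<sigma> y) p"
        by (rule f(6)[OF \<sigma>[OF x] \<sigma>[OF y] W_V[OF x p(1)] W_V[OF y p(2)]])
    qed
  next
    assume "((m, \<lambda>x y. g (\<sigma> x) (\<sigma> y)), (m', \<lambda>x y. g' (\<sigma> x) (\<sigma> y))) \<in> R.bundle_iso"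
    then obtain f where f: "m' = m" "R.bundle_map m (\<lambda>x y. g (\<sigma> x) (\<sigma> y)) (\<lambda>x y. g' (\<sigma> x) (\<sigma> y)) f"
      by (rule R.bundle_isoE)
    show "((m, g), (m', g')) \<in> bundle_iso"
      unfolding f(1) by (rule extend_iso[OF b b'[unfolded f(1)] f(2)])
  qed
  show "((m + m', \<lambda>x y xa. block_sum m m' (g (\<sigma> x) (\<sigma> y) xa) (g' (\<sigma> x) (\<sigma> y) xa)),
      (m + m', \<lambda>i j x. block_sum m m' (g (\<sigma> i) (\<sigma> j) x) (g' (\<sigma> i) (\<sigma> j) x))) \<in> R.bundle_iso"
    by (rule R.bundle_iso_refl[OF restrict_bundle[OF bundle_sum[OF b b']]])
next
  fix m g assume "(m, g) \<in> R.bundles"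
  then show "\<exists>G. (m, G) \<in> bundles \<and> ((m, \<lambda>x y. G (\<sigma> x) (\<sigma> y)), (m, g)) \<in> R.bundle_iso"
    by (rule extend_bundle)
qed

end

section \<open>Bundles over the groupoid of a cover\<close>

text \<open>Since \<open>F\<close> reflects membership and the relation, \<open>E1\<close> is an equivalence relation compatible with sums
  because \<open>E2\<close> is.\<close>

lemma mult_iso_quot_transport:
  assumes E1: "E1 \<subseteq> B1 \<times> B1" and E2: "equiv B2 E2"
    and f2: "\<And>a b. a \<in> B2 \<Longrightarrow> b \<in> B2 \<Longrightarrow> f2 a b \<in> B2"
      "\<And>a a' b b'. (a, a') \<in> E2 \<Longrightarrow> (b, b') \<in> E2 \<Longrightarrow> (f2 a b, f2 a' b') \<in> E2"
    and F: "\<And>a. a \<in> B1 \<longleftrightarrow> F a \<in> B2"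
    and full: "\<And>a b. a \<in> B1 \<Longrightarrow> b \<in> B1 \<Longrightarrow> (a, b) \<in> E1 \<longleftrightarrow> (F a, F b) \<in> E2"
    and surj: "\<And>c. c \<in> B2 \<Longrightarrow> \<exists>a. F a = c"
    and sum: "\<And>a b. a \<in> B1 \<Longrightarrow> b \<in> B1 \<Longrightarrow> (F (f1 a b), f2 (F a) (F b)) \<in> E2"
  shows "mult_iso (quot_monoid B1 E1 f1 z1) (quot_monoid B2 E2 f2 z2)"
proof (rule mult_iso_quot[OF _ E2, where F = F])
  have r2: "(c, c) \<in> E2" if "c \<in> B2" for c using E2 that by (auto simp: equiv_def refl_on_def)
  have E1D: "a \<in> B1" "b \<in> B1" "(F a, F b) \<in> E2" if "(a, b) \<in> E1" for a b
    using that E1 full by blast+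
  show "equiv B1 E1"
  proof (rule equivI[OF E1])
    show "refl_on B1 E1" unfolding refl_on_def using full F r2 by blast
    show "sym E1"
    proof (rule symI)
      fix a b assume ab: "(a, b) \<in> E1"
      then have "(F b, F a) \<in> E2" using E1D(3) E2 by (blast elim: equivE dest: symD)
      then show "(b, a) \<in> E1" using full E1D[OF ab] by blast
    qed
    show "trans E1"
    proof (rule transI)
      fix a b c assume ab: "(a, b) \<in> E1" "(b, c) \<in> E1"
      then have "(F a, F c) \<in> E2" using E1D(3) E2 by (blast elim: equivE dest: transD)
      then show "(a, c) \<in> E1" using full E1D[OF ab(1)] E1D[OF ab(2)] by blast
    qed
  qed
  have E2B: "E2 \<subseteq> B2 \<times> B2" and sym2: "sym E2" and trans2: "trans E2" using E2 by (auto simp: equiv_def)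
  show cl: "f1 a b \<in> B1" if "a \<in> B1" "b \<in> B1" for a b
    using sum[OF that] E2B F by blast
  show "(f1 a b, f1 a' b') \<in> E1" if "(a, a') \<in> E1" "(b, b') \<in> E1" for a a' b b'
  proof -
    note a = E1D[OF that(1)] and b = E1D[OF that(2)]
    have "(F (f1 a b), f2 (F a') (F b')) \<in> E2"
      by (rule transD[OF trans2 sum[OF a(1) b(1)] f2(2)[OF a(3) b(3)]])
    then have "(F (f1 a b), F (f1 a' b')) \<in> E2"
      by (rule transD[OF trans2 _ symD[OF sym2 sum[OF a(2) b(2)]]])
    then show ?thesis using full[OF cl[OF a(1) b(1)] cl[OF a(2) b(2)]] by blast
  qed
  show "\<exists>a\<in>B1. (F a, c) \<in> E2" if c: "c \<in> B2" for c
  proof -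
    obtain a where a: "F a = c" using surj[OF c] by blast
    then show ?thesis using F[of a] r2[OF c] c by (intro bexI[of _ a]) auto
  qed
qed (use f2(2) F full sum in blast)+

lemma (in twist) bundle_cong:
  assumes b: "(m, g) \<in> bundles"
    and eq: "\<And>i j p. i \<in> J \<Longrightarrow> j \<in> J \<Longrightarrow> p \<in> V i \<Longrightarrow> p \<in> V j \<Longrightarrow> g' i j p = g i j p"
  shows "((m, g'), (m, g)) \<in> bundle_iso"
proof -
  have b': "(m, g') \<in> bundles"
  proof (rule bundleI)
    show "smooth.regular_GL (V i \<inter> V j) m (g' i j)" if "i \<in> J" "j \<in> J" for i j
      by (rule smooth.regular_GL_cong[OF V2_open[OF that] bundleD(1)[OF b that]]) (use eq that in auto)
  qed (use bundleD(4,5)[OF b] eq in simp_all)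
  show ?thesis
  proof (rule bundle_isoI[OF b' b, where f = "\<lambda>i p. 1\<^sub>m m"])
    show "smooth.regular_GL (V i) m (\<lambda>_. 1\<^sub>m m)" if "i \<in> J" for i
      using that by (intro smooth.regular_GL_const V_open GL_one)
    show "1\<^sub>m m * g' i j p = g i j p * 1\<^sub>m m" if "i \<in> J" "j \<in> J" "p \<in> V i" "p \<in> V j" for i j p
      using bundleD(3)[OF b that] eq[OF that] by simp
  qed
qed

text \<open>The two kinds of transition matrices compose in opposite orders. Transposition reverses the order and,
  unlike inversion, leaves the twisting as it is.\<close>

lemma gpd_mult_iso:
  fixes X :: "'a topology" and \<A> :: "('a set \<times> ('a \<Rightarrow> 'e::real_inner)) set" and I :: "'i set" and U :: "'i \<Rightarrow> 'a set"
    and \<theta> :: "'i \<times> 'i \<times> 'a \<Rightarrow> 'i \<times> 'i \<times> 'a \<Rightarrow> complex"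
  assumes tw: "twist X \<A> I U (\<lambda>i j k x. \<theta> (i, j, x) (j, k, x))"
  shows "mult_iso (quot_monoid (gpd_twisted_bundles \<A> I U \<theta>) (gpd_twisted_iso \<A> I U \<theta>)
        (\<lambda>(n, \<rho>) (m, \<sigma>). (n + m, \<lambda>r. block_sum n m (\<rho> r) (\<sigma> r))) (0, \<lambda>r. 1\<^sub>m 0))
      (twist.bundle_monoid \<A> I U (\<lambda>i j k x. \<theta> (i, j, x) (j, k, x)))"
proof -
  interpret T: twist X \<A> I U "\<lambda>i j k x. \<theta> (i, j, x) (j, k, x)" by (rule tw)
  define F :: "nat \<times> ('i \<times> 'i \<times> 'a \<Rightarrow> complex mat) \<Rightarrow> nat \<times> ('i \<Rightarrow> 'i \<Rightarrow> 'a \<Rightarrow> complex mat)"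
    where "F = (\<lambda>(n, \<rho>). (n, \<lambda>i j x. (\<rho> (i, j, x))\<^sup>T))"
  have reg: "smooth_GL \<A> (U i \<inter> U j) n (\<lambda>x. \<rho> (i, j, x)) \<longleftrightarrow> T.smooth.regular_GL (U i \<inter> U j) n (\<lambda>x. (\<rho> (i, j, x))\<^sup>T)"
    if "i \<in> I" "j \<in> I" for i j n and \<rho> :: "'i \<times> 'i \<times> 'a \<Rightarrow> complex mat"
    using T.smooth.regular_GL_transpose[OF T.V2_open[OF that], of n "\<lambda>x. \<rho> (i, j, x)"]
      T.smooth.regular_GL_transpose[OF T.V2_open[OF that], of n "\<lambda>x. (\<rho> (i, j, x))\<^sup>T"]
    by (auto simp: T.smooth_GL_eq)
  have mem: "(n, \<rho>) \<in> gpd_twisted_bundles \<A> I U \<theta> \<longleftrightarrow> F (n, \<rho>) \<in> T.bundles" for n \<rho>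
  proof
    assume "(n, \<rho>) \<in> gpd_twisted_bundles \<A> I U \<theta>"
    then have b: "\<forall>i\<in>I. \<forall>j\<in>I. smooth_GL \<A> (U i \<inter> U j) n (\<lambda>x. \<rho> (i, j, x))"
      "\<forall>r\<in>gpd_arrows I U. \<rho> r * \<rho> (gpd_inv r) = 1\<^sub>m n"
      "\<forall>(r, r')\<in>gpd_composable I U. \<rho> r' * \<rho> r = \<theta> r r' \<cdot>\<^sub>m \<rho> (gpd_mult r r')"
      unfolding gpd_twisted_bundles_def by auto
    have c: "\<rho> (i, j, p) \<in> carrier_mat n n" if "i \<in> I" "j \<in> I" "p \<in> U i" "p \<in> U j" for i j p
      using b(1) that unfolding T.smooth_GL_eq using T.smooth.regular_GLD(1) GL_carrier by blast
    show "F (n, \<rho>) \<in> T.bundles"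
      unfolding F_def prod.case
    proof (rule T.bundleI)
      show "T.smooth.regular_GL (U i \<inter> U j) n (\<lambda>x. (\<rho> (i, j, x))\<^sup>T)" if "i \<in> I" "j \<in> I" for i j
        using b(1) reg[OF that] that by blast
      show "(\<rho> (i, j, p))\<^sup>T * (\<rho> (j, i, p))\<^sup>T = 1\<^sub>m n" if a: "i \<in> I" "j \<in> I" "p \<in> U i" "p \<in> U j" for i j p
      proof -
        have "\<rho> (j, i, p) * \<rho> (i, j, p) = 1\<^sub>m n"
          using b(2)[rule_format, of "(j, i, p)"] a by (simp add: gpd_arrows_def)
        then show ?thesis using transpose_mult[OF c c, of j i p i j p] a by simp
      qed
      show "(\<rho> (i, j, p))\<^sup>T * (\<rho> (j, k, p))\<^sup>T = \<theta> (i, j, p) (j, k, p) \<cdot>\<^sub>m (\<rho> (i, k, p))\<^sup>T"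
        if a: "i \<in> I" "j \<in> I" "k \<in> I" "p \<in> U i" "p \<in> U j" "p \<in> U k" for i j k p
      proof -
        have "((i, j, p), (j, k, p)) \<in> gpd_composable I U" using a by (simp add: gpd_composable_def gpd_arrows_def)
        then have "\<rho> (j, k, p) * \<rho> (i, j, p) = \<theta> (i, j, p) (j, k, p) \<cdot>\<^sub>m \<rho> (i, k, p)" using b(3) by force
        then show ?thesis using transpose_mult[OF c c, of j k p i j p] a by (simp add: transpose_smult)
      qed
    qed
  next
    assume "F (n, \<rho>) \<in> T.bundles"
    then have b: "(n, \<lambda>i j x. (\<rho> (i, j, x))\<^sup>T) \<in> T.bundles" by (simp add: F_def)
    note bD = T.bundleD[OF b]
    have c: "\<rho> (i, j, p) \<in> carrier_mat n n" if "i \<in> I" "j \<in> I" "p \<in> U i" "p \<in> U j" for i j p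
      using bD(3)[OF that] by simp
    show "(n, \<rho>) \<in> gpd_twisted_bundles \<A> I U \<theta>"
      unfolding gpd_twisted_bundles_def mem_Collect_eq prod.case
    proof (intro conjI ballI)
      show "smooth_GL \<A> (U i \<inter> U j) n (\<lambda>x. \<rho> (i, j, x))" if "i \<in> I" "j \<in> I" for i j
        using bD(1)[OF that] reg[OF that] by blast
      fix r assume "r \<in> gpd_arrows I U"
      then obtain i j p where r: "r = (i, j, p)" "i \<in> I" "j \<in> I" "p \<in> U i" "p \<in> U j"
        by (auto simp: gpd_arrows_def)
      have "(\<rho> (i, j, p) * \<rho> (j, i, p))\<^sup>T = (1\<^sub>m n)\<^sup>T"
        using transpose_mult[OF c c, of i j p j i p] bD(4)[OF r(3,2,5,4)] r by simp
      then have "\<rho> (i, j, p) * \<rho> (j, i, p) = 1\<^sub>m n" by (simp only: transpose_mat_eq)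
      then show "\<rho> r * \<rho> (gpd_inv r) = 1\<^sub>m n" by (simp add: r)
    next
      fix rr assume "rr \<in> gpd_composable I U"
      then obtain i j k p where rr: "rr = ((i, j, p), (j, k, p))" "i \<in> I" "j \<in> I" "k \<in> I" "p \<in> U i" "p \<in> U j" "p \<in> U k"
        by (auto simp: gpd_composable_def gpd_arrows_def)
      have "(\<rho> (j, k, p) * \<rho> (i, j, p))\<^sup>T = (\<theta> (i, j, p) (j, k, p) \<cdot>\<^sub>m \<rho> (i, k, p))\<^sup>T"
        using transpose_mult[OF c c, of j k p i j p] bD(5)[OF rr(2-7)] rr by (simp add: transpose_smult)
      then have "\<rho> (j, k, p) * \<rho> (i, j, p) = \<theta> (i, j, p) (j, k, p) \<cdot>\<^sub>m \<rho> (i, k, p)" by (simp only: transpose_mat_eq)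
      then show "case rr of (r, r') \<Rightarrow> \<rho> r' * \<rho> r = \<theta> r r' \<cdot>\<^sub>m \<rho> (gpd_mult r r')" by (simp add: rr)
    qed
  qed
  have swap: "(F (n, \<rho>'), F (n, \<rho>)) \<in> T.bundle_iso \<longleftrightarrow> ((n, \<rho>), (n, \<rho>')) \<in> gpd_twisted_iso \<A> I U \<theta>"
    if b: "(n, \<rho>) \<in> gpd_twisted_bundles \<A> I U \<theta>" and b': "(n, \<rho>') \<in> gpd_twisted_bundles \<A> I U \<theta>" for n \<rho> \<rho>'
  proof -
    note B = b[unfolded mem] b'[unfolded mem]
    note tb = B(1)[unfolded F_def prod.case] and tb' = B(2)[unfolded F_def prod.case]
    have c: "\<rho> (i, j, p) \<in> carrier_mat n n" "\<rho>' (i, j, p) \<in> carrier_mat n n" if "i \<in> I" "j \<in> I" "p \<in> U i" "p \<in> U j" for i j p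
      using T.bundleD(3)[OF tb that] T.bundleD(3)[OF tb' that] by simp_all
    show ?thesis
    proof
      assume "(F (n, \<rho>'), F (n, \<rho>)) \<in> T.bundle_iso"
      then have "((n, \<lambda>i j x. (\<rho>' (i, j, x))\<^sup>T), (n, \<lambda>i j x. (\<rho> (i, j, x))\<^sup>T)) \<in> T.bundle_iso" by (simp add: F_def)
      then obtain f where "T.bundle_map n (\<lambda>i j x. (\<rho>' (i, j, x))\<^sup>T) (\<lambda>i j x. (\<rho> (i, j, x))\<^sup>T) f"
        by (rule T.bundle_isoE)
      note f = T.bundle_mapD[OF this]
      show "((n, \<rho>), (n, \<rho>')) \<in> gpd_twisted_iso \<A> I U \<theta>"
        unfolding gpd_twisted_iso_def mem_Collect_eq prod.case
      proof (intro conjI b b' refl exI[of _ "\<lambda>(i, x). (f i x)\<^sup>T"] ballI)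
        show "smooth_GL \<A> (U i) n (\<lambda>x. case (i, x) of (i, x) \<Rightarrow> (f i x)\<^sup>T)" if i: "i \<in> I" for i
          unfolding T.smooth_GL_eq prod.case by (rule T.smooth.regular_GL_transpose[OF T.V_open[OF i] f(1)[OF i]])
        fix r assume "r \<in> gpd_arrows I U"
        then obtain i j p where r: "r = (i, j, p)" "i \<in> I" "j \<in> I" "p \<in> U i" "p \<in> U j"
          by (auto simp: gpd_arrows_def)
        note fc = GL_carrier[OF f(2)[OF r(2,4)]] GL_carrier[OF f(2)[OF r(3,5)]] and rc = c[OF r(2-5)]
        have "(f j p)\<^sup>T * \<rho> (i, j, p) = ((\<rho> (i, j, p))\<^sup>T * f j p)\<^sup>T"
          using transpose_mult[of "(\<rho> (i, j, p))\<^sup>T" n "f j p"] fc rc by simp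
        also have "\<dots> = (f i p * (\<rho>' (i, j, p))\<^sup>T)\<^sup>T" using f(3)[OF r(2-5)] by simp
        also have "\<dots> = \<rho>' (i, j, p) * (f i p)\<^sup>T"
          using transpose_mult[of "f i p" n "(\<rho>' (i, j, p))\<^sup>T"] fc rc by simp
        finally show "(case gpd_tgt r of (i, x) \<Rightarrow> (f i x)\<^sup>T) * \<rho> r = \<rho>' r * (case gpd_src r of (i, x) \<Rightarrow> (f i x)\<^sup>T)"
          by (simp add: r)
      qed
    next
      assume "((n, \<rho>), (n, \<rho>')) \<in> gpd_twisted_iso \<A> I U \<theta>"
      then obtain f where f: "\<forall>i\<in>I. smooth_GL \<A> (U i) n (\<lambda>x. f (i, x))"
        "\<forall>r\<in>gpd_arrows I U. f (gpd_tgt r) * \<rho> r = \<rho>' r * f (gpd_src r)"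
        unfolding gpd_twisted_iso_def by auto
      have fr: "T.smooth.regular_GL (U i) n (\<lambda>x. f (i, x))" if "i \<in> I" for i
        using f(1) that by (simp add: T.smooth_GL_eq)
      have "((n, \<lambda>i j x. (\<rho>' (i, j, x))\<^sup>T), (n, \<lambda>i j x. (\<rho> (i, j, x))\<^sup>T)) \<in> T.bundle_iso"
      proof (rule T.bundle_isoI[OF tb' tb, where f = "\<lambda>i x. (f (i, x))\<^sup>T"])
        show "T.smooth.regular_GL (U i) n (\<lambda>x. (f (i, x))\<^sup>T)" if i: "i \<in> I" for i
          by (rule T.smooth.regular_GL_transpose[OF T.V_open[OF i] fr[OF i]])
        fix i j p assume a: "i \<in> I" "j \<in> I" "p \<in> U i" "p \<in> U j"
        note fc = GL_carrier[OF T.smooth.regular_GLD(1)[OF fr[OF a(1)] a(3)]] GL_carrier[OF T.smooth.regular_GLD(1)[OF fr[OF a(2)] a(4)]]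
        have "f (j, p) * \<rho> (i, j, p) = \<rho>' (i, j, p) * f (i, p)"
          using f(2)[rule_format, of "(i, j, p)"] a by (simp add: gpd_arrows_def)
        then show "(f (i, p))\<^sup>T * (\<rho>' (i, j, p))\<^sup>T = (\<rho> (i, j, p))\<^sup>T * (f (j, p))\<^sup>T"
          using transpose_mult[OF fc(2) c(1)[OF a]] transpose_mult[OF c(2)[OF a] fc(1)] by simp
      qed
      then show "(F (n, \<rho>'), F (n, \<rho>)) \<in> T.bundle_iso" by (simp add: F_def)
    qed
  qed
  have rank: "n = n'" if "((n, g), (n', g')) \<in> T.bundle_iso \<or> ((n, \<rho>), (n', \<rho>')) \<in> gpd_twisted_iso \<A> I U \<theta>" for n n' g g' \<rho> \<rho>'
    using that by (auto simp: T.bundle_iso_iff gpd_twisted_iso_def)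
  show ?thesis
    unfolding T.bundle_monoid_def
  proof (rule mult_iso_quot_transport[where F = F, OF _ T.bundle_equiv])
    show "gpd_twisted_iso \<A> I U \<theta> \<subseteq> gpd_twisted_bundles \<A> I U \<theta> \<times> gpd_twisted_bundles \<A> I U \<theta>"
      by (auto simp: gpd_twisted_iso_def)
    show "a \<in> gpd_twisted_bundles \<A> I U \<theta> \<longleftrightarrow> F a \<in> T.bundles" for a
      by (cases a) (simp only: mem)
    show "(a, b) \<in> gpd_twisted_iso \<A> I U \<theta> \<longleftrightarrow> (F a, F b) \<in> T.bundle_iso"
      if ab: "a \<in> gpd_twisted_bundles \<A> I U \<theta>" "b \<in> gpd_twisted_bundles \<A> I U \<theta>" for a b
    proof -
      obtain n \<rho> n' \<rho>' where e: "a = (n, \<rho>)" "b = (n', \<rho>')" by (cases a; cases b) auto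
      show ?thesis
      proof (cases "n = n'")
        case True
        have "(F b, F a) \<in> T.bundle_iso \<longleftrightarrow> (F a, F b) \<in> T.bundle_iso"
          using T.bundle_equiv by (blast elim: equivE dest: symD)
        then show ?thesis using swap[OF ab[unfolded e, folded True]] by (simp add: e True)
      next
        case False
        then show ?thesis using rank[of n _ n'] unfolding e F_def prod.case by blast
      qed
    qed
    show "\<exists>a. F a = c" if "c \<in> T.bundles" for c
      by (rule exI[of _ "(fst c, \<lambda>(i, j, x). (snd c i j x)\<^sup>T)"]) (simp add: F_def)
    show "(F ((\<lambda>(n, \<rho>) (m, \<sigma>). (n + m, \<lambda>r. block_sum n m (\<rho> r) (\<sigma> r))) a b),
        (\<lambda>(m, g) (m', g'). (m + m', \<lambda>i j x. block_sum m m' (g i j x) (g' i j x))) (F a) (F b)) \<in> T.bundle_iso"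
      if ab: "a \<in> gpd_twisted_bundles \<A> I U \<theta>" "b \<in> gpd_twisted_bundles \<A> I U \<theta>" for a b
    proof -
      obtain n \<rho> m \<sigma> where e: "a = (n, \<rho>)" "b = (m, \<sigma>)" by (cases a; cases b) auto
      note tb = ab[unfolded e mem F_def prod.case]
      show ?thesis
        unfolding e F_def prod.case
      proof (rule T.bundle_cong[OF T.bundle_sum[OF tb]])
        fix i j p assume a: "i \<in> I" "j \<in> I" "p \<in> U i" "p \<in> U j"
        have "\<rho> (i, j, p) \<in> carrier_mat n n" "\<sigma> (i, j, p) \<in> carrier_mat m m"
          using T.bundleD(3)[OF tb(1) a] T.bundleD(3)[OF tb(2) a] by simp_all
        then show "(block_sum n m (\<rho> (i, j, p)) (\<sigma> (i, j, p)))\<^sup>T = block_sum n m (\<rho> (i, j, p))\<^sup>T (\<sigma> (i, j, p))\<^sup>T"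
          by (rule block_sum_transpose)
      qed
    qed
  qed (use T.bundle_sum T.bundle_sum_iso in \<open>auto split: prod.splits\<close>)
qed

section \<open>Comparison of the twistings\<close>

text \<open>The sheaf of smooth functions is fine: averaging a cocycle over its first index bounds it.\<close>

lemma (in smooth_mfd) smooth_cocycle_coboundary:
  assumes W: "\<And>x. x \<in> topspace X \<Longrightarrow> openin X (W x)" "\<And>x. x \<in> topspace X \<Longrightarrow> x \<in> W x"
    and c_smooth: "\<And>x y z. x \<in> topspace X \<Longrightarrow> y \<in> topspace X \<Longrightarrow> z \<in> topspace X \<Longrightarrow>
      smooth_fun \<A> (W x \<inter> W y \<inter> W z) (c x y z)"
    and cocycle: "\<And>w x y z p. w \<in> topspace X \<Longrightarrow> x \<in> topspace X \<Longrightarrow> y \<in> topspace X \<Longrightarrow> z \<in> topspace X \<Longrightarrow>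
      p \<in> W w \<Longrightarrow> p \<in> W x \<Longrightarrow> p \<in> W y \<Longrightarrow> p \<in> W z \<Longrightarrow> c x y z p - c w y z p + c w x z p - c w x y p = 0"
  shows "\<exists>\<mu>. (\<forall>x\<in>topspace X. \<forall>y\<in>topspace X. smooth_fun \<A> (W x \<inter> W y) (\<mu> x y)) \<and>
    (\<forall>x\<in>topspace X. \<forall>y\<in>topspace X. \<forall>z\<in>topspace X. \<forall>p\<in>W x \<inter> W y \<inter> W z.
       c x y z p = \<mu> y z p - \<mu> x z p + \<mu> x y p)"
proof (cases "topspace X = {}")
  case False
  obtain q \<eta> S where pu: "partition_of_unity X (topspace X) W q \<eta> S"
    "\<And>k. smooth_fun \<A> (topspace X) (\<lambda>x. complex_of_real (\<eta> k x))"
    using partition_of_unity_exists[OF openin_topspace False W] by metis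
  note pu' = partition_of_unityD[OF pu(1)]
  define \<mu> where "\<mu> = (\<lambda>x y. weighted_sum \<eta> (\<lambda>k. c (q k) x y))"
  have \<mu>: "smooth_fun \<A> (W x \<inter> W y) (\<mu> x y)" if xy: "x \<in> topspace X" "y \<in> topspace X" for x y
    unfolding \<mu>_def
  proof (rule smooth.weighted_sum[OF pu openin_topspace W(1)])
    show o: "openin X (W x \<inter> W y)" using W(1) xy by blast
    then show "W x \<inter> W y \<subseteq> topspace X" by (rule openin_subset)
    show "smooth_fun \<A> (W x \<inter> W y \<inter> W (q k)) (c (q k) x y)" for k
      using c_smooth[OF pu'(1)[of k] xy] by (simp add: Int_ac)
  qed
  have "c x y z p = \<mu> y z p - \<mu> x z p + \<mu> x y p"
    if a: "x \<in> topspace X" "y \<in> topspace X" "z \<in> topspace X" "p \<in> W x" "p \<in> W y" "p \<in> W z" for x y z p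
  proof -
    have pt: "p \<in> topspace X" using openin_subset[OF W(1)[OF a(1)]] a(4) by blast
    have "\<mu> y z p - \<mu> x z p + \<mu> x y p =
        weighted_sum \<eta> (\<lambda>k p. c (q k) y z p - c (q k) x z p + c (q k) x y p) p"
      by (simp add: \<mu>_def weighted_sum_add weighted_sum_diff)
    also have "\<dots> = c x y z p"
    proof (rule weighted_sum_const[OF pu(1) pt])
      fix k assume "\<eta> k p \<noteq> 0"
      then have "p \<in> W (q k)" using pu'(3,5) pt by blast
      then show "c (q k) y z p - c (q k) x z p + c (q k) x y p = c x y z p"
        using cocycle[OF pu'(1) a(1-3) _ a(4-6)] by (simp add: algebra_simps)
    qed
    finally show ?thesis by simp
  qed
  then show ?thesis using \<mu> by (intro exI[of _ \<mu>]) blast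
qed auto

text \<open>The function \<open>l\<close> is automatically antisymmetric: \<open>l i j * l j i\<close> is the product of \<open>l i i\<close> and of the ratio of
  the two cocycles at \<open>i, j, i\<close>, and both of these are the sign that the ratio has at \<open>i, i, i\<close>.\<close>

lemma scaling_of_coboundary:
  assumes 1: "twist X \<A> J V h" and 2: "twist X \<A> J V h'"
    and l: "\<And>i j. i \<in> J \<Longrightarrow> j \<in> J \<Longrightarrow> smooth_fun \<A> (V i \<inter> V j) (l i j)" "\<And>i j p. l i j p \<noteq> 0"
    and h': "\<And>i j k p. i \<in> J \<Longrightarrow> j \<in> J \<Longrightarrow> k \<in> J \<Longrightarrow> p \<in> V i \<Longrightarrow> p \<in> V j \<Longrightarrow> p \<in> V k \<Longrightarrow>
      h' i j k p = l i j p * l j k p / l i k p * h i j k p"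
  shows "scaling X \<A> J V h h' l"
proof -
  interpret A: twist X \<A> J V h by (rule 1)
  interpret B: twist X \<A> J V h' by (rule 2)
  have anti: "l i j p * l j i p = 1" if a: "i \<in> J" "j \<in> J" "p \<in> V i" "p \<in> V j" for i j p
  proof -
    note nz = A.h_nz[OF a(1) a(1) a(1) a(3) a(3) a(3)] l(2)[of i i p]
    have ii: "h' i i i p = l i i p * h i i i p"
      using h'[OF a(1) a(1) a(1) a(3) a(3) a(3)] nz by simp
    have "h' i j i p = l i j p * l j i p / l i i p * h i j i p" by (rule h'[OF a(1,2,1,3,4,3)])
    then have "l i j p * l j i p * h i i i p = l i i p * (l i i p * h i i i p)"
      using A.h_sign(1)[OF a] B.h_sign(1)[OF a] ii nz by (simp add: field_simps)
    moreover have "l i i p * l i i p = 1"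
      using A.h_sign(2)[OF a] B.h_sign(2)[OF a] unfolding ii by (simp add: mult_ac)
    ultimately show ?thesis using nz by (simp add: mult.assoc[symmetric])
  qed
  show ?thesis
  proof
    fix i j k p assume a: "i \<in> J" "j \<in> J" "k \<in> J" "p \<in> V i" "p \<in> V j" "p \<in> V k"
    have "l k i p = inverse (l i k p)" using anti[OF a(1,3,4,6)] by (simp add: inverse_unique)
    then show "h' i j k p = l i j p * l j k p * l k i p * h i j k p"
      using h'[OF a] by (simp add: divide_inverse mult_ac)
  qed (use l anti in auto)
qed

lemma coboundary3:
  "coboundary c [w, x, y, z] p = c [x, y, z] p - c [w, y, z] p + c [w, x, z] p - c [w, x, y] p"
  by (simp add: coboundary_def eval_nat_numeral lessThan_Suc)

lemma locally_constant_compose: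
  "locally_constant X S f \<Longrightarrow> locally_constant X S (\<lambda>x. g (f x))"
  unfolding locally_constant_def
  using continuous_map_compose[of "subtopology X S" "discrete_topology UNIV" f "discrete_topology UNIV" g]
  by (simp add: o_def)

text \<open>A member of the class serves as the common integral representative to which the cocycles of both twistings
  are compared.\<close>

lemma cech_H3_nonempty:
  assumes "H \<in> carrier (cech_H3 X)"
  shows "H \<noteq> {}"
proof -
  obtain z where z: "z \<in> int_cocycles3 X" "H = int_cohomologous3 X `` {z}"
    using assms by (auto simp: cech_H3_def quot_monoid_def quotient_def)
  obtain W c where Wc: "z = (W, c)" by (cases z)
  have W: "pointed_cover X W" using z(1) by (simp add: Wc int_cocycles3_def)
  have "((W, c), (W, c)) \<in> int_cohomologous3 X"
    unfolding int_cohomologous3_def mem_Collect_eq prod.case using z(1) W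
    by (intro conjI exI[of _ W] exI[of _ "\<lambda>s x. 0"])
      (auto simp: Wc cech_cochain_def locally_constant_def coboundary_def)
  then show ?thesis using z(2) Wc by blast
qed

text \<open>What a connecting image provides on a pointed refinement: a lift \<open>f\<close> of the multiplicative cocycle whose
  coboundary is, up to the coboundary of an integral cochain \<open>b\<close>, the given representative \<open>c\<close> of the class.\<close>

definition connecting_lift ::
    "'a topology \<Rightarrow> ('a set \<Rightarrow> ('a \<Rightarrow> complex) \<Rightarrow> bool) \<Rightarrow> 'i set \<Rightarrow> ('i \<Rightarrow> 'a set) \<Rightarrow>
     ('i \<Rightarrow> 'i \<Rightarrow> 'i \<Rightarrow> 'a \<Rightarrow> complex) \<Rightarrow> ('a list \<Rightarrow> 'a \<Rightarrow> int) \<Rightarrow> ('a \<Rightarrow> 'i) \<Rightarrow> ('a \<Rightarrow> 'a set) \<Rightarrow>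
     ('a \<Rightarrow> 'a \<Rightarrow> 'a \<Rightarrow> 'a \<Rightarrow> complex) \<Rightarrow> ('a \<Rightarrow> 'a \<Rightarrow> 'a \<Rightarrow> 'a \<Rightarrow> int) \<Rightarrow> bool" where
  "connecting_lift X P I U \<theta> c \<tau> W f b \<longleftrightarrow>
     (\<forall>x\<in>topspace X. \<tau> x \<in> I \<and> openin X (W x) \<and> x \<in> W x \<and> W x \<subseteq> U (\<tau> x)) \<and>
     (\<forall>x\<in>topspace X. \<forall>y\<in>topspace X. \<forall>z\<in>topspace X.
        P (U (\<tau> x) \<inter> U (\<tau> y) \<inter> U (\<tau> z)) (f x y z) \<and> locally_constant X (W x \<inter> W y \<inter> W z) (b x y z) \<and>
        (\<forall>p\<in>W x \<inter> W y \<inter> W z. exp (2 * pi * \<i> * f x y z p) = \<theta> (\<tau> x) (\<tau> y) (\<tau> z) p)) \<and>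
     (\<forall>w\<in>topspace X. \<forall>x\<in>topspace X. \<forall>y\<in>topspace X. \<forall>z\<in>topspace X. \<forall>p\<in>W w \<inter> W x \<inter> W y \<inter> W z.
        f x y z p - f w y z p + f w x z p - f w x y p =
        of_int (c [w, x, y, z] p) + (of_int (b x y z p) - of_int (b w y z p) + of_int (b w x z p) - of_int (b w x y p)))"

lemma connecting_liftD:
  assumes "connecting_lift X P I U \<theta> c \<tau> W f b"
  shows "x \<in> topspace X \<Longrightarrow> \<tau> x \<in> I" "x \<in> topspace X \<Longrightarrow> openin X (W x)"
    "x \<in> topspace X \<Longrightarrow> x \<in> W x" "x \<in> topspace X \<Longrightarrow> W x \<subseteq> U (\<tau> x)"
    "x \<in> topspace X \<Longrightarrow> y \<in> topspace X \<Longrightarrow> z \<in> topspace X \<Longrightarrow> P (U (\<tau> x) \<inter> U (\<tau> y) \<inter> U (\<tau> z)) (f x y z)"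
    "x \<in> topspace X \<Longrightarrow> y \<in> topspace X \<Longrightarrow> z \<in> topspace X \<Longrightarrow> locally_constant X (W x \<inter> W y \<inter> W z) (b x y z)"
    "x \<in> topspace X \<Longrightarrow> y \<in> topspace X \<Longrightarrow> z \<in> topspace X \<Longrightarrow> p \<in> W x \<Longrightarrow> p \<in> W y \<Longrightarrow> p \<in> W z \<Longrightarrow>
       exp (2 * pi * \<i> * f x y z p) = \<theta> (\<tau> x) (\<tau> y) (\<tau> z) p"
    "w \<in> topspace X \<Longrightarrow> x \<in> topspace X \<Longrightarrow> y \<in> topspace X \<Longrightarrow> z \<in> topspace X \<Longrightarrow>
       p \<in> W w \<Longrightarrow> p \<in> W x \<Longrightarrow> p \<in> W y \<Longrightarrow> p \<in> W z \<Longrightarrow>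
       f x y z p - f w y z p + f w x z p - f w x y p =
       of_int (c [w, x, y, z] p) + (of_int (b x y z p) - of_int (b w y z p) + of_int (b w x z p) - of_int (b w x y p))"
  using assms unfolding connecting_lift_def by simp_all

lemma connecting_image_lift:
  assumes ci: "connecting_image X P I U \<theta> H" and cover: "(\<Union>i\<in>I. U i) = topspace X"
    and H: "(W', c') \<in> H"
  shows "\<exists>\<tau> W f b. connecting_lift X P I U \<theta> c' \<tau> W f b"
proof -
  obtain f c where f: "cech_cochain I U P 2 f"
    "\<forall>i\<in>I. \<forall>j\<in>I. \<forall>k\<in>I. \<forall>x\<in>U i \<inter> U j \<inter> U k. exp (2 * pi * \<i> * f [i, j, k] x) = \<theta> i j k x"
    "\<forall>s\<in>lists I. length s = 4 \<longrightarrow> (\<forall>x\<in>overlap U s. complex_of_int (c s x) = coboundary f s x)"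
    "H = cech_class3 X I U c"
    using ci unfolding connecting_image_def by blast
  define \<tau> where "\<tau> = (SOME \<tau>. \<forall>x\<in>topspace X. \<tau> x \<in> I \<and> x \<in> U (\<tau> x))"
  have "\<forall>x\<in>topspace X. \<exists>i. i \<in> I \<and> x \<in> U i" using cover by blast
  then have "\<exists>\<tau>. \<forall>x\<in>topspace X. \<tau> x \<in> I \<and> x \<in> U (\<tau> x)" by (rule bchoice)
  then have \<tau>: "\<forall>x\<in>topspace X. \<tau> x \<in> I \<and> x \<in> U (\<tau> x)" unfolding \<tau>_def by (rule someI_ex)
  have "H = int_cohomologous3 X `` {(\<lambda>x. U (\<tau> x), \<lambda>s. c (map \<tau> s))}"
    using f(4) by (simp only: cech_class3_def Let_def \<tau>_def)
  then have "((\<lambda>x. U (\<tau> x), \<lambda>s. c (map \<tau> s)), (W', c')) \<in> int_cohomologous3 X" using H by simp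
  then obtain W b where W: "pointed_cover X W" "\<forall>x\<in>topspace X. W x \<subseteq> U (\<tau> x) \<inter> W' x"
    and b: "cech_cochain (topspace X) W (locally_constant X) 2 b"
    and cb: "\<forall>s\<in>lists (topspace X). length s = 4 \<longrightarrow>
      (\<forall>x\<in>overlap W s. c (map \<tau> s) x - c' s x = coboundary b s x)"
    unfolding int_cohomologous3_def by auto
  have ov: "overlap C [x, y, z] = C x \<inter> C y \<inter> C z" for C :: "'k \<Rightarrow> 'a set" and x y z
    by (auto simp: overlap_def)
  have "connecting_lift X P I U \<theta> c' \<tau> W (\<lambda>x y z. f [\<tau> x, \<tau> y, \<tau> z]) (\<lambda>x y z. b [x, y, z])"
    unfolding connecting_lift_def
  proof (intro conjI ballI)
    fix x assume x: "x \<in> topspace X"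
    show "\<tau> x \<in> I" "openin X (W x)" "x \<in> W x" "W x \<subseteq> U (\<tau> x)"
      using x \<tau> W by (auto simp: pointed_cover_def)
    fix y z assume yz: "y \<in> topspace X" "z \<in> topspace X"
    show "P (U (\<tau> x) \<inter> U (\<tau> y) \<inter> U (\<tau> z)) (f [\<tau> x, \<tau> y, \<tau> z])"
      using f(1)[unfolded cech_cochain_def, rule_format, of "[\<tau> x, \<tau> y, \<tau> z]"] x yz \<tau> by (simp add: ov)
    show "locally_constant X (W x \<inter> W y \<inter> W z) (b [x, y, z])"
      using b[unfolded cech_cochain_def, rule_format, of "[x, y, z]"] x yz by (simp add: ov)
    fix p assume p: "p \<in> W x \<inter> W y \<inter> W z"
    then have "p \<in> U (\<tau> x) \<inter> U (\<tau> y) \<inter> U (\<tau> z)" using W(2) x yz by blast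
    then show "exp (2 * pi * \<i> * f [\<tau> x, \<tau> y, \<tau> z] p) = \<theta> (\<tau> x) (\<tau> y) (\<tau> z) p"
      using f(2) x yz \<tau> by blast
  next
    fix w x y z p assume t: "w \<in> topspace X" "x \<in> topspace X" "y \<in> topspace X" "z \<in> topspace X"
      and p: "p \<in> W w \<inter> W x \<inter> W y \<inter> W z"
    then have pU: "p \<in> U (\<tau> w)" "p \<in> U (\<tau> x)" "p \<in> U (\<tau> y)" "p \<in> U (\<tau> z)" using W(2) by blast+
    have 1: "c (map \<tau> [w, x, y, z]) p - c' [w, x, y, z] p = coboundary b [w, x, y, z] p"
      using cb[rule_format, of "[w, x, y, z]" p] t p by (simp add: overlap_def)
    have 2: "complex_of_int (c (map \<tau> [w, x, y, z]) p) = coboundary f (map \<tau> [w, x, y, z]) p"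
      using f(3)[rule_format, of "map \<tau> [w, x, y, z]" p] t pU \<tau> by (simp add: overlap_def)
    have "coboundary f (map \<tau> [w, x, y, z]) p = of_int (c' [w, x, y, z] p + coboundary b [w, x, y, z] p)"
      unfolding 2[symmetric] 1[symmetric] by simp
    then show "f [\<tau> x, \<tau> y, \<tau> z] p - f [\<tau> w, \<tau> y, \<tau> z] p + f [\<tau> w, \<tau> x, \<tau> z] p - f [\<tau> w, \<tau> x, \<tau> y] p =
       of_int (c' [w, x, y, z] p) + (of_int (b [x, y, z] p) - of_int (b [w, y, z] p) + of_int (b [w, x, z] p) - of_int (b [w, x, y] p))"
      by (simp add: coboundary3)
  qed
  then show ?thesis by blast
qed

lemma (in smooth_mfd) gerbe_twist:
  assumes cover: "leray_cover X I U" and g: "gerbe \<A> I U \<theta>"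
  shows "twist X \<A> I U (\<lambda>i j k x. \<theta> (i, j, x) (j, k, x))"
proof
  have comp: "((i, j, p), (j, k, p)) \<in> gpd_composable I U"
    if "i \<in> I" "j \<in> I" "k \<in> I" "p \<in> U i" "p \<in> U j" "p \<in> U k" for i j k p
    using that by (simp add: gpd_composable_def gpd_arrows_def)
  have g': "\<forall>\<alpha>\<in>I. \<forall>\<beta>\<in>I. \<forall>\<gamma>\<in>I. smooth_fun \<A> (U \<alpha> \<inter> U \<beta> \<inter> U \<gamma>) (\<lambda>x. \<theta> (\<alpha>, \<beta>, x) (\<beta>, \<gamma>, x))"
    "\<forall>(r, r')\<in>gpd_composable I U. cmod (\<theta> r r') = 1"
    "\<forall>(r, r')\<in>gpd_composable I U. \<forall>r''. (r', r'') \<in> gpd_composable I U \<longrightarrow>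
        \<theta> r' r'' * \<theta> r (gpd_mult r' r'') = \<theta> r r' * \<theta> (gpd_mult r r') r''"
    "\<forall>(r, r')\<in>gpd_composable I U. \<theta> r' (gpd_inv (gpd_mult r r')) = \<theta> r r'"
    "\<forall>(r, r')\<in>gpd_composable I U. \<theta> (gpd_inv r') (gpd_inv r) = inverse (\<theta> r r')"
    using g unfolding gerbe_def by blast+
  show "openin X (U j)" if "j \<in> I" for j using cover that by (simp add: leray_cover_def)
  show "smooth_fun \<A> (U i \<inter> U j \<inter> U k) (\<lambda>x. \<theta> (i, j, x) (j, k, x))" if "i \<in> I" "j \<in> I" "k \<in> I" for i j k
    using g'(1) that by blast
  fix i j k p assume a: "i \<in> I" "j \<in> I" "k \<in> I" "p \<in> U i" "p \<in> U j" "p \<in> U k"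
  have "cmod (\<theta> (i, j, p) (j, k, p)) = 1" using bspec[OF g'(2) comp[OF a]] by simp
  then show "\<theta> (i, j, p) (j, k, p) \<noteq> 0" by auto
  show "\<theta> (j, k, p) (k, i, p) = \<theta> (i, j, p) (j, k, p)" using bspec[OF g'(4) comp[OF a]] by simp
  show "\<theta> (k, j, p) (j, i, p) = inverse (\<theta> (i, j, p) (j, k, p))" using bspec[OF g'(5) comp[OF a]] by simp
  fix l assume l: "l \<in> I" "p \<in> U l"
  show "\<theta> (j, k, p) (k, l, p) * \<theta> (i, j, p) (j, l, p) = \<theta> (i, k, p) (k, l, p) * \<theta> (i, j, p) (j, k, p)"
    using bspec[OF g'(3) comp[OF a]] comp[OF a(2,3) l(1) a(5,6) l(2)] by (simp add: mult.commute)
qed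

lemma (in smooth_mfd) root_cocycle_twist:
  assumes cover: "leray_cover X J V" and h: "root_cocycle X n J V h" and n: "n > 0"
  shows "twist X \<A> J V h"
proof
  show o: "openin X (V j)" if "j \<in> J" for j using cover that by (simp add: leray_cover_def)
  show "smooth_fun \<A> (V i \<inter> V j \<inter> V k) (h i j k)" if "i \<in> J" "j \<in> J" "k \<in> J" for i j k
    using h that o by (intro locally_constant_smooth) (auto simp: root_cocycle_def)
  fix i j k p assume a: "i \<in> J" "j \<in> J" "k \<in> J" "p \<in> V i" "p \<in> V j" "p \<in> V k"
  then have r: "h i j k p ^ n = 1 \<and> h j k i p = h i j k p \<and> h k j i p = inverse (h i j k p)"
    using h unfolding root_cocycle_def by blast
  show "h i j k p \<noteq> 0"
  proof
    assume "h i j k p = 0"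
    then show False using r n by (simp add: zero_power)
  qed
  show "h j k i p = h i j k p" "h k j i p = inverse (h i j k p)" using r by auto
  fix l assume "l \<in> J" "p \<in> V l"
  then show "h j k l p * h i j l p = h i k l p * h i j k p"
    using h a unfolding root_cocycle_def by blast
qed

lemma exp_int_multiple: "exp (2 * pi * \<i> * of_int k) = 1"
  using exp_integer_2pi[of "of_int k"] by (simp add: mult_ac)

theorem proposition7p2p9:
  fixes X :: "'a topology"
    and \<A> :: "('a set \<times> ('a \<Rightarrow> 'e::real_inner)) set"
    and I :: "'i set" and U :: "'i \<Rightarrow> 'a set"
    and \<theta> :: "'i \<times> 'i \<times> 'a \<Rightarrow> 'i \<times> 'i \<times> 'a \<Rightarrow> complex"
    and H :: "(('a \<Rightarrow> 'a set) \<times> ('a list \<Rightarrow> 'a \<Rightarrow> int)) set"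
    and J :: "'j set" and V :: "'j \<Rightarrow> 'a set"
    and h :: "'j \<Rightarrow> 'j \<Rightarrow> 'j \<Rightarrow> 'a \<Rightarrow> complex"
  assumes "smooth_manifold X \<A>"
    and "leray_cover X I U"
    and "gerbe \<A> I U \<theta>"
    and "H \<in> carrier (cech_H3 X)"
    and "characteristic_class X \<A> I U \<theta> H"
    and "group.ord (cech_H3 X) H > 0"
    and "torsion_twist X H J V h"
  shows "gpd_K \<A> I U \<theta> \<cong> twisted_K \<A> J V h"
proof -
  interpret smooth_mfd X \<A> by unfold_locales (rule assms(1))
  let ?\<theta> = "\<lambda>i j k x. \<theta> (i, j, x) (j, k, x)"
  have V: "leray_cover X J V" and h: "root_cocycle X (group.ord (cech_H3 X) H) J V h"
    and cV: "connecting_image X (locally_constant X) J V h H"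
    using assms(7) by (auto simp: torsion_twist_def)
  interpret A: twist X \<A> I U ?\<theta> by (rule gerbe_twist[OF assms(2,3)])
  interpret B: twist X \<A> J V h by (rule root_cocycle_twist[OF V h assms(6)])
  obtain W' c' where H: "(W', c') \<in> H" using cech_H3_nonempty[OF assms(4)] by auto
  have cU: "connecting_image X (smooth_fun \<A>) I U ?\<theta> H" using assms(5) by (simp add: characteristic_class_def)
  have covU: "(\<Union>i\<in>I. U i) = topspace X" and covV: "(\<Union>j\<in>J. V j) = topspace X"
    using assms(2) V by (auto simp: leray_cover_def)
  have contr: "contractible_space (subtopology X (C j))" if "leray_cover X K C" "j \<in> K" for C :: "'k \<Rightarrow> 'a set" and K j
    using that unfolding leray_cover_def by (metis (no_types, lifting) INF_insert INF_empty inf_top.right_neutral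
        empty_not_insert empty_subsetI finite.emptyI finite.insertI insert_subset)
  obtain \<tau> W1 f1 b1 where "connecting_lift X (smooth_fun \<A>) I U ?\<theta> c' \<tau> W1 f1 b1"
    using connecting_image_lift[OF cU covU H] by blast
  note T1 = connecting_liftD[OF this]
  obtain \<sigma> W2 f2 b2 where "connecting_lift X (locally_constant X) J V h c' \<sigma> W2 f2 b2"
    using connecting_image_lift[OF cV covV H] by blast
  note T2 = connecting_liftD[OF this]
  define W where "W = (\<lambda>x. W1 x \<inter> W2 x)"
  have W: "openin X (W x)" "x \<in> W x" "W x \<subseteq> U (\<tau> x)" "W x \<subseteq> V (\<sigma> x)" if "x \<in> topspace X" for x
    using T1(2-4)[OF that] T2(2-4)[OF that] by (auto simp: W_def)
  interpret RA: refinement X \<A> I U ?\<theta> W \<tau>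
    by unfold_locales (use contr[OF assms(2)] T1(1) W in auto)
  interpret RB: refinement X \<A> J V h W \<sigma>
    by unfold_locales (use contr[OF V] T2(1) W in auto)
  define F where "F = (\<lambda>x y z p. f1 x y z p - f2 x y z p - of_int (b1 x y z p) - (- of_int (b2 x y z p)))"
  have F_smooth: "smooth_fun \<A> (W x \<inter> W y \<inter> W z) (F x y z)"
    if a: "x \<in> topspace X" "y \<in> topspace X" "z \<in> topspace X" for x y z
  proof -
    let ?W = "W x \<inter> W y \<inter> W z"
    have o: "openin X ?W" using W(1) a by blast
    have oU: "openin X (U (\<tau> x) \<inter> U (\<tau> y) \<inter> U (\<tau> z))" using A.V_open T1(1) a by blast
    have oV: "openin X (V (\<sigma> x) \<inter> V (\<sigma> y) \<inter> V (\<sigma> z))" using B.V_open T2(1) a by blast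
    have o1: "openin X (W1 x \<inter> W1 y \<inter> W1 z)" and o2: "openin X (W2 x \<inter> W2 y \<inter> W2 z)"
      using T1(2) T2(2) a by blast+
    show ?thesis
      unfolding F_def
    proof (intro smooth_fun_minus o)
      show "smooth_fun \<A> ?W (f1 x y z)"
        by (rule smooth.subset[OF oU o T1(5)[OF a]]) (use W(3) a in blast)
      show "smooth_fun \<A> ?W (f2 x y z)"
        by (rule smooth.subset[OF oV o locally_constant_smooth[OF oV T2(5)[OF a]]]) (use W(4) a in blast)
      show "smooth_fun \<A> ?W (\<lambda>p. of_int (b1 x y z p))"
        by (rule smooth.subset[OF o1 o locally_constant_smooth[OF o1 locally_constant_compose[OF T1(6)[OF a]]]])
          (auto simp: W_def)
      show "smooth_fun \<A> ?W (\<lambda>p. - of_int (b2 x y z p))"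
        by (rule smooth.subset[OF o2 o locally_constant_smooth[OF o2 locally_constant_compose[OF T2(6)[OF a]]]])
          (auto simp: W_def)
    qed
  qed
  have F_cocycle: "F x y z p - F w y z p + F w x z p - F w x y p = 0"
    if a: "w \<in> topspace X" "x \<in> topspace X" "y \<in> topspace X" "z \<in> topspace X" "p \<in> W w" "p \<in> W x" "p \<in> W y" "p \<in> W z"
    for w x y z p
  proof -
    have p1: "p \<in> W1 w" "p \<in> W1 x" "p \<in> W1 y" "p \<in> W1 z" and p2: "p \<in> W2 w" "p \<in> W2 x" "p \<in> W2 y" "p \<in> W2 z"
      using a(5-8) by (auto simp: W_def)
    have "F x y z p - F w y z p + F w x z p - F w x y p =
        (f1 x y z p - f1 w y z p + f1 w x z p - f1 w x y p) - (f2 x y z p - f2 w y z p + f2 w x z p - f2 w x y p)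
        - (of_int (b1 x y z p) - of_int (b1 w y z p) + of_int (b1 w x z p) - of_int (b1 w x y p))
        + (of_int (b2 x y z p) - of_int (b2 w y z p) + of_int (b2 w x z p) - of_int (b2 w x y p))"
      by (simp add: F_def algebra_simps)
    also have "\<dots> = 0" unfolding T1(8)[OF a(1-4) p1] T2(8)[OF a(1-4) p2] by simp
    finally show ?thesis .
  qed
  obtain \<mu> where \<mu>: "\<And>x y. x \<in> topspace X \<Longrightarrow> y \<in> topspace X \<Longrightarrow> smooth_fun \<A> (W x \<inter> W y) (\<mu> x y)"
    "\<And>x y z p. x \<in> topspace X \<Longrightarrow> y \<in> topspace X \<Longrightarrow> z \<in> topspace X \<Longrightarrow> p \<in> W x \<inter> W y \<inter> W z \<Longrightarrow>
       F x y z p = \<mu> y z p - \<mu> x z p + \<mu> x y p"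
    using smooth_cocycle_coboundary[of W F, OF W(1,2) F_smooth F_cocycle] by blast
  define l where "l = (\<lambda>x y p. exp (2 * pi * \<i> * \<mu> x y p))"
  have "scaling X \<A> (topspace X) W RB.h\<sigma> RA.h\<sigma> l"
  proof (rule scaling_of_coboundary[OF RB.refined_twist RA.refined_twist])
    fix x y assume xy: "x \<in> topspace X" "y \<in> topspace X"
    have o: "openin X (W x \<inter> W y)" using W(1) xy by blast
    show "smooth_fun \<A> (W x \<inter> W y) (l x y)"
      unfolding l_def by (intro smooth_fun_exp smooth.mult smooth.const o \<mu>(1) xy)
    fix z p assume z: "z \<in> topspace X" and p: "p \<in> W x" "p \<in> W y" "p \<in> W z"
    let ?e = "\<lambda>c. exp (2 * pi * \<i> * c)"
    have e: "?e (c - d) = ?e c / ?e d" "?e (c + d) = ?e c * ?e d" for c d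
      by (simp_all add: exp_diff exp_add algebra_simps)
    have "?e (F x y z p) = ?e (f1 x y z p) / ?e (f2 x y z p)"
      unfolding F_def e using exp_int_multiple[of "b1 x y z p"] exp_int_multiple[of "- b2 x y z p"] by simp
    also have "\<dots> = RA.h\<sigma> x y z p / RB.h\<sigma> x y z p"
      using T1(7)[OF xy z] T2(7)[OF xy z] p by (simp add: W_def)
    finally have "RA.h\<sigma> x y z p = ?e (F x y z p) * RB.h\<sigma> x y z p"
      using RB.R.h_nz[OF xy z p] by simp
    also have "?e (F x y z p) = l x y p * l y z p / l x z p"
      unfolding \<mu>(2)[OF xy z IntI[OF IntI[OF p(1,2)] p(3)]] e l_def by simp
    finally show "RA.h\<sigma> x y z p = l x y p * l y z p / l x z p * RB.h\<sigma> x y z p" .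
  qed (simp add: l_def)
  then interpret S: scaling X \<A> "topspace X" W RB.h\<sigma> RA.h\<sigma> l .
  have "mult_iso A.bundle_monoid B.bundle_monoid"
    by (rule mult_iso_trans[OF RA.mult_iso_refinement mult_iso_trans[OF mult_iso_sym[OF S.mult_iso_scale]
            mult_iso_sym[OF RB.mult_iso_refinement]]])
  then show ?thesis
    unfolding gpd_K_def B.twisted_K_eq
    by (intro mult_iso_grothendieck mult_iso_trans[OF gpd_mult_iso[OF A.twist_axioms]])
qed

end
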